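(* $X_\lambda$ is smooth if and only if $\lambda$ is even.
   Context: Let $K$ be an algebraically closed field of characteristic zero, $d\ge 1$ an integer, $V=K[x,y]_1$ the space of linear forms in $x,y$. A closed point $(a_0:\cdots:a_k)$ of $\mathbb{P}(\mathrm{Sym}^kV)\cong\mathbb{P}^k_K$ is identified with the binary form $\sum_{j=0}^k a_jx^{k-j}y^j$ up to scalars in $K^*$. Let $\lambda=(\lambda_1,\dots,\lambda_e)$ be a partition of $d$, also written $\lambda=(1^{e_1}2^{e_2}\cdots d^{e_d})$, where $e_r\ge0$ is the number of $\lambda_i$ equal to $r$. Put $Y_\lambda=\prod_{r=1}^d\mathbb{P}(\mathrm{Sym}^{e_r}V)$, let $f_\lambda:Y_\lambda\to\mathbb{P}(\mathrm{Sym}^dV)$ be the morphism $(G_1,\dots,G_d)\mapsto\prod_{r=1}^dG_r^r$, and let the coincident root locus $X_\lambda=\mathrm{im}(f_\lambda)$ be its image, an integral closed subscheme of $\mathbb{P}(\mathrm{Sym}^dV)$; its closed points are the forms $\prod_{i=1}^eL_i^{\lambda_i}$ with $L_1,\dots,L_e$ nonzero linear forms. The partition $\lambda=(\lambda_1,\dots,\lambda_e)$ is called even if $\lambda_1=\cdots=\lambda_e$. *)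

theory Defs
  imports
    "HOL-Computational_Algebra.Polynomial"
    "HOL-Library.Poly_Mapping"
    "HOL-Library.Function_Algebras"
    "HOL-Library.Extended_Nat"
    "HOL-Analysis.Function_Topology"
begin

section \<open>Polynomials in variables indexed by natural numbers\<close>

text \<open>A monomial is its exponent vector, and a polynomial is the finitely supported family of its
  coefficients; multiplication is the convolution product of \<^theory>\<open>HOL-Library.Poly_Mapping\<close>.\<close>

type_synonym 'a mpoly = "(nat \<Rightarrow>\<^sub>0 nat) \<Rightarrow>\<^sub>0 'a"

definition mpoly_ring :: "nat set \<Rightarrow> 'a::zero mpoly set" where
  "mpoly_ring J = {f. \<forall>m\<in>Poly_Mapping.keys f. Poly_Mapping.keys m \<subseteq> J}"

definition meval :: "(nat \<Rightarrow> 'a) \<Rightarrow> 'a::comm_ring_1 mpoly \<Rightarrow> 'a" where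
  "meval p f =
     (\<Sum>m\<in>Poly_Mapping.keys f.
        Poly_Mapping.lookup f m * (\<Prod>j\<in>Poly_Mapping.keys m. p j ^ Poly_Mapping.lookup m j))"

text \<open>The formal partial derivative. The exponent subtraction truncates only when
  \<^term>\<open>Poly_Mapping.lookup m j = 0\<close>, and then the coefficient vanishes.\<close>

definition mpderiv :: "nat \<Rightarrow> 'a::comm_ring_1 mpoly \<Rightarrow> 'a mpoly" where
  "mpderiv j f =
     (\<Sum>m\<in>Poly_Mapping.keys f.
        Poly_Mapping.single (m - Poly_Mapping.single j 1)
          (of_nat (Poly_Mapping.lookup m j) * Poly_Mapping.lookup f m))"


section \<open>Affine spaces, Zariski topology and Krull dimension\<close>

text \<open>Affine space with coordinates indexed by \<open>J\<close>; coordinates outside \<open>J\<close> are set to \<open>0\<close>.\<close>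

definition aff_space :: "nat set \<Rightarrow> (nat \<Rightarrow> 'a::zero) set" where
  "aff_space J = {p. \<forall>j. j \<notin> J \<longrightarrow> p j = 0}"

text \<open>The sets \<open>D(f) = {f \<noteq> 0}\<close> are a basis of the Zariski topology, as
  \<open>D(f) \<inter> D(g) = D(fg)\<close>; so its closed sets are the common zero loci of sets of polynomials.\<close>

definition zariski :: "nat set \<Rightarrow> (nat \<Rightarrow> 'a::field) topology" where
  "zariski J = topology_generated_by {{p \<in> aff_space J. meval p f \<noteq> 0} | f. f \<in> mpoly_ring J}"

definition irreducible_in :: "'b topology \<Rightarrow> 'b set \<Rightarrow> bool" where
  "irreducible_in T S \<longleftrightarrow>
     S \<subseteq> topspace T \<and> S \<noteq> {} \<and>
     (\<forall>A B. closedin T A \<and> closedin T B \<and> S \<subseteq> A \<union> B \<longrightarrow> S \<subseteq> A \<or> S \<subseteq> B)"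

text \<open>The supremum of the lengths \<open>n\<close> of chains \<open>C\<^sub>0 \<subset> C\<^sub>1 \<subset> \<dots> \<subset> C\<^sub>n\<close> of irreducible closed subsets.\<close>

definition krull_dim :: "'b topology \<Rightarrow> enat" where
  "krull_dim T = Sup {enat n | n. \<exists>C :: nat \<Rightarrow> 'b set.
     (\<forall>i\<le>n. closedin T (C i) \<and> irreducible_in T (C i)) \<and> (\<forall>i<n. C i \<subset> C (Suc i))}"

definition vanishing_ideal :: "nat set \<Rightarrow> (nat \<Rightarrow> 'a::field) set \<Rightarrow> 'a mpoly set" where
  "vanishing_ideal J Z = {f \<in> mpoly_ring J. \<forall>p\<in>Z. meval p f = 0}"


section \<open>Tangent spaces and smoothness\<close>

definition fscale :: "'a::field \<Rightarrow> (nat \<Rightarrow> 'a) \<Rightarrow> nat \<Rightarrow> 'a" where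
  "fscale c v = (\<lambda>j. c * v j)"

lemma vector_space_fscale: "vector_space fscale"
  by unfold_locales (auto simp: fscale_def fun_eq_iff algebra_simps)

text \<open>The Zariski tangent space at \<open>p\<close>, i.e. the kernel of the Jacobian matrix at \<open>p\<close> of the ideal
  of \<open>Z\<close>. It is a subspace of the vector space given by \<^const>\<open>fscale\<close>.\<close>

definition tangent_space ::
  "nat set \<Rightarrow> (nat \<Rightarrow> 'a::field) set \<Rightarrow> (nat \<Rightarrow> 'a) \<Rightarrow> (nat \<Rightarrow> 'a) set" where
  "tangent_space J Z p =
     {v \<in> aff_space J. \<forall>f\<in>vanishing_ideal J Z. (\<Sum>j\<in>J. meval p (mpderiv j f) * v j) = 0}"

text \<open>For \<open>J\<close> finite, the ground field algebraically closed and \<open>Z\<close> closed and irreducible (so that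
  the local dimension of \<open>Z\<close> at each point is the dimension of \<open>Z\<close>), this says that the rank of the
  Jacobian matrix at \<open>p\<close> is \<open>card J - dim Z\<close>.\<close>

definition aff_smooth_at :: "nat set \<Rightarrow> (nat \<Rightarrow> 'a::field) set \<Rightarrow> (nat \<Rightarrow> 'a) \<Rightarrow> bool" where
  "aff_smooth_at J Z p \<longleftrightarrow>
     enat (vector_space.dim fscale (tangent_space J Z p)) = krull_dim (subtopology (zariski J) Z)"


section \<open>Projective space\<close>

text \<open>A point of \<open>P\<^sup>n\<close> is the set of its homogeneous coordinate vectors \<open>(a\<^sub>0, \<dots>, a\<^sub>n) \<noteq> 0\<close>.\<close>

definition hom_coords :: "nat \<Rightarrow> (nat \<Rightarrow> 'a::field) set" where
  "hom_coords n = aff_space {..n} - {0}"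

definition proj_point :: "(nat \<Rightarrow> 'a::field) \<Rightarrow> (nat \<Rightarrow> 'a) set" where
  "proj_point a = {fscale c a | c. c \<noteq> 0}"

definition proj_space :: "nat \<Rightarrow> (nat \<Rightarrow> 'a::field) set set" where
  "proj_space n = proj_point ` hom_coords n"

text \<open>The intersection of \<open>X \<subseteq> P\<^sup>n\<close> with the chart where the \<open>i\<close>-th coordinate is nonzero (and
  normalised to \<open>1\<close>), as a subset of the affine space with coordinates indexed by
  \<open>{0,\<dots>,n} - {i}\<close>.\<close>

definition proj_chart :: "nat \<Rightarrow> nat \<Rightarrow> (nat \<Rightarrow> 'a::field) set set \<Rightarrow> (nat \<Rightarrow> 'a) set" where
  "proj_chart n i X = {p \<in> aff_space ({..n} - {i}). proj_point (p(i := 1)) \<in> X}"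

text \<open>Smoothness of an irreducible closed subset \<open>X \<subseteq> P\<^sup>n\<close>, with its reduced structure, over an
  algebraically closed field (where it suffices to look at closed points).\<close>

definition proj_smooth :: "nat \<Rightarrow> (nat \<Rightarrow> 'a::field) set set \<Rightarrow> bool" where
  "proj_smooth n X \<longleftrightarrow>
     (\<forall>i\<le>n. \<forall>p\<in>proj_chart n i X. aff_smooth_at ({..n} - {i}) (proj_chart n i X) p)"


section \<open>Binary forms and coincident root loci\<close>

text \<open>The monomial \<open>x\<^sup>p y\<^sup>q\<close>, with \<open>x\<close> and \<open>y\<close> the variables of index \<open>0\<close> and \<open>1\<close>.\<close>

definition xy_monom :: "nat \<Rightarrow> nat \<Rightarrow> (nat \<Rightarrow>\<^sub>0 nat)" where
  "xy_monom p q = Poly_Mapping.single 0 p + Poly_Mapping.single 1 q"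

definition binary_form :: "nat \<Rightarrow> (nat \<Rightarrow> 'a) \<Rightarrow> 'a::field mpoly" where
  "binary_form k a = (\<Sum>j\<le>k. Poly_Mapping.single (xy_monom (k - j) j) (a j))"

definition form_coords :: "nat \<Rightarrow> 'a::field mpoly \<Rightarrow> nat \<Rightarrow> 'a" where
  "form_coords k F = (\<lambda>j. if j \<le> k then Poly_Mapping.lookup F (xy_monom (k - j) j) else 0)"

definition is_partition :: "nat \<Rightarrow> nat list \<Rightarrow> bool" where
  "is_partition d lam \<longleftrightarrow>
     sorted_wrt (\<ge>) lam \<and> (\<forall>r\<in>set lam. r > 0) \<and> sum_list lam = d"

definition even_partition :: "nat list \<Rightarrow> bool" where
  "even_partition lam \<longleftrightarrow> (\<forall>i<length lam. \<forall>j<length lam. lam ! i = lam ! j)"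

text \<open>Homogeneous coordinates of the points \<open>(G\<^sub>1, \<dots>, G\<^sub>d)\<close> of \<open>Y\<^sub>\<lambda>\<close>, and the morphism \<open>f\<^sub>\<lambda>\<close> in terms
  of them: rescaling the \<open>G\<^sub>r\<close> rescales the product, so the resulting point of \<open>P\<^sup>d\<close> only depends
  on the point of \<open>Y\<^sub>\<lambda>\<close>. Here \<^term>\<open>count_list lam r\<close> is \<open>e\<^sub>r\<close>.\<close>

definition Y_coords :: "nat \<Rightarrow> nat list \<Rightarrow> (nat \<Rightarrow> nat \<Rightarrow> 'a::field) set" where
  "Y_coords d lam = (\<Pi>\<^sub>E r\<in>{1..d}. hom_coords (count_list lam r))"

definition f_map :: "nat \<Rightarrow> nat list \<Rightarrow> (nat \<Rightarrow> nat \<Rightarrow> 'a::field) \<Rightarrow> (nat \<Rightarrow> 'a) set" where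
  "f_map d lam G =
     proj_point (form_coords d (\<Prod>r\<in>{1..d}. binary_form (count_list lam r) (G r) ^ r))"

definition coincident_root_locus :: "nat \<Rightarrow> nat list \<Rightarrow> (nat \<Rightarrow> 'a::field) set set" where
  "coincident_root_locus d lam = f_map d lam ` Y_coords d lam"

end

theory Submission
  imports Defs "HOL-Computational_Algebra.Formal_Laurent_Series" "HOL-Computational_Algebra.Polynomial_FPS"
begin

text \<open>
  Setting \<open>x = 1\<close> turns binary forms of degree \<open>k\<close> into univariate polynomials of degree at most
  \<open>k\<close> in \<open>y\<close>, and over an algebraically closed field \<open>X\<^sub>\<lambda>\<close> becomes the set of classes of products
  \<open>\<Prod>s\<in>I. L\<^sub>s ^ w\<^sub>s\<close> of nonzero linear forms, where \<open>I\<close> has one element for each of the \<open>e\<close> parts and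
  \<open>w\<^sub>s\<close> is that part (\<open>coincident_root_locus_eq\<close>). Smoothness compares the Krull dimension of the
  affine charts with the dimension of their tangent spaces.

  \<^emph>\<open>The dimension is at most \<open>e\<close>.\<close> Along a chain \<open>C\<^sub>0 \<subset> \<dots> \<subset> C\<^sub>n\<close> of irreducible closed sets choose
  functions \<open>g\<^sub>k\<close> that vanish on \<open>C\<^sub>k\<close> but not on \<open>C\<^sub>k\<^sub>+\<^sub>1\<close>. Dividing a relation by one \<open>g\<^sub>k\<close> at a time
  shows that they are algebraically independent on \<open>C\<^sub>n\<close> (\<open>chain_monomials_independent\<close>). But a
  function on a chart, pulled back to the coefficients of the \<open>L\<^sub>s\<close> and cleared of denominators, is
  homogeneous in each \<open>L\<^sub>s\<close>, and such functions of degree proportional to \<open>N\<close> form a space of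
  dimension \<open>O(N^e)\<close>. Counting the \<open>(N + 1)^n\<close> monomials in the \<open>g\<^sub>k\<close> gives \<open>n \<le> e\<close>
  (\<open>krull_dim_le_card\<close>).

  \<^emph>\<open>Unequal parts give a singular point.\<close> The chart \<open>a\<^sub>0 = 1\<close> contains the coefficient vectors of
  \<open>\<Prod>s\<in>I. (1 + b\<^sub>s y) ^ w\<^sub>s\<close>; look at the origin \<open>b = 0\<close>, the form \<open>x^d\<close>. Let \<open>f\<close> vanish on the chart
  and let \<open>c\<close> be its derivative at the origin in direction \<open>a\<^sub>k\<^sub>+\<^sub>1\<close>. Differentiating \<open>f = 0\<close> in \<open>b\<^sub>s\<close>
  and extracting the part of weight \<open>k\<close> for the scaling of \<open>b\<close> produces a polynomial of degree at
  most \<open>k\<close>, with coefficient \<open>\<plusminus>c\<close> at \<open>T^k\<close>, that vanishes at every \<open>b\<^sub>s\<close>. For \<open>k < e\<close> this forces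
  \<open>c = 0\<close>. For \<open>k = e\<close> it equals \<open>\<plusminus>c (\<Prod>s\<in>I. T - b\<^sub>s)\<close>, and its next coefficient says that the linear
  forms \<open>c (\<Sum>s\<in>I. b\<^sub>s)\<close> and \<open>\<Sum>s\<in>I. w\<^sub>s b\<^sub>s\<close> are proportional; with two different weights again \<open>c = 0\<close>
  (\<open>linear_derivatives_vanish\<close>). So the tangent space contains \<open>e + 1\<close> independent directions.

  \<^emph>\<open>Equal parts give a smooth variety.\<close> Now the locus consists of the powers \<open>G^r\<close> with
  \<open>deg G \<le> e\<close>. Its points satisfy a differential equation: the derivative of order \<open>e + 1\<close> of the
  \<open>r\<close>-th root vanishes, and up to a power of \<open>F\<close> that derivative is a differential polynomial in
  \<open>F = G^r\<close>. Its linearization at \<open>G^r\<close> says that a tangent vector has the form \<open>G^(r-1) H\<close> with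
  \<open>deg H \<le> e\<close>, and the curves \<open>(G + t H)^r\<close> show that all of these occur
  (\<open>tangent_space_power_locus\<close>). The chart imposes one linear condition on the \<open>e + 1\<close> coefficients
  of \<open>H\<close>, which leaves dimension \<open>e\<close>. A chain of length \<open>e\<close> is cut out by the conditions
  \<open>F(-1) = \<dots> = F(-m) = 0\<close> (\<open>krull_dim_ge\<close>), so the dimension is exactly \<open>e\<close>.
\<close>


section \<open>Evaluation and differentiation of polynomials\<close>

definition monom_val :: "(nat \<Rightarrow> 'a) \<Rightarrow> (nat \<Rightarrow>\<^sub>0 nat) \<Rightarrow> 'a::comm_ring_1" where
  "monom_val p m = (\<Prod>j\<in>Poly_Mapping.keys m. p j ^ Poly_Mapping.lookup m j)"

lemma monom_val_superset:
  assumes "finite S" "Poly_Mapping.keys m \<subseteq> S"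
  shows "monom_val p m = (\<Prod>j\<in>S. p j ^ Poly_Mapping.lookup m j)"
  unfolding monom_val_def
  by (rule prod.mono_neutral_left) (use assms in \<open>auto simp: in_keys_iff\<close>)

lemma monom_val_add: "monom_val p (m + n) = monom_val p m * monom_val p n"
proof -
  let ?S = "Poly_Mapping.keys m \<union> Poly_Mapping.keys n"
  have "Poly_Mapping.keys (m + n) \<subseteq> ?S" by (rule keys_add)
  then show ?thesis
    using monom_val_superset[of ?S "m + n" p] monom_val_superset[of ?S m p]
      monom_val_superset[of ?S n p]
    by (simp add: lookup_add power_add prod.distrib)
qed

lemma meval_single: "meval p (Poly_Mapping.single m c) = c * monom_val p m"
  by (simp add: meval_def monom_val_def)

lemma meval_add: "meval p (f + g) = meval p f + meval p g"
  unfolding meval_def monom_val_def[symmetric]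
  by (rule setsum_keys_plus_distrib[of "\<lambda>m c. c * monom_val p m"]) (simp_all add: algebra_simps)

lemma meval_zero: "meval p 0 = 0"
  by (simp add: meval_def)

lemma meval_sum: "meval p (sum f S) = (\<Sum>s\<in>S. meval p (f s))"
  by (induction S rule: infinite_finite_induct) (simp_all add: meval_add meval_zero)

lemma sum_of_terms: "f = (\<Sum>m\<in>Poly_Mapping.keys f. Poly_Mapping.single m (Poly_Mapping.lookup f m))"
proof (rule poly_mapping_eqI)
  fix k
  show "Poly_Mapping.lookup f k =
    Poly_Mapping.lookup (\<Sum>m\<in>Poly_Mapping.keys f. Poly_Mapping.single m (Poly_Mapping.lookup f m)) k"
    by (simp add: lookup_sum lookup_single when_def sum.delta in_keys_iff)
qed

lemma product_of_terms:
  "f * g = (\<Sum>m\<in>Poly_Mapping.keys f. \<Sum>n\<in>Poly_Mapping.keys g.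
     Poly_Mapping.single m (Poly_Mapping.lookup f m) * Poly_Mapping.single n (Poly_Mapping.lookup g n))"
  by (subst sum_of_terms[of f], subst sum_of_terms[of g]) (rule sum_product)

lemma meval_mult: "meval p (f * g) = meval p f * meval p g"
proof -
  have "meval p (f * g) = (\<Sum>m\<in>Poly_Mapping.keys f. \<Sum>n\<in>Poly_Mapping.keys g.
     (Poly_Mapping.lookup f m * monom_val p m) * (Poly_Mapping.lookup g n * monom_val p n))"
    by (subst product_of_terms) (simp add: meval_sum mult_single meval_single monom_val_add algebra_simps)
  also have "\<dots> = meval p f * meval p g"
    by (simp add: meval_def monom_val_def sum_product)
  finally show ?thesis .
qed

abbreviation mconst :: "'a \<Rightarrow> 'a::comm_ring_1 mpoly" where
  "mconst c \<equiv> Poly_Mapping.single 0 c"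

definition mvar :: "nat \<Rightarrow> 'a::comm_ring_1 mpoly" where
  "mvar j = Poly_Mapping.single (Poly_Mapping.single j 1) 1"

lemma meval_const: "meval p (mconst c) = c"
  by (simp add: meval_single monom_val_def)

lemma meval_var: "meval p (mvar j) = p j"
  by (simp add: meval_single monom_val_def mvar_def)

lemma mpderiv_zero: "mpderiv j 0 = 0"
  by (simp add: mpderiv_def)

lemma mpderiv_single:
  "mpderiv j (Poly_Mapping.single m c) =
     Poly_Mapping.single (m - Poly_Mapping.single j 1) (of_nat (Poly_Mapping.lookup m j) * c)"
  by (simp add: mpderiv_def)

lemma mpderiv_add: "mpderiv j (f + g) = mpderiv j f + mpderiv j g"
  unfolding mpderiv_def
  by (rule setsum_keys_plus_distrib[of "\<lambda>m c. Poly_Mapping.single (m - Poly_Mapping.single j 1)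
        (of_nat (Poly_Mapping.lookup m j) * c)"]) (simp_all add: algebra_simps single_add)

lemma mpderiv_sum: "mpderiv j (sum f S) = (\<Sum>s\<in>S. mpderiv j (f s))"
  by (induction S rule: infinite_finite_induct) (simp_all add: mpderiv_add mpderiv_zero)

lemma mpderiv_mult_single:
  fixes a b :: "'a::comm_ring_1"
  shows "mpderiv j (Poly_Mapping.single m a * Poly_Mapping.single n b) =
    mpderiv j (Poly_Mapping.single m a) * Poly_Mapping.single n b +
    Poly_Mapping.single m a * mpderiv j (Poly_Mapping.single n b)"
proof -
  let ?e = "Poly_Mapping.single j 1 :: nat \<Rightarrow>\<^sub>0 nat"
  have shift: "(k - ?e) + l = (k + l) - ?e" if "Poly_Mapping.lookup k j \<noteq> 0" for k l
    by (rule poly_mapping_eqI) (use that in \<open>auto simp: lookup_add lookup_minus lookup_single when_def\<close>)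
  have *: "Poly_Mapping.single ((k - ?e) + l) (of_nat (Poly_Mapping.lookup k j) * c) =
      Poly_Mapping.single ((k + l) - ?e) (of_nat (Poly_Mapping.lookup k j) * c)" for k l and c :: 'a
    by (cases "Poly_Mapping.lookup k j = 0") (simp_all only: shift not_False_eq_True of_nat_0 mult_zero_left single_zero)
  show ?thesis
    using *[of m n "a * b"] *[of n m "a * b"]
    by (simp add: mult_single mpderiv_single lookup_add algebra_simps flip: single_add)
qed

lemma mpderiv_mult: "mpderiv j (f * g) = mpderiv j f * g + f * mpderiv j g"
proof -
  have f: "mpderiv j f = (\<Sum>m\<in>Poly_Mapping.keys f. mpderiv j (Poly_Mapping.single m (Poly_Mapping.lookup f m)))" for f :: "'a mpoly"
    by (subst sum_of_terms[of f]) (rule mpderiv_sum)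
  have "mpderiv j (f * g) = (\<Sum>m\<in>Poly_Mapping.keys f. \<Sum>n\<in>Poly_Mapping.keys g.
     mpderiv j (Poly_Mapping.single m (Poly_Mapping.lookup f m)) * Poly_Mapping.single n (Poly_Mapping.lookup g n)) +
    (\<Sum>m\<in>Poly_Mapping.keys f. \<Sum>n\<in>Poly_Mapping.keys g.
     Poly_Mapping.single m (Poly_Mapping.lookup f m) * mpderiv j (Poly_Mapping.single n (Poly_Mapping.lookup g n)))"
    by (subst product_of_terms) (simp only: mpderiv_sum mpderiv_mult_single sum.distrib)
  also have "\<dots> = mpderiv j f * g + f * mpderiv j g"
    by (simp only: sum_product[symmetric] f[symmetric] sum_of_terms[symmetric])
  finally show ?thesis .
qed

lemma mpderiv_const: "mpderiv j (mconst c) = 0"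
  by (simp add: mpderiv_single)

lemma mpderiv_var: "mpderiv j (mvar k) = mconst (if j = k then 1 else 0)"
  by (auto simp: mpderiv_single lookup_single mvar_def)

lemma mpoly_ring_const: "mconst c \<in> mpoly_ring J"
  by (simp add: mpoly_ring_def)

lemma mpoly_ring_var: "j \<in> J \<Longrightarrow> mvar j \<in> mpoly_ring J"
  by (simp add: mpoly_ring_def mvar_def)

lemma mpoly_ring_zero: "0 \<in> mpoly_ring J"
  by (simp add: mpoly_ring_def)

lemma mpoly_ring_add: "f \<in> mpoly_ring J \<Longrightarrow> g \<in> mpoly_ring J \<Longrightarrow> f + g \<in> mpoly_ring J"
  using keys_add[of f g] by (auto simp: mpoly_ring_def)

lemma mpoly_ring_mult:
  assumes "f \<in> mpoly_ring J" "g \<in> mpoly_ring J" shows "f * g \<in> mpoly_ring J"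
proof -
  have "Poly_Mapping.keys m \<subseteq> J" if "m \<in> Poly_Mapping.keys (f * g)" for m
  proof -
    have "m \<in> {a + b |a b. a \<in> Poly_Mapping.keys f \<and> b \<in> Poly_Mapping.keys g}"
      using keys_mult[of f g] that by blast
    then obtain a b where ab: "m = a + b" "a \<in> Poly_Mapping.keys f" "b \<in> Poly_Mapping.keys g"
      by blast
    then have "Poly_Mapping.keys a \<subseteq> J" "Poly_Mapping.keys b \<subseteq> J"
      using assms by (auto simp: mpoly_ring_def)
    then show ?thesis using keys_add[of a b] ab by blast
  qed
  then show ?thesis by (auto simp: mpoly_ring_def)
qed

lemma mpoly_ring_sum: "(\<And>s. s \<in> S \<Longrightarrow> f s \<in> mpoly_ring J) \<Longrightarrow> sum f S \<in> mpoly_ring J"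
  by (induction S rule: infinite_finite_induct) (auto intro: mpoly_ring_add mpoly_ring_zero)

lemma mpoly_ring_mpderiv:
  assumes "f \<in> mpoly_ring J" shows "mpderiv j f \<in> mpoly_ring J"
  unfolding mpderiv_def
proof (rule mpoly_ring_sum)
  fix m assume "m \<in> Poly_Mapping.keys f"
  then have "Poly_Mapping.keys m \<subseteq> J" using assms by (auto simp: mpoly_ring_def)
  then have "Poly_Mapping.keys (m - Poly_Mapping.single j 1) \<subseteq> J"
    by (auto simp: in_keys_iff lookup_minus)
  then show "Poly_Mapping.single (m - Poly_Mapping.single j 1)
      (of_nat (Poly_Mapping.lookup m j) * Poly_Mapping.lookup f m) \<in> mpoly_ring J"
    by (simp add: mpoly_ring_def)
qed

lemma monomial_induct:
  fixes c :: "'a::comm_ring_1"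
  assumes "Poly_Mapping.keys m \<subseteq> J"
    and const: "\<And>c. P (mconst c)" and var: "\<And>j. j \<in> J \<Longrightarrow> P (mvar j)"
    and mult: "\<And>f g. f \<in> mpoly_ring J \<Longrightarrow> g \<in> mpoly_ring J \<Longrightarrow> P f \<Longrightarrow> P g \<Longrightarrow> P (f * g)"
  shows "P (Poly_Mapping.single m c)"
  using assms(1)
proof (induction "\<Sum>j\<in>Poly_Mapping.keys m. Poly_Mapping.lookup m j" arbitrary: m)
  case 0
  then have "m = 0" by (auto intro!: poly_mapping_eqI simp: in_keys_iff)
  then show ?case using const by simp
next
  case (Suc n)
  then obtain j where j: "j \<in> Poly_Mapping.keys m" by (metis Zero_not_Suc equals0I sum.empty)
  let ?e = "Poly_Mapping.single j 1 :: nat \<Rightarrow>\<^sub>0 nat"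
  define m' where "m' = m - ?e"
  have m: "m = ?e + m'"
    by (rule poly_mapping_eqI) (use j in \<open>auto simp: m'_def lookup_add lookup_minus lookup_single when_def in_keys_iff\<close>)
  have sub: "Poly_Mapping.keys m' \<subseteq> Poly_Mapping.keys m"
    by (auto simp: m'_def in_keys_iff lookup_minus)
  have "(\<Sum>j\<in>Poly_Mapping.keys m'. Poly_Mapping.lookup m' j) =
        (\<Sum>j\<in>Poly_Mapping.keys m. Poly_Mapping.lookup m' j)"
    by (rule sum.mono_neutral_left) (use sub in \<open>auto simp: in_keys_iff\<close>)
  moreover have "Suc n = 1 + (\<Sum>j\<in>Poly_Mapping.keys m. Poly_Mapping.lookup m' j)"
  proof -
    have "Poly_Mapping.lookup m i = (if i = j then 1 else 0) + Poly_Mapping.lookup m' i" for i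
      by (subst m) (simp add: lookup_add lookup_single when_def)
    then show ?thesis unfolding Suc(2) using j by (simp add: sum.distrib)
  qed
  ultimately have IH: "P (Poly_Mapping.single m' c)"
    using Suc(1)[of m'] sub Suc(3) by auto
  have jJ: "j \<in> J" using j Suc(3) by auto
  have "P (mvar j * Poly_Mapping.single m' c)"
    by (rule mult) (use jJ var IH sub Suc(3) in \<open>auto simp: mpoly_ring_def mvar_def\<close>)
  then show ?case by (simp only: mvar_def mult_single m[symmetric] mult_1)
qed

text \<open>Identities that are compatible with sums and products need only be checked on constants and
  variables; this is how the chain rule and all forms of clearing denominators are proved.\<close>

lemma mpoly_ring_induct [consumes 1, case_names const var add mult]:
  fixes f :: "'a::comm_ring_1 mpoly"
  assumes "f \<in> mpoly_ring J"
    and const: "\<And>c. P (mconst c)" and var: "\<And>j. j \<in> J \<Longrightarrow> P (mvar j)"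
    and add: "\<And>f g. f \<in> mpoly_ring J \<Longrightarrow> g \<in> mpoly_ring J \<Longrightarrow> P f \<Longrightarrow> P g \<Longrightarrow> P (f + g)"
    and mult: "\<And>f g. f \<in> mpoly_ring J \<Longrightarrow> g \<in> mpoly_ring J \<Longrightarrow> P f \<Longrightarrow> P g \<Longrightarrow> P (f * g)"
  shows "P f"
proof -
  have keys: "Poly_Mapping.keys m \<subseteq> J" if "m \<in> Poly_Mapping.keys f" for m
    using assms(1) that by (auto simp: mpoly_ring_def)
  have "P (\<Sum>m\<in>S. Poly_Mapping.single m (Poly_Mapping.lookup f m)) \<and>
      (\<Sum>m\<in>S. Poly_Mapping.single m (Poly_Mapping.lookup f m)) \<in> mpoly_ring J"
    if "finite S" "S \<subseteq> Poly_Mapping.keys f" for S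
    using that
  proof (induction S rule: finite_induct)
    case empty
    then show ?case using const[of 0] mpoly_ring_const[of 0 J] by simp
  next
    case (insert m S)
    have "P (Poly_Mapping.single m (Poly_Mapping.lookup f m))"
      by (rule monomial_induct[where J = J and P = P]) (use insert keys const var mult in auto)
    moreover have "Poly_Mapping.single m (Poly_Mapping.lookup f m) \<in> mpoly_ring J"
      using insert keys by (simp add: mpoly_ring_def)
    ultimately show ?case using insert by (auto intro: add mpoly_ring_add)
  qed
  from this[of "Poly_Mapping.keys f"] show ?thesis
    by (simp add: sum_of_terms[symmetric])
qed

lemma meval_cong:
  assumes "f \<in> mpoly_ring J" "\<And>j. j \<in> J \<Longrightarrow> p j = q j"
  shows "meval p f = meval q f"
  using assms(1)
  by (induction f rule: mpoly_ring_induct) (simp_all add: meval_const meval_var meval_add meval_mult assms(2))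


lemma meval_power: "meval p (f ^ n) = meval p f ^ n"
proof (induction n)
  case 0
  have "meval p (mconst 1) = 1" by (rule meval_const)
  then show ?case by simp
qed (simp add: meval_mult)

lemma meval_prod: "meval p (prod f S) = (\<Prod>s\<in>S. meval p (f s))"
proof (induction S rule: infinite_finite_induct)
  case empty
  have "meval p (mconst 1) = 1" by (rule meval_const)
  then show ?case by simp
next
  case (infinite A)
  have "meval p (mconst 1) = 1" by (rule meval_const)
  with infinite show ?case by simp
qed (simp add: meval_mult)

lemma mpoly_ring_one: "(1 :: 'a::comm_ring_1 mpoly) \<in> mpoly_ring J"
  using mpoly_ring_const[of "1 :: 'a" J] by simp

lemma mpoly_ring_power: "(f :: 'a::comm_ring_1 mpoly) \<in> mpoly_ring J \<Longrightarrow> f ^ n \<in> mpoly_ring J"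
  by (induction n) (auto intro: mpoly_ring_mult mpoly_ring_one)

lemma mpoly_ring_prod:
  fixes f :: "'s \<Rightarrow> 'a::comm_ring_1 mpoly"
  shows "(\<And>s. s \<in> S \<Longrightarrow> f s \<in> mpoly_ring J) \<Longrightarrow> prod f S \<in> mpoly_ring J"
  by (induction S rule: infinite_finite_induct) (auto intro: mpoly_ring_mult mpoly_ring_one)


section \<open>Functions with a formal derivative\<close>

text \<open>A set of pairs \<open>(f, f')\<close> closed under the rules of differentiation. There are two instances:
  polynomial functions of a curve parameter with their derivative, and polynomial functions of
  a point \<open>p\<close> with their derivative at \<open>p\<close> in a direction \<open>v\<close>. Both are needed for functions whose
  values are univariate polynomials, coefficient by coefficient.\<close>

locale function_algebra =
  fixes \<A> :: "(('p \<Rightarrow> 'a::field) \<times> ('p \<Rightarrow> 'a)) set"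
  assumes alg_const: "(\<lambda>_. c, \<lambda>_. 0) \<in> \<A>"
    and alg_add: "(f, f') \<in> \<A> \<Longrightarrow> (g, g') \<in> \<A> \<Longrightarrow> (\<lambda>p. f p + g p, \<lambda>p. f' p + g' p) \<in> \<A>"
    and alg_mult: "(f, f') \<in> \<A> \<Longrightarrow> (g, g') \<in> \<A> \<Longrightarrow> (\<lambda>p. f p * g p, \<lambda>p. f' p * g p + f p * g' p) \<in> \<A>"
begin

lemma sum_closed:
  assumes "finite S" "\<And>s. s \<in> S \<Longrightarrow> (f s, f' s) \<in> \<A>"
  shows "(\<lambda>p. \<Sum>s\<in>S. f s p, \<lambda>p. \<Sum>s\<in>S. f' s p) \<in> \<A>"
  using assms
proof (induction S rule: finite_induct)
  case empty
  show ?case using alg_const[of 0] by simp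
next
  case (insert s S)
  then show ?case using alg_add[of "f s" "f' s" "\<lambda>p. \<Sum>s\<in>S. f s p" "\<lambda>p. \<Sum>s\<in>S. f' s p"] by simp
qed

lemma chain_rule:
  assumes "finite J" "f \<in> mpoly_ring J" "\<And>j. j \<in> J \<Longrightarrow> (x j, x' j) \<in> \<A>"
  shows "(\<lambda>p. meval (\<lambda>j. x j p) f, \<lambda>p. \<Sum>j\<in>J. meval (\<lambda>j. x j p) (mpderiv j f) * x' j p) \<in> \<A>"
  using assms(2)
proof (induction f rule: mpoly_ring_induct)
  case (const c)
  show ?case using alg_const[of c] by (simp add: meval_const mpderiv_const meval_zero)
next
  case (var k)
  have "meval (\<lambda>j. x j p) (mpderiv j (mvar k)) * x' j p = (if j = k then x' k p else 0)" for j p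
    by (simp add: mpderiv_var meval_const)
  then show ?case using var assms by (simp add: meval_var)
next
  case (add f g)
  show ?case using alg_add[OF add(3,4)]
    by (simp add: meval_add mpderiv_add algebra_simps sum.distrib)
next
  case (mult f g)
  show ?case using alg_mult[OF mult(3,4)]
    by (simp add: meval_mult meval_add mpderiv_mult algebra_simps sum.distrib sum_distrib_left)
qed

definition coeffwise :: "('p \<Rightarrow> 'a poly) \<Rightarrow> ('p \<Rightarrow> 'a poly) \<Rightarrow> bool" where
  "coeffwise F F' \<longleftrightarrow> (\<forall>l. (\<lambda>p. coeff (F p) l, \<lambda>p. coeff (F' p) l) \<in> \<A>)"

lemma coeffwise_const: "coeffwise (\<lambda>_. P) (\<lambda>_. 0)"
  by (simp add: coeffwise_def alg_const)

lemma coeffwise_add: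
  "coeffwise F F' \<Longrightarrow> coeffwise G G' \<Longrightarrow> coeffwise (\<lambda>p. F p + G p) (\<lambda>p. F' p + G' p)"
  by (simp add: coeffwise_def alg_add)

lemma coeffwise_mult:
  assumes "coeffwise F F'" "coeffwise G G'"
  shows "coeffwise (\<lambda>p. F p * G p) (\<lambda>p. F' p * G p + F p * G' p)"
proof -
  have "(\<lambda>p. \<Sum>i\<le>l. coeff (F p) i * coeff (G p) (l - i),
         \<lambda>p. \<Sum>i\<le>l. coeff (F' p) i * coeff (G p) (l - i) + coeff (F p) i * coeff (G' p) (l - i)) \<in> \<A>" for l
    using assms by (intro sum_closed alg_mult) (auto simp: coeffwise_def)
  then show ?thesis by (simp add: coeffwise_def coeff_mult sum.distrib)
qed

lemma coeffwise_power:
  assumes "coeffwise F F'"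
  shows "coeffwise (\<lambda>p. F p ^ n) (\<lambda>p. smult (of_nat n) (F p ^ (n - 1) * F' p))"
proof (induction n)
  case 0
  then show ?case using coeffwise_const[of 1] by simp
next
  case (Suc n)
  have *: "F' p * F p ^ n + F p * smult (of_nat n) (F p ^ (n - 1) * F' p) =
      smult (of_nat (Suc n)) (F p ^ n * F' p)" for p
  proof -
    have "F p * smult (of_nat n) (F p ^ (n - 1) * F' p) = smult (of_nat n) (F p ^ n * F' p)"
      by (cases n) (simp_all add: mult.assoc)
    then show ?thesis by (simp add: smult_add_left mult.commute)
  qed
  show ?case using coeffwise_mult[OF assms Suc.IH] unfolding * by simp
qed

lemma coeffwise_pderiv:
  assumes "coeffwise F F'"
  shows "coeffwise (\<lambda>p. pderiv (F p)) (\<lambda>p. pderiv (F' p))"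
proof -
  have "(\<lambda>p. of_nat (Suc l) * coeff (F p) (Suc l), \<lambda>p. 0 * coeff (F p) (Suc l) + of_nat (Suc l) * coeff (F' p) (Suc l)) \<in> \<A>" for l
    using assms by (intro alg_mult alg_const) (auto simp: coeffwise_def)
  then show ?thesis by (simp add: coeffwise_def coeff_pderiv)
qed

end

definition curve_alg :: "(('a::field \<Rightarrow> 'a) \<times> ('a \<Rightarrow> 'a)) set" where
  "curve_alg = range (\<lambda>q. (poly q, poly (pderiv q)))"

lemma curve_algI: "(poly q, poly (pderiv q)) \<in> curve_alg"
  by (simp add: curve_alg_def)

lemma curve_algE:
  assumes "(f, f') \<in> curve_alg"
  obtains q where "\<And>t. poly q t = f t" "\<And>t. poly (pderiv q) t = f' t"
proof -
  obtain q where "f = poly q" "f' = poly (pderiv q)" using assms by (auto simp: curve_alg_def)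
  then show ?thesis using that by simp
qed

interpretation curve: function_algebra "curve_alg :: (('a::field \<Rightarrow> 'a) \<times> ('a \<Rightarrow> 'a)) set"
proof
  fix c :: 'a
  have "(\<lambda>_. c, \<lambda>_. 0) = (poly [:c:], poly (pderiv [:c:]))" by (simp add: fun_eq_iff)
  then show "(\<lambda>_. c, \<lambda>_. 0) \<in> curve_alg"
    using curve_algI by metis
next
  fix f f' g g' :: "'a \<Rightarrow> 'a"
  assume "(f, f') \<in> curve_alg"
    and "(g, g') \<in> curve_alg"
  then obtain p q where pq: "f = poly p" "f' = poly (pderiv p)" "g = poly q" "g' = poly (pderiv q)"
    by (auto simp: curve_alg_def)
  have "(\<lambda>t. f t + g t, \<lambda>t. f' t + g' t) = (poly (p + q), poly (pderiv (p + q)))"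
    by (simp add: pq fun_eq_iff pderiv_add)
  then show "(\<lambda>t. f t + g t, \<lambda>t. f' t + g' t) \<in> curve_alg"
    using curve_algI by metis
  have "(\<lambda>t. f t * g t, \<lambda>t. f' t * g t + f t * g' t) = (poly (p * q), poly (pderiv (p * q)))"
    by (simp add: pq fun_eq_iff pderiv_mult algebra_simps)
  then show "(\<lambda>t. f t * g t, \<lambda>t. f' t * g t + f t * g' t) \<in> curve_alg"
    using curve_algI by metis
qed

lemma curve_line: "curve.coeffwise (\<lambda>t. U + smult t V) (\<lambda>_. V)"
  unfolding curve.coeffwise_def
proof
  fix l
  have "(\<lambda>t. coeff (U + smult t V) l, \<lambda>_. coeff V l) =
      (poly [:coeff U l, coeff V l:], poly (pderiv [:coeff U l, coeff V l:]))"
    by (simp add: fun_eq_iff pderiv_pCons)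
  then show "(\<lambda>t. coeff (U + smult t V) l, \<lambda>_. coeff V l) \<in> curve_alg"
    using curve_algI by metis
qed

lemma curve_line_power:
  "curve.coeffwise (\<lambda>t. (U + smult t V) ^ n * B)
     (\<lambda>t. smult (of_nat n) ((U + smult t V) ^ (n - 1) * V) * B)"
  using curve.coeffwise_mult[OF curve.coeffwise_power[OF curve_line] curve.coeffwise_const[of B]]
  by simp

lemma curve_constant:
  fixes f :: "'a::field_char_0 \<Rightarrow> 'a"
  assumes "(f, f') \<in> curve_alg" "\<And>t. f t = 0"
  shows "f' t = 0"
proof -
  obtain q where q: "\<And>t. poly q t = f t" "\<And>t. poly (pderiv q) t = f' t"
    using assms(1) by (rule curve_algE) (rule that)
  then have "q = 0" using assms(2) poly_all_0_iff_0[of q] by simp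
  then show ?thesis using q(2)[of t] by simp
qed

text \<open>Along a rational curve \<open>t \<mapsto> \<gamma>(t) / \<gamma>\<^sub>i(t)\<close> in a chart, a polynomial becomes a polynomial in \<open>t\<close>
  after multiplication by a power of \<open>\<gamma>\<^sub>i\<close>. If \<open>\<gamma>\<^sub>i\<close> is \<open>1\<close> to first order at \<open>0\<close>, the denominators do
  not contribute to the derivative at \<open>0\<close>.\<close>

lemma rational_curve:
  fixes \<gamma> :: "nat \<Rightarrow> 'a::field poly"
  assumes "finite J" "f \<in> mpoly_ring J"
  shows "\<exists>D q. (\<forall>t. poly (\<gamma> i) t \<noteq> 0 \<longrightarrow>
       poly q t = poly (\<gamma> i) t ^ D * meval (\<lambda>j. poly (\<gamma> j) t / poly (\<gamma> i) t) f) \<and>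
     (poly (\<gamma> i) 0 = 1 \<and> poly (pderiv (\<gamma> i)) 0 = 0 \<longrightarrow>
       poly (pderiv q) 0 = (\<Sum>j\<in>J. meval (\<lambda>j. poly (\<gamma> j) 0) (mpderiv j f) * poly (pderiv (\<gamma> j)) 0))"
  (is "\<exists>D q. ?val f D q \<and> ?der f q")
  using assms(2)
proof (induction f rule: mpoly_ring_induct)
  case (const c)
  have "?val (mconst c) 0 [:c:] \<and> ?der (mconst c) [:c:]"
    by (simp add: meval_const mpderiv_const meval_zero)
  then show ?case by blast
next
  case (var k)
  have "(\<Sum>j\<in>J. meval (\<lambda>j. poly (\<gamma> j) 0) (mpderiv j (mvar k)) * poly (pderiv (\<gamma> j)) 0) =
     (\<Sum>j\<in>J. if j = k then poly (pderiv (\<gamma> k)) 0 else 0)"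
    by (rule sum.cong) (auto simp: mpderiv_var meval_const)
  then have "?val (mvar k) 1 (\<gamma> k) \<and> ?der (mvar k) (\<gamma> k)"
    using var assms(1) by (simp add: meval_var)
  then show ?case by blast
next
  case (add f g)
  obtain D p where p: "?val f D p" "?der f p" using add by blast
  obtain E q where q: "?val g E q" "?der g q" using add by blast
  let ?r = "p * \<gamma> i ^ E + q * \<gamma> i ^ D"
  have pow: "poly (pderiv (\<gamma> i ^ n)) 0 = 0" if "poly (pderiv (\<gamma> i)) 0 = 0" for n
    using that by (simp add: pderiv_power)
  have "?val (f + g) (D + E) ?r"
    using p(1) q(1) by (auto simp: meval_add power_add algebra_simps)
  moreover have "?der (f + g) ?r"
    using p(2) q(2) pow by (auto simp: pderiv_add pderiv_mult meval_add mpderiv_add algebra_simps sum.distrib)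
  ultimately show ?case by blast
next
  case (mult f g)
  obtain D p where p: "?val f D p" "?der f p" using mult by blast
  obtain E q where q: "?val g E q" "?der g q" using mult by blast
  have "?val (f * g) (D + E) (p * q)"
    using p(1) q(1) by (auto simp: meval_mult power_add algebra_simps)
  moreover have "?der (f * g) (p * q)"
  proof
    assume i: "poly (\<gamma> i) 0 = 1 \<and> poly (pderiv (\<gamma> i)) 0 = 0"
    then have "poly p 0 = meval (\<lambda>j. poly (\<gamma> j) 0) f" "poly q 0 = meval (\<lambda>j. poly (\<gamma> j) 0) g"
      using p(1) q(1) by auto
    then show "poly (pderiv (p * q)) 0 =
        (\<Sum>j\<in>J. meval (\<lambda>j. poly (\<gamma> j) 0) (mpderiv j (f * g)) * poly (pderiv (\<gamma> j)) 0)"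
      using p(2) q(2) i
      by (simp add: pderiv_mult meval_add meval_mult mpderiv_mult algebra_simps sum.distrib sum_distrib_left)
  qed
  ultimately show ?case by blast
qed

text \<open>Functions of a point and a direction: \<open>f'\<close> is the directional derivative that occurs in the
  definition of the tangent space.\<close>

definition mpoly_algebra ::
  "nat set \<Rightarrow> (((nat \<Rightarrow> 'a::field) \<times> (nat \<Rightarrow> 'a) \<Rightarrow> 'a) \<times> ((nat \<Rightarrow> 'a) \<times> (nat \<Rightarrow> 'a) \<Rightarrow> 'a)) set" where
  "mpoly_algebra J =
     {(\<lambda>pv. meval (fst pv) f, \<lambda>pv. \<Sum>j\<in>J. meval (fst pv) (mpderiv j f) * snd pv j) | f. f \<in> mpoly_ring J}"

lemma mpoly_algebraI:
  "f \<in> mpoly_ring J \<Longrightarrow>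
   (\<lambda>pv. meval (fst pv) f, \<lambda>pv. \<Sum>j\<in>J. meval (fst pv) (mpderiv j f) * snd pv j) \<in> mpoly_algebra J"
  by (auto simp: mpoly_algebra_def)

lemma mpoly_function_algebra: "function_algebra (mpoly_algebra J)"
proof
  fix c :: 'a
  show "(\<lambda>_. c, \<lambda>_. 0) \<in> mpoly_algebra J"
    using mpoly_algebraI[OF mpoly_ring_const[of c J]]
    by (simp add: meval_const mpderiv_const meval_zero)
next
  fix f f' g g' :: "(nat \<Rightarrow> 'a) \<times> (nat \<Rightarrow> 'a) \<Rightarrow> 'a"
  assume "(f, f') \<in> mpoly_algebra J" "(g, g') \<in> mpoly_algebra J"
  then obtain p q where p: "p \<in> mpoly_ring J" "f = (\<lambda>pv. meval (fst pv) p)"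
      "f' = (\<lambda>pv. \<Sum>j\<in>J. meval (fst pv) (mpderiv j p) * snd pv j)"
    and q: "q \<in> mpoly_ring J" "g = (\<lambda>pv. meval (fst pv) q)"
      "g' = (\<lambda>pv. \<Sum>j\<in>J. meval (fst pv) (mpderiv j q) * snd pv j)"
    by (auto simp: mpoly_algebra_def)
  show "(\<lambda>t. f t + g t, \<lambda>t. f' t + g' t) \<in> mpoly_algebra J"
    using mpoly_algebraI[OF mpoly_ring_add[OF p(1) q(1)]]
    by (simp add: p(2,3) q(2,3) meval_add mpderiv_add algebra_simps sum.distrib)
  show "(\<lambda>t. f t * g t, \<lambda>t. f' t * g t + f t * g' t) \<in> mpoly_algebra J"
    using mpoly_algebraI[OF mpoly_ring_mult[OF p(1) q(1)]]
    by (simp add: p(2,3) q(2,3) meval_mult meval_add mpderiv_mult algebra_simps sum.distrib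
        sum_distrib_left)
qed


section \<open>Irreducible closed sets and Krull dimension\<close>

lemma topspace_zariski: "topspace (zariski J) = (aff_space J :: (nat \<Rightarrow> 'a::field) set)"
proof -
  have "meval p (1 :: 'a mpoly) = 1" for p :: "nat \<Rightarrow> 'a"
    using meval_const[of p 1] by simp
  then have "{p \<in> aff_space J. meval p (1 :: 'a mpoly) \<noteq> 0} = aff_space J" by auto
  then show ?thesis
    unfolding zariski_def topology_generated_by_topspace
    using mpoly_ring_one[of J] by blast
qed

lemma openin_zariski_basis:
  assumes "openin (zariski J) U" "p \<in> U"
  shows "\<exists>f\<in>mpoly_ring J. meval p f \<noteq> 0 \<and> {q \<in> aff_space J. meval q f \<noteq> 0} \<subseteq> U"
proof -
  have "generate_topology_on {{p \<in> aff_space J. meval p f \<noteq> 0} | f. f \<in> mpoly_ring J} U"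
    using assms(1) unfolding zariski_def by (rule openin_topology_generated_by)
  then show ?thesis using assms(2)
  proof (induction arbitrary: p rule: generate_topology_on.induct)
    case Empty
    then show ?case by simp
  next
    case (Int a b)
    obtain f where f: "f \<in> mpoly_ring J" "meval p f \<noteq> 0" "{q \<in> aff_space J. meval q f \<noteq> 0} \<subseteq> a"
      using Int by blast
    obtain g where g: "g \<in> mpoly_ring J" "meval p g \<noteq> 0" "{q \<in> aff_space J. meval q g \<noteq> 0} \<subseteq> b"
      using Int by blast
    show ?case
      by (rule bexI[of _ "f * g"]) (use f g in \<open>auto simp: meval_mult intro: mpoly_ring_mult\<close>)
  next
    case (UN K)
    then show ?case by blast
  next
    case (Basis s)
    then show ?case by blast
  qed
qed

text \<open>The sets \<open>D(f)\<close> are a basis of the topology, so a point outside a closed set has a neighbourhood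
  \<open>D(f)\<close> that misses it.\<close>

lemma zariski_closed_separation:
  assumes "closedin (subtopology (zariski J) Z) C" "Z \<subseteq> aff_space J" "p \<in> Z" "p \<notin> C"
  shows "\<exists>f\<in>mpoly_ring J. meval p f \<noteq> 0 \<and> (\<forall>q\<in>C. meval q f = 0)"
proof -
  obtain D where D: "closedin (zariski J) D" "C = D \<inter> Z"
    using assms(1) by (auto simp: closedin_subtopology)
  have "openin (zariski J) (aff_space J - D)"
    using D(1) by (simp add: closedin_def topspace_zariski)
  from openin_zariski_basis[OF this, of p] assms D show ?thesis by blast
qed

lemma closedin_zero_locus:
  assumes "f \<in> mpoly_ring J" "Z \<subseteq> aff_space J"
  shows "closedin (subtopology (zariski J) Z) {q \<in> Z. meval q f = 0}"
proof -
  have "openin (zariski J) {p \<in> aff_space J. meval p f \<noteq> 0}"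
    unfolding zariski_def by (rule topology_generated_by_Basis) (use assms in blast)
  moreover have "aff_space J - {q \<in> aff_space J. meval q f = 0} = {p \<in> aff_space J. meval p f \<noteq> 0}"
    by auto
  ultimately have "closedin (zariski J) {q \<in> aff_space J. meval q f = 0}"
    by (simp add: closedin_def topspace_zariski)
  moreover have "{q \<in> Z. meval q f = 0} = {q \<in> aff_space J. meval q f = 0} \<inter> Z"
    using assms(2) by auto
  ultimately show ?thesis unfolding closedin_subtopology by blast
qed

lemma topspace_sub_zariski:
  "Z \<subseteq> aff_space J \<Longrightarrow> topspace (subtopology (zariski J) Z) = Z"
  by (auto simp: topspace_zariski)

text \<open>Irreducibility says that the ideal of \<open>C\<close> is prime; the converse for sets \<open>C\<close> that need not be
  closed is \<open>irreducible_inI\<close>.\<close>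

lemma irreducible_in_prime:
  assumes "irreducible_in (subtopology (zariski J) Z) C" "Z \<subseteq> aff_space J"
    and "f \<in> mpoly_ring J" "g \<in> mpoly_ring J" "\<forall>q\<in>C. meval q f * meval q g = 0"
  shows "(\<forall>q\<in>C. meval q f = 0) \<or> (\<forall>q\<in>C. meval q g = 0)"
proof -
  have CZ: "C \<subseteq> Z"
    using assms(1,2) by (auto simp: irreducible_in_def)
  have "C \<subseteq> {q \<in> Z. meval q f = 0} \<union> {q \<in> Z. meval q g = 0}"
    using CZ assms(5) by auto
  with closedin_zero_locus[OF assms(3,2)] closedin_zero_locus[OF assms(4,2)] assms(1)
  have "C \<subseteq> {q \<in> Z. meval q f = 0} \<or> C \<subseteq> {q \<in> Z. meval q g = 0}"
    unfolding irreducible_in_def by meson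
  then show ?thesis by auto
qed

lemma irreducible_inI:
  assumes "Z \<subseteq> aff_space J" "C \<subseteq> Z" "C \<noteq> {}"
    and prime: "\<And>f g. f \<in> mpoly_ring J \<Longrightarrow> g \<in> mpoly_ring J \<Longrightarrow> \<forall>q\<in>C. meval q f * meval q g = 0 \<Longrightarrow>
      (\<forall>q\<in>C. meval q f = 0) \<or> (\<forall>q\<in>C. meval q g = 0)"
  shows "irreducible_in (subtopology (zariski J) Z) C"
  unfolding irreducible_in_def topspace_sub_zariski[OF assms(1)]
proof (intro conjI allI impI assms(2,3))
  fix A B
  assume AB: "closedin (subtopology (zariski J) Z) A \<and> closedin (subtopology (zariski J) Z) B \<and> C \<subseteq> A \<union> B"
  show "C \<subseteq> A \<or> C \<subseteq> B"
  proof (rule ccontr)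
    assume "\<not> (C \<subseteq> A \<or> C \<subseteq> B)"
    then obtain a b where ab: "a \<in> C" "a \<notin> A" "b \<in> C" "b \<notin> B" by blast
    obtain f where f: "f \<in> mpoly_ring J" "meval a f \<noteq> 0" "\<forall>q\<in>A. meval q f = 0"
      using zariski_closed_separation[of J Z A a] AB ab assms by blast
    obtain g where g: "g \<in> mpoly_ring J" "meval b g \<noteq> 0" "\<forall>q\<in>B. meval q g = 0"
      using zariski_closed_separation[of J Z B b] AB ab assms by blast
    have "\<forall>q\<in>C. meval q f * meval q g = 0" using f g AB by auto
    from prime[OF f(1) g(1) this] f g ab show False by blast
  qed
qed

lemma PiE_lessThan_Suc_sum:
  "(\<Sum>\<alpha>\<in>PiE {..<Suc n} (\<lambda>_. {..N::nat}). F \<alpha>) =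
   (\<Sum>m\<le>N. \<Sum>\<alpha>\<in>PiE {..<n} (\<lambda>_. {..N}). F (\<alpha>(n := m)))"
proof -
  have "(\<Sum>\<alpha>\<in>PiE (insert n {..<n}) (\<lambda>_. {..N}). F \<alpha>) =
    (\<Sum>(m, \<alpha>)\<in>{..N} \<times> PiE {..<n} (\<lambda>_. {..N}). F (\<alpha>(n := m)))"
    unfolding PiE_insert_eq
    by (subst sum.reindex[OF inj_combinator]) (auto simp: case_prod_unfold)
  also have "\<dots> = (\<Sum>m\<le>N. \<Sum>\<alpha>\<in>PiE {..<n} (\<lambda>_. {..N}). F (\<alpha>(n := m)))"
    by (simp add: sum.cartesian_product)
  finally show ?thesis by (simp add: lessThan_Suc)
qed

text \<open>The functions \<open>g\<^sub>0, \<dots>, g\<^sub>n\<^sub>-\<^sub>1\<close> attached to the steps of a chain are algebraically independent on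
  its top. Write a relation as \<open>\<Sum>m\<le>N. g\<^sub>n^m h\<^sub>m\<close> with \<open>h\<^sub>m\<close> a polynomial in the earlier functions. On
  \<open>C\<^sub>n\<close> only \<open>h\<^sub>0\<close> survives, so its coefficients vanish by induction; then \<open>g\<^sub>n\<close> divides the relation
  and can be cancelled because \<open>C\<^sub>n\<^sub>+\<^sub>1\<close> is irreducible and \<open>g\<^sub>n\<close> is not zero on it.\<close>

lemma chain_monomials_independent:
  fixes C :: "nat \<Rightarrow> (nat \<Rightarrow> 'a::field) set"
  assumes "Z \<subseteq> aff_space J"
    and "\<And>i. i \<le> n \<Longrightarrow> irreducible_in (subtopology (zariski J) Z) (C i)"
    and "\<And>i. i < n \<Longrightarrow> C i \<subseteq> C (Suc i)"
    and "\<And>i. i < n \<Longrightarrow> g i \<in> mpoly_ring J"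
    and "\<And>i p. i < n \<Longrightarrow> p \<in> C i \<Longrightarrow> meval p (g i) = 0"
    and "\<And>i. i < n \<Longrightarrow> \<exists>p\<in>C (Suc i). meval p (g i) \<noteq> 0"
    and "\<And>p. p \<in> C n \<Longrightarrow>
       (\<Sum>\<alpha>\<in>PiE {..<n} (\<lambda>_. {..N}). c \<alpha> * (\<Prod>k<n. meval p (g k) ^ \<alpha> k)) = 0"
    and "\<alpha> \<in> PiE {..<n} (\<lambda>_. {..N})"
  shows "c \<alpha> = 0"
  using assms(2-)
proof (induction n arbitrary: c \<alpha>)
  case 0
  have "C 0 \<noteq> {}" using 0(1)[of 0] by (auto simp: irreducible_in_def)
  with 0(6) 0(7) show ?case by auto
next
  case (Suc n)
  note irr = Suc.prems(1) and mono = Suc.prems(2) and ring = Suc.prems(3)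
    and van = Suc.prems(4) and nonvan = Suc.prems(5) and rel = Suc.prems(6)
  define A where "A = PiE {..<n} (\<lambda>_. {..N})"
  define h where "h m p = (\<Sum>\<alpha>\<in>A. c (\<alpha>(n := m)) * (\<Prod>k<n. meval p (g k) ^ \<alpha> k))" for m p
  have coeffs_zero: "\<forall>\<alpha>\<in>A. c (\<alpha>(n := m)) = 0" if "\<And>p. p \<in> C n \<Longrightarrow> h m p = 0" for m
  proof
    fix \<alpha> assume \<alpha>: "\<alpha> \<in> A"
    show "c (\<alpha>(n := m)) = 0"
    proof (rule Suc.IH[of "\<lambda>\<alpha>. c (\<alpha>(n := m))"])
      show "\<alpha> \<in> PiE {..<n} (\<lambda>_. {..N})" using \<alpha> by (simp add: A_def)
      show "(\<Sum>\<alpha>\<in>PiE {..<n} (\<lambda>_. {..N}). c (\<alpha>(n := m)) * (\<Prod>k<n. meval p (g k) ^ \<alpha> k)) = 0"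
        if "p \<in> C n" for p
        using that \<open>\<And>p. p \<in> C n \<Longrightarrow> h m p = 0\<close> by (simp add: h_def A_def)
    qed (use Suc.prems in auto)
  qed
  \<comment> \<open>After \<open>M\<close> cancellations the first \<open>M\<close> coefficient functions are gone.\<close>
  have step: "(\<forall>m<M. \<forall>\<alpha>\<in>A. c (\<alpha>(n := m)) = 0) \<and>
      (\<forall>p\<in>C (Suc n). (\<Sum>m\<in>{M..N}. meval p (g n) ^ (m - M) * h m p) = 0)" if "M \<le> Suc N" for M
    using that
  proof (induction M)
    case 0
    have "(\<Sum>m\<in>{0..N}. meval p (g n) ^ (m - 0) * h m p) = 0" if "p \<in> C (Suc n)" for p
    proof -
      have "(\<Prod>k<n. meval p (g k) ^ (if k = n then m else \<alpha> k)) = (\<Prod>k<n. meval p (g k) ^ \<alpha> k)" for m \<alpha>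
        by (rule prod.cong) auto
      then have "(\<Sum>m\<in>{0..N}. meval p (g n) ^ (m - 0) * h m p) =
          (\<Sum>\<alpha>\<in>PiE {..<Suc n} (\<lambda>_. {..N}). c \<alpha> * (\<Prod>k<Suc n. meval p (g k) ^ \<alpha> k))"
        unfolding PiE_lessThan_Suc_sum
        by (simp add: h_def A_def sum_distrib_left atLeast0AtMost mult_ac)
      then show ?thesis using rel[OF that] by simp
    qed
    then show ?case by simp
  next
    case (Suc M)
    then have M: "M \<le> N" by simp
    note IHs = Suc.IH[OF le_SucI[OF M]]
    note IH0 = conjunct1[OF IHs] and IH = bspec[OF conjunct2[OF IHs]]
    have split: "(\<Sum>m\<in>{M..N}. meval p (g n) ^ (m - M) * h m p) =
        h M p + meval p (g n) * (\<Sum>m\<in>{Suc M..N}. meval p (g n) ^ (m - Suc M) * h m p)" for p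
    proof -
      have "(\<Sum>m\<in>{Suc M..N}. meval p (g n) ^ (m - M) * h m p) =
          (\<Sum>m\<in>{Suc M..N}. meval p (g n) * (meval p (g n) ^ (m - Suc M) * h m p))"
      proof (rule sum.cong)
        fix m assume "m \<in> {Suc M..N}"
        then have "m - M = Suc (m - Suc M)" by auto
        then show "meval p (g n) ^ (m - M) * h m p = meval p (g n) * (meval p (g n) ^ (m - Suc M) * h m p)"
          by simp
      qed simp
      then show ?thesis using M by (simp add: sum.atLeast_Suc_atMost sum_distrib_left)
    qed
    have zero: "\<forall>\<alpha>\<in>A. c (\<alpha>(n := M)) = 0"
    proof (rule coeffs_zero)
      fix p assume p: "p \<in> C n"
      then have "p \<in> C (Suc n)" "meval p (g n) = 0" using mono[of n] van[of n p] by auto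
      with IH[of p] split[of p] show "h M p = 0" by simp
    qed
    then have hM: "h M p = 0" for p by (simp add: h_def)
    define G where "G = (\<Sum>m\<in>{Suc M..N}. g n ^ (m - Suc M) *
        (\<Sum>\<alpha>\<in>A. mconst (c (\<alpha>(n := m))) * (\<Prod>k<n. g k ^ \<alpha> k)))"
    have G: "meval p G = (\<Sum>m\<in>{Suc M..N}. meval p (g n) ^ (m - Suc M) * h m p)" for p
      by (simp add: G_def h_def meval_sum meval_mult meval_power meval_prod meval_const)
    have "G \<in> mpoly_ring J"
      unfolding G_def
      by (intro mpoly_ring_sum mpoly_ring_mult mpoly_ring_power mpoly_ring_const mpoly_ring_prod)
        (use ring in auto)
    moreover have "\<forall>p\<in>C (Suc n). meval p (g n) * meval p G = 0"
      using IH split hM by (simp add: G)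
    ultimately have "\<forall>p\<in>C (Suc n). meval p G = 0"
      using irreducible_in_prime[OF irr[of "Suc n"] assms(1) ring[of n], of G] nonvan[of n] by auto
    then show ?case using IH0 zero unfolding G by (metis less_antisym)
  qed
  have \<alpha>: "\<alpha> = (restrict \<alpha> {..<n})(n := \<alpha> n)"
    using Suc.prems(7) by (auto simp: fun_eq_iff PiE_iff extensional_def)
  have "restrict \<alpha> {..<n} \<in> A" "\<alpha> n < Suc N"
    using Suc.prems(7) by (auto simp: A_def PiE_iff Ball_def less_Suc_eq_le)
  then show ?case using step[of "Suc N"] \<alpha> by (metis le_refl)
qed


section \<open>An upper bound for the dimension\<close>

text \<open>Gaussian elimination: one equation is used to eliminate one unknown.\<close>

lemma underdetermined_system:
  fixes M :: "'i \<Rightarrow> 'k \<Rightarrow> 'a::field"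
  assumes "finite B" "finite A" "card B < card A"
  shows "\<exists>c. (\<exists>\<alpha>\<in>A. c \<alpha> \<noteq> 0) \<and> (\<forall>\<kappa>\<in>B. (\<Sum>\<alpha>\<in>A. c \<alpha> * M \<alpha> \<kappa>) = 0)"
  using assms
proof (induction B arbitrary: A M rule: finite_induct)
  case empty
  then have "A \<noteq> {}" by auto
  then show ?case by (intro exI[of _ "\<lambda>_. 1"]) auto
next
  case (insert \<kappa>0 B)
  show ?case
  proof (cases "\<forall>\<alpha>\<in>A. M \<alpha> \<kappa>0 = 0")
    case True
    have "card B < card A" using insert by simp
    from insert.IH[OF insert.prems(1) this, of M] True show ?thesis by auto
  next
    case False
    then obtain \<alpha>0 where \<alpha>0: "\<alpha>0 \<in> A" "M \<alpha>0 \<kappa>0 \<noteq> 0" by blast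
    define A' where "A' = A - {\<alpha>0}"
    have A': "finite A'" "card B < card A'" "\<alpha>0 \<notin> A'" "A = insert \<alpha>0 A'"
      using insert \<alpha>0 by (auto simp: A'_def)
    obtain c where c: "\<exists>\<alpha>\<in>A'. c \<alpha> \<noteq> 0"
      and eq: "\<And>\<kappa>. \<kappa> \<in> B \<Longrightarrow> (\<Sum>\<alpha>\<in>A'. c \<alpha> * (M \<alpha> \<kappa> - M \<alpha> \<kappa>0 / M \<alpha>0 \<kappa>0 * M \<alpha>0 \<kappa>)) = 0"
      using insert.IH[OF A'(1,2), of "\<lambda>\<alpha> \<kappa>. M \<alpha> \<kappa> - M \<alpha> \<kappa>0 / M \<alpha>0 \<kappa>0 * M \<alpha>0 \<kappa>"] by blast
    define x where "x = - (\<Sum>\<alpha>\<in>A'. c \<alpha> * M \<alpha> \<kappa>0) / M \<alpha>0 \<kappa>0"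
    define c' where "c' = c(\<alpha>0 := x)"
    have sum: "(\<Sum>\<alpha>\<in>A. c' \<alpha> * M \<alpha> \<kappa>) = x * M \<alpha>0 \<kappa> + (\<Sum>\<alpha>\<in>A'. c \<alpha> * M \<alpha> \<kappa>)" for \<kappa>
    proof -
      have "(\<Sum>\<alpha>\<in>A'. c' \<alpha> * M \<alpha> \<kappa>) = (\<Sum>\<alpha>\<in>A'. c \<alpha> * M \<alpha> \<kappa>)"
        by (rule sum.cong) (use A'(3) in \<open>auto simp: c'_def\<close>)
      then show ?thesis using A' by (simp add: c'_def)
    qed
    have "(\<Sum>\<alpha>\<in>A. c' \<alpha> * M \<alpha> \<kappa>) = 0" if "\<kappa> \<in> B" for \<kappa>
    proof -
      have "(\<Sum>\<alpha>\<in>A'. c \<alpha> * (M \<alpha> \<kappa> - M \<alpha> \<kappa>0 / M \<alpha>0 \<kappa>0 * M \<alpha>0 \<kappa>)) =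
          (\<Sum>\<alpha>\<in>A'. c \<alpha> * M \<alpha> \<kappa>) - (\<Sum>\<alpha>\<in>A'. c \<alpha> * M \<alpha> \<kappa>0) * (M \<alpha>0 \<kappa> / M \<alpha>0 \<kappa>0)"
        by (simp add: algebra_simps sum_subtractf sum_distrib_left)
      then show ?thesis using eq[OF that] sum[of \<kappa>] by (simp add: x_def)
    qed
    moreover have "(\<Sum>\<alpha>\<in>A. c' \<alpha> * M \<alpha> \<kappa>0) = 0"
      using sum[of \<kappa>0] \<alpha>0 by (simp add: x_def)
    moreover have "\<exists>\<alpha>\<in>A. c' \<alpha> \<noteq> 0"
      using c A' by (auto simp: c'_def)
    ultimately show ?thesis by blast
  qed
qed

text \<open>The monomial \<open>\<Prod>s\<in>I. u\<^sub>s^k\<^sub>s v\<^sub>s^(D\<^sub>s - k\<^sub>s)\<close> in the coefficients of the linear polynomials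
  \<open>L\<^sub>s = u\<^sub>s + v\<^sub>s y\<close>.\<close>

definition coeff_monomial :: "'s set \<Rightarrow> ('s \<Rightarrow> nat) \<Rightarrow> ('s \<Rightarrow> nat) \<Rightarrow> ('s \<Rightarrow> 'a::field poly) \<Rightarrow> 'a" where
  "coeff_monomial I D k L = (\<Prod>s\<in>I. coeff (L s) 0 ^ k s * coeff (L s) 1 ^ (D s - k s))"

text \<open>Functions of the \<open>L\<^sub>s\<close> that are homogeneous of degree \<open>D\<^sub>s\<close> in each \<open>L\<^sub>s\<close>. They are described by a
  spanning set because only its size \<open>\<Prod>s\<in>I. D\<^sub>s + 1\<close> matters.\<close>

definition multihom :: "'s set \<Rightarrow> ('s \<Rightarrow> nat) \<Rightarrow> (('s \<Rightarrow> 'a::field poly) \<Rightarrow> 'a) \<Rightarrow> bool" where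
  "multihom I D \<Phi> \<longleftrightarrow> (\<exists>c. \<forall>L. (\<forall>s\<in>I. degree (L s) \<le> 1) \<longrightarrow>
     \<Phi> L = (\<Sum>k\<in>PiE I (\<lambda>s. {..D s}). c k * coeff_monomial I D k L))"

definition form_of :: "'s set \<Rightarrow> ('s \<Rightarrow> nat) \<Rightarrow> ('s \<Rightarrow> 'a::field poly) \<Rightarrow> 'a poly" where
  "form_of I w L = (\<Prod>s\<in>I. L s ^ w s)"

context
  fixes I :: "'s set"
  assumes I: "finite I"
begin

lemma multihom_cong:
  assumes "multihom I D \<Phi>" "\<And>L. (\<And>s. s \<in> I \<Longrightarrow> degree (L s) \<le> 1) \<Longrightarrow> \<Phi> L = \<Psi> L"
  shows "multihom I D \<Psi>"
proof -
  obtain c where "\<And>L. (\<forall>s\<in>I. degree (L s) \<le> 1) \<Longrightarrow> \<Phi> L = (\<Sum>k\<in>PiE I (\<lambda>s. {..D s}). c k * coeff_monomial I D k L)"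
    using assms(1) unfolding multihom_def by blast
  with assms(2) show ?thesis unfolding multihom_def by (intro exI[of _ c]) force
qed

lemma multihom_zero: "multihom I D (\<lambda>_. 0)"
  unfolding multihom_def by (rule exI[of _ "\<lambda>_. 0"]) simp

lemma multihom_add:
  assumes "multihom I D \<Phi>" "multihom I D \<Psi>"
  shows "multihom I D (\<lambda>L. \<Phi> L + \<Psi> L)"
proof -
  obtain a b where "\<And>L. (\<forall>s\<in>I. degree (L s) \<le> 1) \<Longrightarrow> \<Phi> L = (\<Sum>k\<in>PiE I (\<lambda>s. {..D s}). a k * coeff_monomial I D k L)"
    and "\<And>L. (\<forall>s\<in>I. degree (L s) \<le> 1) \<Longrightarrow> \<Psi> L = (\<Sum>k\<in>PiE I (\<lambda>s. {..D s}). b k * coeff_monomial I D k L)"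
    using assms unfolding multihom_def by blast
  then show ?thesis unfolding multihom_def
    by (intro exI[of _ "\<lambda>k. a k + b k"]) (simp add: algebra_simps sum.distrib)
qed

lemma multihom_scale:
  assumes "multihom I D \<Phi>"
  shows "multihom I D (\<lambda>L. x * \<Phi> L)"
proof -
  obtain a where "\<And>L. (\<forall>s\<in>I. degree (L s) \<le> 1) \<Longrightarrow> \<Phi> L = (\<Sum>k\<in>PiE I (\<lambda>s. {..D s}). a k * coeff_monomial I D k L)"
    using assms unfolding multihom_def by blast
  then show ?thesis unfolding multihom_def
    by (intro exI[of _ "\<lambda>k. x * a k"]) (simp add: sum_distrib_left mult.assoc)
qed

lemma multihom_sum:
  "(\<And>x. x \<in> S \<Longrightarrow> multihom I D (\<Phi> x)) \<Longrightarrow> multihom I D (\<lambda>L. \<Sum>x\<in>S. \<Phi> x L)"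
  by (induction S rule: infinite_finite_induct) (simp_all add: multihom_zero multihom_add)

lemma multihom_mon:
  assumes "\<And>s. s \<in> I \<Longrightarrow> k s \<le> D s"
  shows "multihom I D (coeff_monomial I D k :: ('s \<Rightarrow> 'a::field poly) \<Rightarrow> 'a)"
proof -
  let ?k = "restrict k I"
  have k: "?k \<in> PiE I (\<lambda>s. {..D s})" using assms by auto
  have "coeff_monomial I D ?k L = coeff_monomial I D k L" for L :: "'s \<Rightarrow> 'a poly"
    by (simp add: coeff_monomial_def)
  moreover have "(\<Sum>k\<in>PiE I (\<lambda>s. {..D s}). (if k = ?k then 1 else 0) * coeff_monomial I D k L) = coeff_monomial I D ?k L" for L :: "'s \<Rightarrow> 'a poly"
    using k I by (simp add: finite_PiE if_distrib[of "\<lambda>x. x * _"] cong: if_cong)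
  ultimately show ?thesis unfolding multihom_def
    by (intro exI[of _ "\<lambda>k. if k = ?k then 1 else 0"]) auto
qed

lemma multihom_mult:
  assumes "multihom I D \<Phi>" "multihom I E \<Psi>"
  shows "multihom I (\<lambda>s. D s + E s) (\<lambda>L. \<Phi> L * \<Psi> L)"
proof -
  obtain a b where a: "\<And>L. (\<forall>s\<in>I. degree (L s) \<le> 1) \<Longrightarrow> \<Phi> L = (\<Sum>k\<in>PiE I (\<lambda>s. {..D s}). a k * coeff_monomial I D k L)"
    and b: "\<And>L. (\<forall>s\<in>I. degree (L s) \<le> 1) \<Longrightarrow> \<Psi> L = (\<Sum>k\<in>PiE I (\<lambda>s. {..E s}). b k * coeff_monomial I E k L)"
    using assms unfolding multihom_def by blast
  have mon: "coeff_monomial I D k L * coeff_monomial I E l L = coeff_monomial I (\<lambda>s. D s + E s) (\<lambda>s. k s + l s) L"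
    if "k \<in> PiE I (\<lambda>s. {..D s})" "l \<in> PiE I (\<lambda>s. {..E s})" for k l and L :: "'s \<Rightarrow> 'a poly"
    unfolding coeff_monomial_def prod.distrib[symmetric]
  proof (rule prod.cong)
    fix s assume "s \<in> I"
    then have "k s \<le> D s" "l s \<le> E s" using that by auto
    then have "D s + E s - (k s + l s) = (D s - k s) + (E s - l s)" by simp
    then show "coeff (L s) 0 ^ k s * coeff (L s) 1 ^ (D s - k s) *
        (coeff (L s) 0 ^ l s * coeff (L s) 1 ^ (E s - l s)) =
        coeff (L s) 0 ^ (k s + l s) * coeff (L s) 1 ^ (D s + E s - (k s + l s))"
      by (simp add: power_add algebra_simps)
  qed simp
  have "multihom I (\<lambda>s. D s + E s) (\<lambda>L. \<Sum>k\<in>PiE I (\<lambda>s. {..D s}). \<Sum>l\<in>PiE I (\<lambda>s. {..E s}).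
      (a k * b l) * coeff_monomial I (\<lambda>s. D s + E s) (\<lambda>s. k s + l s) L)"
    by (intro multihom_sum multihom_scale multihom_mon add_mono) auto
  then show ?thesis
  proof (rule multihom_cong)
    fix L :: "'s \<Rightarrow> 'a poly" assume L: "\<And>s. s \<in> I \<Longrightarrow> degree (L s) \<le> 1"
    have "(\<Sum>k\<in>PiE I (\<lambda>s. {..D s}). \<Sum>l\<in>PiE I (\<lambda>s. {..E s}).
      (a k * b l) * coeff_monomial I (\<lambda>s. D s + E s) (\<lambda>s. k s + l s) L) =
      (\<Sum>k\<in>PiE I (\<lambda>s. {..D s}). \<Sum>l\<in>PiE I (\<lambda>s. {..E s}).
        (a k * coeff_monomial I D k L) * (b l * coeff_monomial I E l L))"
      by (intro sum.cong refl) (simp add: mon[symmetric] algebra_simps)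
    then show "(\<Sum>k\<in>PiE I (\<lambda>s. {..D s}). \<Sum>l\<in>PiE I (\<lambda>s. {..E s}).
      (a k * b l) * coeff_monomial I (\<lambda>s. D s + E s) (\<lambda>s. k s + l s) L) = \<Phi> L * \<Psi> L"
      using L by (simp add: a b sum_product)
  qed
qed

lemma multihom_const: "multihom I (\<lambda>_. 0) (\<lambda>_. x)"
  using multihom_scale[OF multihom_mon[of "\<lambda>_. 0" "\<lambda>_. 0"], of x] by (simp add: coeff_monomial_def)

lemma multihom_prod:
  assumes "finite S" "\<And>x. x \<in> S \<Longrightarrow> multihom I (D x) (\<Phi> x)"
  shows "multihom I (\<lambda>s. \<Sum>x\<in>S. D x s) (\<lambda>L. \<Prod>x\<in>S. \<Phi> x L)"
  using assms by (induction S rule: finite_induct) (simp_all add: multihom_const multihom_mult)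

lemma multihom_power:
  assumes "multihom I D \<Phi>"
  shows "multihom I (\<lambda>s. n * D s) (\<lambda>L. \<Phi> L ^ n)"
  using multihom_prod[of "{..<n}" "\<lambda>_. D" "\<lambda>_. \<Phi>"] assms by simp

lemma multihom_coeff_mult:
  assumes "\<And>l. multihom I D (\<lambda>L. coeff (P L) l)" "\<And>l. multihom I E (\<lambda>L. coeff (Q L) l)"
  shows "multihom I (\<lambda>s. D s + E s) (\<lambda>L. coeff (P L * Q L) l)"
  unfolding coeff_mult by (intro multihom_sum multihom_mult assms)

lemma multihom_coeff_linear:
  assumes "s \<in> I"
  shows "multihom I (\<lambda>r. if r = s then 1 else 0) (\<lambda>L. coeff (L s) l)"
proof -
  let ?D = "\<lambda>r. if r = s then 1 else 0 :: nat"
  have "coeff_monomial I ?D (\<lambda>_. 0) = (\<lambda>L :: 's \<Rightarrow> 'a poly. coeff (L s) 1)"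
  proof
    fix L :: "'s \<Rightarrow> 'a poly"
    have "coeff_monomial I ?D (\<lambda>_. 0) L = (\<Prod>r\<in>I. if r = s then coeff (L s) 1 else 1)"
      unfolding coeff_monomial_def by (rule prod.cong) auto
    then show "coeff_monomial I ?D (\<lambda>_. 0) L = coeff (L s) 1" using I assms by simp
  qed
  with multihom_mon[of "\<lambda>_. 0" ?D, where ?'a = 'a] have 1: "multihom I ?D (\<lambda>L :: 's \<Rightarrow> 'a poly. coeff (L s) 1)" by simp
  have "coeff_monomial I ?D ?D = (\<lambda>L :: 's \<Rightarrow> 'a poly. coeff (L s) 0)"
  proof
    fix L :: "'s \<Rightarrow> 'a poly"
    have "coeff_monomial I ?D ?D L = (\<Prod>r\<in>I. if r = s then coeff (L s) 0 else 1)"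
      unfolding coeff_monomial_def by (rule prod.cong) auto
    then show "coeff_monomial I ?D ?D L = coeff (L s) 0" using I assms by simp
  qed
  with multihom_mon[of ?D ?D, where ?'a = 'a] have 0: "multihom I ?D (\<lambda>L :: 's \<Rightarrow> 'a poly. coeff (L s) 0)" by simp
  consider "l = 0" | "l = 1" | "l > 1" by linarith
  then show ?thesis
  proof cases
    case 3
    show ?thesis
    proof (rule multihom_cong[OF multihom_zero])
      fix L :: "'s \<Rightarrow> 'a poly" assume "\<And>s. s \<in> I \<Longrightarrow> degree (L s) \<le> 1"
      then have "degree (L s) < l" using assms 3 by (meson le_less_trans)
      then show "0 = coeff (L s) l" by (simp add: coeff_eq_0)
    qed
  qed (use 0 1 in simp_all)
qed

lemma multihom_coeff_power:
  assumes "\<And>l. multihom I D (\<lambda>L. coeff (P L) l)"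
  shows "multihom I (\<lambda>s. n * D s) (\<lambda>L. coeff (P L ^ n) l)"
proof (induction n arbitrary: l)
  case 0
  show ?case by (cases "l = 0") (simp_all add: multihom_const)
next
  case (Suc n)
  show ?case using multihom_coeff_mult[OF assms Suc.IH] by simp
qed

lemma multihom_coeff_prod:
  assumes "finite S" "\<And>x l. x \<in> S \<Longrightarrow> multihom I (D x) (\<lambda>L. coeff (P x L) l)"
  shows "multihom I (\<lambda>s. \<Sum>x\<in>S. D x s) (\<lambda>L. coeff (\<Prod>x\<in>S. P x L) l)"
  using assms
proof (induction S arbitrary: l rule: finite_induct)
  case empty
  show ?case by (cases "l = 0") (simp_all add: multihom_const)
next
  case (insert x S)
  have "multihom I (\<lambda>s. D x s + (\<Sum>x\<in>S. D x s)) (\<lambda>L. coeff (P x L * (\<Prod>x\<in>S. P x L)) l)"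
    by (rule multihom_coeff_mult) (use insert in auto)
  then show ?case using insert by simp
qed

lemma multihom_form_of: "multihom I w (\<lambda>L. coeff (form_of I w L) l)"
proof -
  have "multihom I (\<lambda>r. \<Sum>s\<in>I. w s * (if r = s then 1 else 0)) (\<lambda>L. coeff (form_of I w L) l)"
    unfolding form_of_def
    by (intro multihom_coeff_prod multihom_coeff_power multihom_coeff_linear I)
  moreover have "(\<Sum>s\<in>I. w s * (if r = s then 1 else 0)) = w r" if "r \<in> I" for r
    using I that by (simp add: if_distrib cong: if_cong)
  moreover have "multihom I D \<Phi> \<Longrightarrow> (\<And>s. s \<in> I \<Longrightarrow> D s = w s) \<Longrightarrow> multihom I w \<Phi>"
    for D and \<Phi> :: "('s \<Rightarrow> 'a poly) \<Rightarrow> 'a"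
  proof -
    assume D: "multihom I D \<Phi>" and eq: "\<And>s. s \<in> I \<Longrightarrow> D s = w s"
    have "PiE I (\<lambda>s. {..D s}) = PiE I (\<lambda>s. {..w s})" using eq by (auto intro!: PiE_cong)
    moreover have "coeff_monomial I D k L = coeff_monomial I w k L" for k and L :: "'s \<Rightarrow> 'a poly"
      unfolding coeff_monomial_def by (rule prod.cong) (use eq in auto)
    ultimately show ?thesis using D by (simp add: multihom_def)
  qed
  ultimately show ?thesis by blast
qed

text \<open>A polynomial on the chart \<open>F\<^sub>i \<noteq> 0\<close>, evaluated at \<open>F = \<Prod>s\<in>I. L\<^sub>s^w\<^sub>s\<close> and multiplied by a power of
  \<open>F\<^sub>i\<close>, is multihomogeneous, since every coefficient of \<open>F\<close> has degree \<open>w\<^sub>s\<close> in \<open>L\<^sub>s\<close>.\<close>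

lemma multihom_homogenize:
  fixes g :: "'a::field mpoly"
  assumes "g \<in> mpoly_ring J"
  shows "\<exists>D. \<exists>\<Phi>. multihom I (\<lambda>s. D * w s) \<Phi> \<and> (\<forall>L. coeff (form_of I w L) i \<noteq> 0 \<longrightarrow>
     \<Phi> L = coeff (form_of I w L) i ^ D * meval (\<lambda>j. coeff (form_of I w L) j / coeff (form_of I w L) i) g)"
  using assms
proof (induction g rule: mpoly_ring_induct)
  case (const c)
  show ?case
    by (rule exI[of _ 0], rule exI[of _ "\<lambda>_. c"]) (simp add: multihom_const meval_const)
next
  case (var j)
  show ?case
    by (rule exI[of _ 1], rule exI[of _ "\<lambda>L. coeff (form_of I w L) j"])
      (use multihom_form_of in \<open>simp add: meval_var\<close>)
next
  case (add f g)
  obtain D \<Phi> where D: "multihom I (\<lambda>s. D * w s) \<Phi>"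
    and \<Phi>: "\<And>L. coeff (form_of I w L) i \<noteq> 0 \<Longrightarrow>
      \<Phi> L = coeff (form_of I w L) i ^ D * meval (\<lambda>j. coeff (form_of I w L) j / coeff (form_of I w L) i) f"
    using add by blast
  obtain E \<Psi> where E: "multihom I (\<lambda>s. E * w s) \<Psi>"
    and \<Psi>: "\<And>L. coeff (form_of I w L) i \<noteq> 0 \<Longrightarrow>
      \<Psi> L = coeff (form_of I w L) i ^ E * meval (\<lambda>j. coeff (form_of I w L) j / coeff (form_of I w L) i) g"
    using add by blast
  show ?case
  proof (rule exI[of _ "D + E"], rule exI[of _ "\<lambda>L. \<Phi> L * coeff (form_of I w L) i ^ E + \<Psi> L * coeff (form_of I w L) i ^ D"],
      intro conjI allI impI)
    show "multihom I (\<lambda>s. (D + E) * w s) (\<lambda>L. \<Phi> L * coeff (form_of I w L) i ^ E + \<Psi> L * coeff (form_of I w L) i ^ D)"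
      using multihom_mult[OF D multihom_power[OF multihom_form_of, of E w i]]
        multihom_mult[OF E multihom_power[OF multihom_form_of, of D w i]]
      by (intro multihom_add) (simp_all add: algebra_simps)
  qed (simp add: \<Phi> \<Psi> meval_add power_add algebra_simps)
next
  case (mult f g)
  obtain D \<Phi> where D: "multihom I (\<lambda>s. D * w s) \<Phi>"
    and \<Phi>: "\<And>L. coeff (form_of I w L) i \<noteq> 0 \<Longrightarrow>
      \<Phi> L = coeff (form_of I w L) i ^ D * meval (\<lambda>j. coeff (form_of I w L) j / coeff (form_of I w L) i) f"
    using mult by blast
  obtain E \<Psi> where E: "multihom I (\<lambda>s. E * w s) \<Psi>"
    and \<Psi>: "\<And>L. coeff (form_of I w L) i \<noteq> 0 \<Longrightarrow>
      \<Psi> L = coeff (form_of I w L) i ^ E * meval (\<lambda>j. coeff (form_of I w L) j / coeff (form_of I w L) i) g"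
    using mult by blast
  show ?case
  proof (rule exI[of _ "D + E"], rule exI[of _ "\<lambda>L. \<Phi> L * \<Psi> L"], intro conjI allI impI)
    show "multihom I (\<lambda>s. (D + E) * w s) (\<lambda>L. \<Phi> L * \<Psi> L)"
      using multihom_mult[OF D E] by (simp add: algebra_simps)
  qed (simp add: \<Phi> \<Psi> meval_mult power_add algebra_simps)
qed

text \<open>If the chain had length \<open>card I + 1\<close>, its \<open>(N + 1)^(card I + 1)\<close> independent monomials would be
  multihomogeneous of degree proportional to \<open>N\<close>, where there is room for only about \<open>N^(card I)\<close>
  independent functions.\<close>

lemma chain_length_bound:
  fixes C :: "nat \<Rightarrow> (nat \<Rightarrow> 'a::field) set"
  assumes Z: "Z \<subseteq> aff_space J"
    and param: "\<And>z. z \<in> Z \<Longrightarrow> \<exists>L. (\<forall>s\<in>I. degree (L s) \<le> 1) \<and> coeff (form_of I w L) i \<noteq> 0 \<and>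
       (\<forall>j\<in>J. z j = coeff (form_of I w L) j / coeff (form_of I w L) i)"
    and n: "n = Suc (card I)"
    and irr: "\<And>k. k \<le> n \<Longrightarrow> closedin (subtopology (zariski J) Z) (C k) \<and> irreducible_in (subtopology (zariski J) Z) (C k)"
    and strict: "\<And>k. k < n \<Longrightarrow> C k \<subset> C (Suc k)"
  shows False
proof -
  have CZ: "C k \<subseteq> Z" if "k \<le> n" for k
    using irr[OF that] topspace_sub_zariski[OF Z] by (auto simp: irreducible_in_def)
  have "\<exists>f\<in>mpoly_ring J. (\<exists>p\<in>C (Suc k). meval p f \<noteq> 0) \<and> (\<forall>q\<in>C k. meval q f = 0)" if k: "k < n" for k
  proof -
    obtain p where "p \<in> C (Suc k)" "p \<notin> C k" using strict[OF k] by blast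
    with zariski_closed_separation[of J Z "C k" p] irr[of k] CZ[of "Suc k"] k Z show ?thesis by auto
  qed
  then obtain g where g: "\<And>k. k < n \<Longrightarrow> g k \<in> mpoly_ring J"
    "\<And>k. k < n \<Longrightarrow> \<exists>p\<in>C (Suc k). meval p (g k) \<noteq> 0"
    "\<And>k q. k < n \<Longrightarrow> q \<in> C k \<Longrightarrow> meval q (g k) = 0"
    by metis
  define F where "F L l = coeff (form_of I w L) l" for L :: "'s \<Rightarrow> 'a poly" and l
  have "\<exists>D. \<exists>\<Phi>. multihom I (\<lambda>s. D * w s) \<Phi> \<and>
      (\<forall>L. F L i \<noteq> 0 \<longrightarrow> \<Phi> L = F L i ^ D * meval (\<lambda>j. F L j / F L i) (g k))" if "k < n" for k
    unfolding F_def using multihom_homogenize[OF g(1)[OF that]] by blast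
  then obtain D0 \<Phi>0 where D0: "\<And>k. k < n \<Longrightarrow> multihom I (\<lambda>s. D0 k * w s) (\<Phi>0 k)"
    "\<And>k L. k < n \<Longrightarrow> F L i \<noteq> 0 \<Longrightarrow> \<Phi>0 k L = F L i ^ D0 k * meval (\<lambda>j. F L j / F L i) (g k)"
    by metis
  \<comment> \<open>A common degree for all \<open>g k\<close>; missing factors are supplied by powers of \<open>F L i\<close>.\<close>
  define D where "D = (\<Sum>k<n. D0 k)"
  have D: "D0 k \<le> D" if "k < n" for k
    unfolding D_def using that by (intro member_le_sum) auto
  define \<Phi> where "\<Phi> k L = \<Phi>0 k L * F L i ^ (D - D0 k)" for k L
  have hom: "multihom I (\<lambda>s. D * w s) (\<Phi> k)" if "k < n" for k
    using multihom_mult[OF D0(1)[OF that] multihom_power[OF multihom_form_of, of "D - D0 k" w i]] D[OF that]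
    unfolding \<Phi>_def F_def by (simp add: add_mult_distrib[symmetric])
  have \<Phi>: "\<Phi> k L = F L i ^ D * meval (\<lambda>j. F L j / F L i) (g k)" if "k < n" "F L i \<noteq> 0" for k L
    using D0(2)[OF that] D[OF that(1)] by (simp add: \<Phi>_def mult_ac flip: power_add)
  define W where "W = (\<Sum>s\<in>I. w s)"
  \<comment> \<open>The target space has dimension at most \<open>((K + 1) (N + 1))^(card I)\<close>; the choice of \<open>N\<close> makes
    this smaller than \<open>(N + 1)^(card I + 1)\<close>.\<close>
  define K where "K = n * D * W"
  define N where "N = Suc K ^ card I"
  define E where "E s = n * D * N * w s" for s
  define A where "A = PiE {..<n} (\<lambda>_. {..N})"
  define B where "B = PiE I (\<lambda>s. {..E s})"
  have finAB: "finite A" "finite B" unfolding A_def B_def using I by (auto intro: finite_PiE)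
  have "card B = (\<Prod>s\<in>I. Suc (E s))" unfolding B_def using I by (simp add: card_PiE)
  also have "\<dots> \<le> (\<Prod>s\<in>I. Suc K * Suc N)"
  proof (rule prod_mono)
    fix s assume "s \<in> I"
    then have "w s \<le> W" unfolding W_def using I by (intro member_le_sum) auto
    then have "E s \<le> K * N" unfolding E_def K_def by (simp add: mult_ac)
    then show "0 \<le> Suc (E s) \<and> Suc (E s) \<le> Suc K * Suc N" by simp
  qed
  also have "\<dots> = N * Suc N ^ card I" by (simp add: N_def power_mult_distrib del: mult_Suc mult_Suc_right)
  also have "\<dots> < Suc N ^ n" by (simp add: n)
  also have "\<dots> = card A" unfolding A_def by (simp add: card_PiE)
  finally have card: "card B < card A" .
  define \<Theta> where "\<Theta> \<alpha> L = (\<Prod>k<n. \<Phi> k L ^ \<alpha> k * (F L i ^ D) ^ (N - \<alpha> k))" for \<alpha> L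
  have "multihom I E (\<Theta> \<alpha>)" if \<alpha>: "\<alpha> \<in> A" for \<alpha>
  proof -
    have "multihom I (\<lambda>s. D * N * w s) (\<lambda>L. \<Phi> k L ^ \<alpha> k * (F L i ^ D) ^ (N - \<alpha> k))" if k: "k < n" for k
    proof -
      have "\<alpha> k \<le> N" using \<alpha> k by (auto simp: A_def)
      then have "\<alpha> k * (D * w s) + (N - \<alpha> k) * (D * w s) = D * N * w s" for s
        by (simp only: add_mult_distrib[symmetric] le_add_diff_inverse) simp
      then show ?thesis
        using multihom_mult[OF multihom_power[OF hom[OF k], of "\<alpha> k"]
            multihom_power[OF multihom_power[OF multihom_form_of, of D w i], of "N - \<alpha> k"]]
        by (simp add: F_def)
    qed
    then have "multihom I (\<lambda>s. \<Sum>k<n. D * N * w s) (\<Theta> \<alpha>)"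
      unfolding \<Theta>_def by (intro multihom_prod) auto
    then show ?thesis by (simp add: E_def[abs_def] mult_ac)
  qed
  then obtain M where M: "\<And>\<alpha> L. \<alpha> \<in> A \<Longrightarrow> (\<forall>s\<in>I. degree (L s) \<le> 1) \<Longrightarrow>
      \<Theta> \<alpha> L = (\<Sum>k\<in>B. M \<alpha> k * coeff_monomial I E k L)"
    unfolding multihom_def B_def by metis
  obtain c where c: "\<exists>\<alpha>\<in>A. c \<alpha> \<noteq> 0" "\<And>k. k \<in> B \<Longrightarrow> (\<Sum>\<alpha>\<in>A. c \<alpha> * M \<alpha> k) = 0"
    using underdetermined_system[OF finAB(2,1) card, of M] by blast
  have rel: "(\<Sum>\<alpha>\<in>A. c \<alpha> * \<Theta> \<alpha> L) = 0" if "\<forall>s\<in>I. degree (L s) \<le> 1" for L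
  proof -
    have "(\<Sum>\<alpha>\<in>A. c \<alpha> * \<Theta> \<alpha> L) = (\<Sum>\<alpha>\<in>A. \<Sum>k\<in>B. c \<alpha> * M \<alpha> k * coeff_monomial I E k L)"
      using that by (simp add: M sum_distrib_left mult.assoc)
    also have "\<dots> = (\<Sum>k\<in>B. (\<Sum>\<alpha>\<in>A. c \<alpha> * M \<alpha> k) * coeff_monomial I E k L)"
      by (subst sum.swap) (simp add: sum_distrib_right)
    finally show ?thesis using c(2) by simp
  qed
  have "c \<alpha> = 0" if "\<alpha> \<in> A" for \<alpha>
  proof (rule chain_monomials_independent[OF Z, where n = n and C = C and g = g and N = N and c = c])
    fix p assume "p \<in> C n"
    then obtain L where L: "\<forall>s\<in>I. degree (L s) \<le> 1" "F L i \<noteq> 0" "\<forall>j\<in>J. p j = F L j / F L i"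
      using param[of p] CZ[of n] unfolding F_def by auto
    have ev: "meval p (g k) = meval (\<lambda>j. F L j / F L i) (g k)" if "k < n" for k
      by (rule meval_cong[OF g(1)[OF that]]) (use L in auto)
    have "\<Theta> \<alpha> L = F L i ^ (D * N * n) * (\<Prod>k<n. meval p (g k) ^ \<alpha> k)" if \<alpha>: "\<alpha> \<in> A" for \<alpha>
    proof -
      have "\<Theta> \<alpha> L = (\<Prod>k<n. F L i ^ (D * N) * meval p (g k) ^ \<alpha> k)"
        unfolding \<Theta>_def
      proof (rule prod.cong)
        fix k assume "k \<in> {..<n}"
        then have k: "k < n" "\<alpha> k \<le> N" using \<alpha> by (auto simp: A_def)
        have "D * \<alpha> k + D * (N - \<alpha> k) = D * N"
          using k by (simp add: distrib_left[symmetric])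
        then have "(F L i ^ D) ^ \<alpha> k * (F L i ^ D) ^ (N - \<alpha> k) = F L i ^ (D * N)"
          by (simp flip: power_mult power_add)
        then show "\<Phi> k L ^ \<alpha> k * (F L i ^ D) ^ (N - \<alpha> k) = F L i ^ (D * N) * meval p (g k) ^ \<alpha> k"
          using \<Phi>[OF k(1) L(2)] ev[OF k(1)] by (simp add: power_mult_distrib mult_ac)
      qed simp
      then show ?thesis by (simp add: prod.distrib power_mult)
    qed
    then have "F L i ^ (D * N * n) * (\<Sum>\<alpha>\<in>A. c \<alpha> * (\<Prod>k<n. meval p (g k) ^ \<alpha> k)) = 0"
      using rel[OF L(1)] by (simp add: sum_distrib_left mult_ac)
    then show "(\<Sum>\<alpha>\<in>PiE {..<n} (\<lambda>_. {..N}). c \<alpha> * (\<Prod>k<n. meval p (g k) ^ \<alpha> k)) = 0"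
      using L(2) by (simp add: A_def)
  qed (use irr strict g that in \<open>auto simp: A_def\<close>)
  with c(1) show False by blast
qed

lemma krull_dim_le_card:
  fixes Z :: "(nat \<Rightarrow> 'a::field) set"
  assumes Z: "Z \<subseteq> aff_space J"
    and param: "\<And>z. z \<in> Z \<Longrightarrow> \<exists>L. (\<forall>s\<in>I. degree (L s) \<le> 1) \<and> coeff (form_of I w L) i \<noteq> 0 \<and>
       (\<forall>j\<in>J. z j = coeff (form_of I w L) j / coeff (form_of I w L) i)"
  shows "krull_dim (subtopology (zariski J) Z) \<le> enat (card I)"
  unfolding krull_dim_def
proof (rule Sup_least, clarify)
  fix n C
  assume C: "\<forall>i\<le>n. closedin (subtopology (zariski J) Z) (C i) \<and> irreducible_in (subtopology (zariski J) Z) (C i)"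
    "\<forall>i<n. C i \<subset> C (Suc i)"
  show "enat n \<le> enat (card I)"
  proof (rule ccontr)
    assume "\<not> enat n \<le> enat (card I)"
    then have "Suc (card I) \<le> n" by simp
    with C show False by (intro chain_length_bound[OF Z param refl, of C]) auto
  qed
qed

end


section \<open>Tangent vectors at the most degenerate point\<close>

lemma coeff_linear_product:
  assumes "finite S"
  shows "coeff (pCons 0 (\<Prod>s\<in>S. [:- b s, 1:])) (card S) = - (\<Sum>s\<in>S. b s :: 'a::field)"
    and "coeff (\<Prod>s\<in>S. [:- b s, 1:]) (card S) = 1"
    and "degree (\<Prod>s\<in>S. [:- b s, 1:]) = card S"
proof -
  have deg: "degree (\<Prod>s\<in>T. [:- b s, 1:]) = card T" if "finite T" for T
    using that by (subst degree_prod_eq_sum_degree) auto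
  have lead: "coeff (\<Prod>s\<in>T. [:- b s, 1:]) (card T) = 1" if "finite T" for T
    using lead_coeff_prod[of "\<lambda>s. [:- b s, 1:]" T] deg[OF that] by simp
  then show "coeff (\<Prod>s\<in>S. [:- b s, 1:]) (card S) = 1" using assms by blast
  show "coeff (pCons 0 (\<Prod>s\<in>S. [:- b s, 1:])) (card S) = - (\<Sum>s\<in>S. b s)"
    using assms
  proof (induction S rule: finite_induct)
    case empty
    then show ?case by simp
  next
    case (insert x S)
    have "coeff (pCons 0 (\<Prod>s\<in>insert x S. [:- b s, 1:])) (card (insert x S)) =
      coeff ([:- b x, 1:] * (\<Prod>s\<in>S. [:- b s, 1:])) (card S)"
      using insert by simp
    also have "\<dots> = - b x * coeff (\<Prod>s\<in>S. [:- b s, 1:]) (card S) +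
        coeff (pCons 0 (\<Prod>s\<in>S. [:- b s, 1:])) (card S)"
      by (simp add: mult_pCons_left)
    finally show ?case using insert lead by simp
  qed
  show "degree (\<Prod>s\<in>S. [:- b s, 1:]) = card S" by (rule deg[OF assms])
qed

lemma coeff_form_of_low:
  assumes "finite I"
  shows "coeff (form_of I w (\<lambda>s. [:1, b s:])) 0 = (1 :: 'a::field)"
    and "coeff (form_of I w (\<lambda>s. [:1, b s:])) 1 = (\<Sum>s\<in>I. of_nat (w s) * b s)"
proof -
  have pow: "coeff ([:1, c:] ^ n) 0 = 1 \<and> coeff ([:1, c:] ^ n) 1 = of_nat n * c" for c :: 'a and n
    by (induction n) (auto simp: mult_pCons_left algebra_simps)
  have mult: "coeff (p * q) 1 = coeff p 0 * coeff q 1 + coeff p 1 * coeff q 0" for p q :: "'a poly"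
    by (simp add: coeff_mult)
  have "coeff (\<Prod>s\<in>I. [:1, b s:] ^ w s) 0 = 1 \<and>
      coeff (\<Prod>s\<in>I. [:1, b s:] ^ w s) 1 = (\<Sum>s\<in>I. of_nat (w s) * b s)"
    using assms
    by (induction I rule: finite_induct) (use pow in \<open>auto simp: mult coeff_mult_0 simp del: One_nat_def\<close>)
  then show "coeff (form_of I w (\<lambda>s. [:1, b s:])) 0 = 1"
    "coeff (form_of I w (\<lambda>s. [:1, b s:])) 1 = (\<Sum>s\<in>I. of_nat (w s) * b s)"
    unfolding form_of_def by auto
qed

lemma degree_form_of:
  assumes "finite I" "\<And>s. s \<in> I \<Longrightarrow> degree (L s) \<le> 1"
  shows "degree (form_of I w L) \<le> (\<Sum>s\<in>I. w s)"
proof -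
  have "degree (form_of I w L) \<le> sum (degree \<circ> (\<lambda>s. L s ^ w s)) I"
    unfolding form_of_def by (rule degree_prod_sum_le[OF assms(1)])
  also have "\<dots> \<le> (\<Sum>s\<in>I. w s)"
  proof (rule sum_mono)
    fix s assume "s \<in> I"
    then show "(degree \<circ> (\<lambda>s. L s ^ w s)) s \<le> w s"
      using degree_power_le[of "L s" "w s"] assms(2)[of s] by (simp add: order_trans)
  qed
  finally show ?thesis .
qed

text \<open>The coefficients of the power series quotient of \<open>\<Sum>l. a\<^sub>l y^l\<close> by \<open>1 + \<beta> y\<close>, as polynomials in \<open>\<beta>\<close>.\<close>

primrec quotient_coeff :: "(nat \<Rightarrow> 'a::field) \<Rightarrow> nat \<Rightarrow> 'a poly" where
  "quotient_coeff a 0 = [:a 0:]"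
| "quotient_coeff a (Suc l) = [:a (Suc l):] - pCons 0 (quotient_coeff a l)"

lemma quotient_coeff:
  assumes "A = [:1, \<beta>:] * B"
  shows "coeff B l = poly (quotient_coeff (coeff A) l) \<beta>"
  by (induction l) (use assms in \<open>auto simp: mult_pCons_left\<close>)

lemma degree_quotient_coeff: "degree (quotient_coeff a l) \<le> l"
proof (induction l)
  case (Suc l)
  have "degree (pCons 0 (quotient_coeff a l)) \<le> Suc l"
    using Suc degree_pCons_le le_trans Suc_le_mono by blast
  then show ?case by (auto intro: degree_diff_le)
qed simp

lemma coeff_quotient_coeff: "coeff (quotient_coeff a l) l = (-1) ^ l * a 0"
  by (induction l) auto

lemma coeff_quotient_coeff': "coeff (quotient_coeff a (Suc l)) l = (-1) ^ l * a 1"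
proof (induction l)
  case (Suc l)
  then show ?case by (subst quotient_coeff.simps(2)) (simp del: quotient_coeff.simps)
qed simp

text \<open>The derivative of \<open>A = \<Prod>s\<in>I. (1 + b\<^sub>s y)^w\<^sub>s\<close> in \<open>b\<^sub>s\<close> is \<open>w\<^sub>s y A / (1 + b\<^sub>s y)\<close>, and the chain rule
  turns the vanishing of \<open>f\<close> on all such \<open>A\<close> into a linear relation between the partial derivatives
  of \<open>f\<close> at \<open>A\<close>.\<close>

lemma tangent_origin_relation:
  fixes b :: "'s \<Rightarrow> 'a::field_char_0"
  assumes I: "finite I" and s: "s \<in> I" "w s > 0"
    and f: "f \<in> mpoly_ring {1..d}"
    and van: "\<And>b. meval (coeff (form_of I w (\<lambda>s. [:1, b s:]))) f = 0"
  shows "(\<Sum>j\<in>{1..d}. meval (coeff (form_of I w (\<lambda>s. [:1, b s:]))) (mpderiv j f) *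
      poly (quotient_coeff (coeff (form_of I w (\<lambda>s. [:1, b s:]))) (j - 1)) (b s)) = 0"
proof -
  define R where "R = (\<Prod>r\<in>I - {s}. [:1, b r:] ^ w r)"
  \<comment> \<open>\<open>B\<close> is the quotient of the product by \<open>1 + b s y\<close>.\<close>
  define B where "B = [:1, b s:] ^ (w s - 1) * R"
  have form: "form_of I w (\<lambda>r. [:1, (b(s := x)) r:]) = [:1, x:] ^ w s * R" for x
  proof -
    have "form_of I w (\<lambda>r. [:1, (b(s := x)) r:]) =
        [:1, x:] ^ w s * (\<Prod>r\<in>I - {s}. [:1, (b(s := x)) r:] ^ w r)"
      unfolding form_of_def using I s by (subst prod.remove[of I s]) auto
    also have "(\<Prod>r\<in>I - {s}. [:1, (b(s := x)) r:] ^ w r) = R"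
      unfolding R_def by (rule prod.cong) auto
    finally show ?thesis .
  qed
  have form_b: "form_of I w (\<lambda>r. [:1, b r:]) = [:1, b s:] * B"
  proof -
    have "[:1, b s:] ^ w s = [:1, b s:] * [:1, b s:] ^ (w s - 1)"
      using s(2) by (simp add: power_eq_if)
    with form[of "b s"] show ?thesis unfolding B_def fun_upd_triv by (simp only: mult.assoc)
  qed
  define \<Theta> where "\<Theta> t = ([:1, b s:] + smult t [:0, 1:]) ^ w s * R" for t
  define \<Theta>' where "\<Theta>' t = smult (of_nat (w s)) (([:1, b s:] + smult t [:0, 1:]) ^ (w s - 1) * [:0, 1:]) * R" for t
  have "curve.coeffwise \<Theta> \<Theta>'"
    unfolding \<Theta>_def \<Theta>'_def by (rule curve_line_power)
  then have chain: "(\<lambda>t. meval (coeff (\<Theta> t)) f,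
      \<lambda>t. \<Sum>j\<in>{1..d}. meval (coeff (\<Theta> t)) (mpderiv j f) * coeff (\<Theta>' t) j) \<in> curve_alg"
    by (intro curve.chain_rule[OF finite_atLeastAtMost f]) (simp add: curve.coeffwise_def)
  have \<Theta>: "\<Theta> t = form_of I w (\<lambda>r. [:1, (b(s := b s + t)) r:])" for t
    by (simp only: form \<Theta>_def) simp
  have "(\<Sum>j\<in>{1..d}. meval (coeff (\<Theta> 0)) (mpderiv j f) * coeff (\<Theta>' 0) j) = 0"
    by (rule curve_constant[OF chain]) (unfold \<Theta>, rule van)
  moreover have "\<Theta> 0 = form_of I w (\<lambda>r. [:1, b r:])"
    by (simp only: \<Theta> add_0_right fun_upd_triv)
  moreover have "coeff (\<Theta>' 0) j = of_nat (w s) * poly (quotient_coeff (coeff (form_of I w (\<lambda>r. [:1, b r:]))) (j - 1)) (b s)"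
    if "j \<in> {1..d}" for j
  proof -
    have "\<Theta>' 0 = smult (of_nat (w s)) (pCons 0 B)"
      by (simp add: \<Theta>'_def B_def mult_ac)
    moreover obtain i where "j = Suc i" using \<open>j \<in> {1..d}\<close> by (cases j) auto
    ultimately show ?thesis
      using quotient_coeff[OF form_b] by simp
  qed
  ultimately have "of_nat (w s) * (\<Sum>j\<in>{1..d}. meval (coeff (form_of I w (\<lambda>s. [:1, b s:]))) (mpderiv j f) *
      poly (quotient_coeff (coeff (form_of I w (\<lambda>s. [:1, b s:]))) (j - 1)) (b s)) = 0"
    by (simp add: sum_distrib_left mult_ac)
  then show ?thesis using s(2) by simp
qed

lemma form_of_scale:
  fixes b :: "'s \<Rightarrow> 'a::field"
  shows "coeff (form_of I w (\<lambda>s. [:1, \<sigma> * b s:])) l = \<sigma> ^ l * coeff (form_of I w (\<lambda>s. [:1, b s:])) l"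
proof -
  have pow: "pcompose (p ^ n) q = pcompose p q ^ n" for p q :: "'a poly" and n
    by (induction n) (simp_all add: pcompose_1 pcompose_mult)
  have "form_of I w (\<lambda>s. [:1, \<sigma> * b s:]) = pcompose (form_of I w (\<lambda>s. [:1, b s:])) [:0, \<sigma>:]"
    unfolding form_of_def pcompose_prod pow by (simp add: pcompose_pCons mult.commute)
  then show ?thesis by (simp add: coeff_pcompose_linear)
qed

lemma quotient_coeff_scale:
  "poly (quotient_coeff (\<lambda>l. \<sigma> ^ l * a l) n) (\<sigma> * \<beta>) = \<sigma> ^ n * poly (quotient_coeff a n) \<beta>"
  by (induction n) (auto simp: algebra_simps)

text \<open>The Taylor expansion of \<open>g\<close> to first order along the curve \<open>\<sigma> \<mapsto> (\<sigma>^l a\<^sub>l)\<^sub>l\<close>, whose velocity at the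
  origin points in the first coordinate direction.\<close>

lemma meval_scaled_curve:
  fixes a :: "nat \<Rightarrow> 'a::field_char_0"
  assumes "g \<in> mpoly_ring {1..d}" "d \<ge> 1"
  obtains q where "\<And>\<sigma>. poly q \<sigma> = meval (\<lambda>l. \<sigma> ^ l * a l) g"
    and "coeff q 0 = meval (\<lambda>_. 0) g"
    and "coeff q 1 = meval (\<lambda>_. 0) (mpderiv 1 g) * a 1"
proof -
  have "(\<lambda>t. meval (\<lambda>j. poly (monom (a j) j) t) g, \<lambda>t. \<Sum>j\<in>{1..d}.
      meval (\<lambda>j. poly (monom (a j) j) t) (mpderiv j g) * poly (pderiv (monom (a j) j)) t) \<in> curve_alg"
    by (rule curve.chain_rule[OF finite_atLeastAtMost assms(1) curve_algI])
  then obtain q where q: "\<And>t. poly q t = meval (\<lambda>j. poly (monom (a j) j) t) g"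
    "\<And>t. poly (pderiv q) t = (\<Sum>j\<in>{1..d}. meval (\<lambda>j. poly (monom (a j) j) t) (mpderiv j g) * poly (pderiv (monom (a j) j)) t)"
    by (rule curve_algE) (rule that)
  have zero: "meval (\<lambda>j. poly (monom (a j) j) 0) h = meval (\<lambda>_. 0) h" if "h \<in> mpoly_ring {1..d}" for h
    by (rule meval_cong[OF that]) (auto simp: poly_monom)
  have "coeff q 0 = meval (\<lambda>_. 0) g"
    using q(1)[of 0] zero[OF assms(1)] by (simp add: poly_0_coeff_0)
  moreover have "coeff q 1 = meval (\<lambda>_. 0) (mpderiv 1 g) * a 1"
  proof -
    have "coeff q 1 = poly (pderiv q) 0"
      by (simp add: poly_0_coeff_0 coeff_pderiv)
    also have "\<dots> = (\<Sum>j\<in>{1..d}. if j = 1 then meval (\<lambda>_. 0) (mpderiv 1 g) * a 1 else 0)"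
      unfolding q(2)
    proof (rule sum.cong)
      fix j assume j: "j \<in> {1..d}"
      have "poly (pderiv (monom (a j) j)) 0 = (if j = 1 then a 1 else 0)"
        using j by (auto simp: poly_0_coeff_0 coeff_pderiv)
      then show "meval (\<lambda>j. poly (monom (a j) j) 0) (mpderiv j g) * poly (pderiv (monom (a j) j)) 0 =
          (if j = 1 then meval (\<lambda>_. 0) (mpderiv 1 g) * a 1 else 0)"
        using zero[OF mpoly_ring_mpderiv[OF assms(1)], of j] by simp
    qed simp
    finally show ?thesis using assms(2) by simp
  qed
  moreover have "poly q \<sigma> = meval (\<lambda>l. \<sigma> ^ l * a l) g" for \<sigma>
    using q(1)[of \<sigma>] by (simp add: poly_monom mult.commute)
  ultimately show ?thesis using that by blast
qed

text \<open>Apply the relation above at \<open>\<sigma> b\<close> and take the coefficient of \<open>\<sigma>^k\<close>. The terms with index above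
  \<open>k + 1\<close> drop out, and what remains is a polynomial evaluated at \<open>b\<^sub>s\<close> that is the same for all \<open>s\<close>.
  Its two leading coefficients involve only first and second derivatives of \<open>f\<close> at the origin, which
  are constants, and the linear form \<open>\<Sum>s\<in>I. w\<^sub>s b\<^sub>s\<close>, which is the coefficient of \<open>y\<close> in the product.\<close>

lemma tangent_origin_polynomial:
  fixes b :: "'s \<Rightarrow> 'a::field_char_0"
  assumes I: "finite I" and w: "\<And>s. s \<in> I \<Longrightarrow> w s > 0"
    and f: "f \<in> mpoly_ring {1..d}"
    and van: "\<And>b. meval (coeff (form_of I w (\<lambda>s. [:1, b s:]))) f = 0"
    and k: "k < d"
  shows "\<exists>Q. degree Q \<le> k \<and> (\<forall>s\<in>I. poly Q (b s) = 0) \<and>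
    coeff Q k = (-1) ^ k * meval (\<lambda>_. 0) (mpderiv (Suc k) f) \<and>
    (k > 0 \<longrightarrow> coeff Q (k - 1) = (-1) ^ (k - 1) *
       (meval (\<lambda>_. 0) (mpderiv (Suc k) f) + meval (\<lambda>_. 0) (mpderiv 1 (mpderiv k f))) *
       (\<Sum>s\<in>I. of_nat (w s) * b s))"
proof -
  define a where "a = coeff (form_of I w (\<lambda>s. [:1, b s:]))"
  have a0: "a 0 = 1" and a1: "a 1 = (\<Sum>s\<in>I. of_nat (w s) * b s)"
    unfolding a_def by (rule coeff_form_of_low[OF I])+
  have d: "d \<ge> 1" using k by simp
  have "\<exists>q. (\<forall>\<sigma>. poly q \<sigma> = meval (\<lambda>l. \<sigma> ^ l * a l) (mpderiv j f)) \<and>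
      coeff q 0 = meval (\<lambda>_. 0) (mpderiv j f) \<and>
      coeff q 1 = meval (\<lambda>_. 0) (mpderiv 1 (mpderiv j f)) * a 1" for j
    by (rule meval_scaled_curve[OF mpoly_ring_mpderiv[OF f, of j] d, of a]) blast
  then obtain q where q: "\<And>j \<sigma>. poly (q j) \<sigma> = meval (\<lambda>l. \<sigma> ^ l * a l) (mpderiv j f)"
    "\<And>j. coeff (q j) 0 = meval (\<lambda>_. 0) (mpderiv j f)"
    "\<And>j. coeff (q j) 1 = meval (\<lambda>_. 0) (mpderiv 1 (mpderiv j f)) * a 1"
    by metis
  define Q where "Q = (\<Sum>j\<le>k. smult (coeff (q (Suc j)) (k - j)) (quotient_coeff a j))"
  have "poly Q (b s) = 0" if s: "s \<in> I" for s
  proof -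
    define P where "P = (\<Sum>j\<in>{1..d}. monom (poly (quotient_coeff a (j - 1)) (b s)) (j - 1) * q j)"
    have "poly P \<sigma> = 0" for \<sigma>
    proof -
      have "coeff (form_of I w (\<lambda>r. [:1, \<sigma> * b r:])) = (\<lambda>l. \<sigma> ^ l * a l)"
        by (rule ext) (simp add: form_of_scale a_def)
      then have "(\<Sum>j\<in>{1..d}. meval (\<lambda>l. \<sigma> ^ l * a l) (mpderiv j f) *
          poly (quotient_coeff (\<lambda>l. \<sigma> ^ l * a l) (j - 1)) (\<sigma> * b s)) = 0"
        using tangent_origin_relation[OF I s w[OF s] f van, of "\<lambda>r. \<sigma> * b r"] by simp
      moreover have "poly P \<sigma> = (\<Sum>j\<in>{1..d}. meval (\<lambda>l. \<sigma> ^ l * a l) (mpderiv j f) *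
          poly (quotient_coeff (\<lambda>l. \<sigma> ^ l * a l) (j - 1)) (\<sigma> * b s))"
        unfolding P_def poly_sum
        by (rule sum.cong) (simp_all add: poly_monom q(1) quotient_coeff_scale)
      ultimately show ?thesis by simp
    qed
    then have "P = 0" using poly_all_0_iff_0 by blast
    have "0 = coeff P k" by (simp add: \<open>P = 0\<close>)
    also have "\<dots> = (\<Sum>j\<in>{1..d}. if k < j - 1 then 0 else poly (quotient_coeff a (j - 1)) (b s) * coeff (q j) (k - (j - 1)))"
      by (simp add: P_def coeff_sum coeff_monom_mult del: One_nat_def)
    also have "\<dots> = (\<Sum>j<d. if k < j then 0 else poly (quotient_coeff a j) (b s) * coeff (q (Suc j)) (k - j))"
      by (rule sum.reindex_bij_witness[of _ Suc "\<lambda>j. j - 1"]) auto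
    also have "\<dots> = (\<Sum>j\<le>k. poly (quotient_coeff a j) (b s) * coeff (q (Suc j)) (k - j))"
      by (rule sum.mono_neutral_cong_right) (use k in auto)
    also have "\<dots> = poly Q (b s)" by (simp add: Q_def poly_sum mult_ac)
    finally show ?thesis by simp
  qed
  moreover have "degree Q \<le> k"
    unfolding Q_def using degree_quotient_coeff
    by (intro degree_sum_le) (auto intro: order_trans[OF degree_smult_le] order_trans)
  moreover have high: "coeff (quotient_coeff a j) l = 0" if "j < l" for j l
    using degree_quotient_coeff[of a j] that by (intro coeff_eq_0) simp
  moreover have "coeff Q k = (-1) ^ k * meval (\<lambda>_. 0) (mpderiv (Suc k) f)"
  proof -
    have "coeff Q k = (\<Sum>j\<le>k. if j = k then coeff (q (Suc k)) 0 * (-1) ^ k else 0)"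
      unfolding Q_def coeff_sum
      by (rule sum.cong) (auto simp: high coeff_quotient_coeff a0)
    then show ?thesis by (simp add: q(2))
  qed
  moreover have "coeff Q (k - 1) = (-1) ^ (k - 1) *
       (meval (\<lambda>_. 0) (mpderiv (Suc k) f) + meval (\<lambda>_. 0) (mpderiv 1 (mpderiv k f))) *
       (\<Sum>s\<in>I. of_nat (w s) * b s)" if kpos: "k > 0"
  proof -
    obtain m where m: "k = Suc m" using kpos by (cases k) auto
    have low: "(\<Sum>j<m. coeff (q (Suc j)) (Suc m - j) * coeff (quotient_coeff a j) m) = 0"
      by (rule sum.neutral) (simp add: high)
    have "coeff Q m = coeff (q (Suc m)) 1 * ((-1) ^ m * a 0) + coeff (q (Suc k)) 0 * ((-1) ^ m * a 1)"
      unfolding Q_def coeff_sum m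
      by (simp only: atMost_Suc lessThan_Suc_atMost[symmetric] lessThan_Suc)
        (simp add: low coeff_quotient_coeff coeff_quotient_coeff' del: quotient_coeff.simps)
    then show ?thesis unfolding q a0 a1[symmetric] m by (simp add: algebra_simps)
  qed
  ultimately show ?thesis by blast
qed

text \<open>The \<open>card I\<close> distinct roots \<open>b\<^sub>s\<close> exceed the degree unless \<open>k = card I\<close>. In that case comparing the
  second coefficient with \<open>- (\<Sum>s\<in>I. b\<^sub>s)\<close> gives a linear identity in \<open>b\<close>, valid for all injective
  \<open>b\<close>, in which every coefficient \<open>c - (c + \<gamma>) w\<^sub>s\<close> must vanish.\<close>

lemma linear_derivatives_vanish:
  fixes f :: "'a::field_char_0 mpoly"
  assumes I: "finite I" and w: "\<And>s. s \<in> I \<Longrightarrow> w s > 0"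
    and uneven: "s1 \<in> I" "s2 \<in> I" "w s1 \<noteq> w s2"
    and f: "f \<in> mpoly_ring {1..d}"
    and van: "\<And>b. meval (coeff (form_of I w (\<lambda>s. [:1, b s:]))) f = 0"
    and k: "k < d" "k \<le> card I"
  shows "meval (\<lambda>_. 0) (mpderiv (Suc k) f) = 0"
proof (rule ccontr)
  define c where "c = meval (\<lambda>_. 0) (mpderiv (Suc k) f)"
  define \<gamma> where "\<gamma> = meval (\<lambda>_. 0) (mpderiv 1 (mpderiv k f))"
  assume "meval (\<lambda>_. 0) (mpderiv (Suc k) f) \<noteq> 0"
  then have c: "c \<noteq> 0" by (simp add: c_def)
  have pos: "card I > 0" using I uneven by (auto simp: card_gt_0_iff)
  have key: "k = card I \<and> (\<Sum>s\<in>I. (c - (c + \<gamma>) * of_nat (w s)) * b s) = 0" if inj: "inj_on b I" for b :: "'b \<Rightarrow> 'a"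
  proof -
    obtain Q where Q: "degree Q \<le> k" "\<And>s. s \<in> I \<Longrightarrow> poly Q (b s) = 0"
      "coeff Q k = (-1) ^ k * c"
      "k > 0 \<Longrightarrow> coeff Q (k - 1) = (-1) ^ (k - 1) * (c + \<gamma>) * (\<Sum>s\<in>I. of_nat (w s) * b s)"
      using tangent_origin_polynomial[OF I w f van k(1), of b, folded c_def \<gamma>_def] by blast
    have Q0: "Q \<noteq> 0" using Q(3) c by auto
    have roots: "card (b ` I) = card I" using inj by (rule card_image)
    have "card I \<le> card {x. poly Q x = 0}"
      unfolding roots[symmetric] by (rule card_mono) (use Q(2) Q0 poly_roots_finite in auto)
    also have "\<dots> \<le> degree Q" by (rule card_poly_roots_bound[OF Q0])
    finally have kI: "k = card I" using Q(1) k(2) by simp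
    define P where "P = (\<Prod>s\<in>I. [:- b s, 1:])"
    have P: "degree P = k" "coeff P k = 1" "coeff (pCons 0 P) k = - (\<Sum>s\<in>I. b s)"
      unfolding P_def kI using coeff_linear_product[OF I, of b] by auto
    have "poly P (b s) = 0" if "s \<in> I" for s
      unfolding P_def poly_prod using that I by (auto intro!: prod_zero bexI[of _ s])
    define R where "R = Q - smult (coeff Q k) P"
    have "R = 0"
    proof (rule poly_eqI_degree[of "b ` I"])
      show "poly R x = poly 0 x" if "x \<in> b ` I" for x
        using that Q(2) \<open>\<And>s. s \<in> I \<Longrightarrow> poly P (b s) = 0\<close> by (auto simp: R_def)
      have "degree R \<le> k" unfolding R_def using Q(1) P(1) by (intro degree_diff_le) auto
      moreover have "coeff R k = 0" by (simp add: R_def P(2))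
      ultimately have "degree R < k" using pos kI
        by (metis (no_types) degree_0 eq_zero_or_degree_less)
      then show "degree R < card (b ` I)" "degree (0 :: 'a poly) < card (b ` I)"
        using pos roots kI by auto
    qed
    then have "Q = smult (coeff Q k) P" by (simp add: R_def)
    from arg_cong[OF this, of "\<lambda>p. coeff p (k - 1)"]
    have "coeff Q (k - 1) = coeff Q k * coeff P (k - 1)" by (simp only: coeff_smult)
    moreover obtain m where m: "k = Suc m" using pos unfolding kI[symmetric] by (cases k) auto
    ultimately have "(-1) ^ m * (c + \<gamma>) * (\<Sum>s\<in>I. of_nat (w s) * b s) = (-1) ^ m * (c * (\<Sum>s\<in>I. b s))"
      using Q(3,4) P(3) by simp
    then have "(c + \<gamma>) * (\<Sum>s\<in>I. of_nat (w s) * b s) = c * (\<Sum>s\<in>I. b s)"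
      by (simp add: mult.assoc)
    then show ?thesis using kI by (simp add: algebra_simps sum_distrib_left sum_subtractf sum.distrib)
  qed
  \<comment> \<open>Moving a single \<open>b s\<close> to a value that is not yet taken keeps \<open>b\<close> injective and isolates the
    coefficient at \<open>s\<close>.\<close>
  have "c = (c + \<gamma>) * of_nat (w s)" if s: "s \<in> I" for s
  proof -
    obtain h :: "'b \<Rightarrow> nat" where h: "inj_on h I"
      using finite_imp_inj_to_nat_seg[OF I] by blast
    define b :: "'b \<Rightarrow> 'a" where "b s = of_nat (h s)" for s
    define N where "N = Suc (Max (h ` I))"
    have N: "h r < N" if "r \<in> I" for r
      using that I by (auto simp: N_def less_Suc_eq_le)
    have inj: "inj_on b I" using h by (auto simp: b_def inj_on_def)
    have inj': "inj_on (b(s := of_nat N)) I"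
      using inj N unfolding inj_on_def by (auto simp: b_def dest: less_imp_neq)
    let ?\<kappa> = "\<lambda>s. c - (c + \<gamma>) * of_nat (w s)"
    have "0 = (\<Sum>r\<in>I. ?\<kappa> r * (b(s := of_nat N)) r) - (\<Sum>r\<in>I. ?\<kappa> r * b r)"
      using key[OF inj] key[OF inj'] by simp
    also have "\<dots> = (\<Sum>r\<in>I. if r = s then ?\<kappa> s * (of_nat N - b s) else 0)"
      unfolding sum_subtractf[symmetric] by (rule sum.cong) (auto simp: algebra_simps)
    also have "\<dots> = ?\<kappa> s * (of_nat N - b s)" using I s by simp
    finally have "?\<kappa> s = 0" using N[OF s] by (auto simp: b_def)
    then show ?thesis by simp
  qed
  from this[OF uneven(1)] this[OF uneven(2)] uneven(3) c show False
    by (metis mult_cancel_left mult_zero_left of_nat_eq_iff)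
qed


section \<open>A differential equation for powers of binary forms\<close>

text \<open>Up to the factor \<open>r^(m+1)\<close> this is \<open>F^(m+1-1/r)\<close> times the derivative of order \<open>m + 1\<close> of \<open>F^(1/r)\<close>:
  the recursion is the product rule after clearing the fractional power. It is polynomial in \<open>F\<close>
  and its derivatives, so its coefficients are polynomials in the coefficients of \<open>F\<close>.\<close>

primrec power_ode :: "nat \<Rightarrow> 'a::field poly \<Rightarrow> nat \<Rightarrow> 'a poly" where
  "power_ode r F 0 = pderiv F"
| "power_ode r F (Suc m) = of_nat r * (F * pderiv (power_ode r F m)) +
     (1 - of_nat (r * Suc m)) * (pderiv F * power_ode r F m)"

text \<open>The derivative of \<open>power_ode r F m\<close> with respect to \<open>F\<close> in direction \<open>V\<close>.\<close>

primrec power_ode_lin :: "nat \<Rightarrow> 'a::field poly \<Rightarrow> 'a poly \<Rightarrow> nat \<Rightarrow> 'a poly" where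
  "power_ode_lin r F V 0 = pderiv V"
| "power_ode_lin r F V (Suc m) =
     of_nat r * (V * pderiv (power_ode r F m) + F * pderiv (power_ode_lin r F V m)) +
     (1 - of_nat (r * Suc m)) * (pderiv V * power_ode r F m + pderiv F * power_ode_lin r F V m)"

lemma (in function_algebra) coeffwise_power_ode:
  assumes "coeffwise F F'"
  shows "coeffwise (\<lambda>p. power_ode r (F p) m) (\<lambda>p. power_ode_lin r (F p) (F' p) m)"
proof (induction m)
  case 0
  show ?case using coeffwise_pderiv[OF assms] by simp
next
  case (Suc m)
  note 1 = coeffwise_mult[OF coeffwise_const[of "of_nat r"] coeffwise_mult[OF assms coeffwise_pderiv[OF Suc.IH]]]
  note 2 = coeffwise_mult[OF coeffwise_const[of "1 - of_nat (r * Suc m)"]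
      coeffwise_mult[OF coeffwise_pderiv[OF assms] Suc.IH]]
  from coeffwise_add[OF 1 2] show ?case
    by (simp only: power_ode.simps power_ode_lin.simps mult_zero_left add_0_left)
qed

text \<open>Laurent series form a field with a derivation that contains the polynomials. There a direction
  \<open>V\<close> can be divided by \<open>r G^(r-1)\<close>, which gives the corresponding first-order change of the root \<open>G\<close>,
  even where \<open>G\<close> has zeros.\<close>

abbreviation poly_to_fls :: "'a::field_char_0 poly \<Rightarrow> 'a fls" where
  "poly_to_fls p \<equiv> fps_to_fls (fps_of_poly p)"

lemma poly_to_fls_mult: "poly_to_fls (p * q) = poly_to_fls p * poly_to_fls q"
  by (simp add: fps_of_poly_mult fls_times_fps_to_fls)

lemma poly_to_fls_add: "poly_to_fls (p + q) = poly_to_fls p + poly_to_fls q"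
  by (simp add: fps_of_poly_add)

lemma poly_to_fls_diff: "poly_to_fls (p - q) = poly_to_fls p - poly_to_fls q"
  by (simp add: fps_of_poly_diff)

lemma poly_to_fls_of_nat: "poly_to_fls (of_nat n) = of_nat n"
  by (induction n) (simp_all add: fps_of_poly_add)

lemma poly_to_fls_power: "poly_to_fls (p ^ n) = poly_to_fls p ^ n"
  by (simp add: fps_of_poly_power fps_to_fls_power)

lemma poly_to_fls_pderiv: "poly_to_fls (pderiv p) = fls_deriv (poly_to_fls p)"
  by (simp add: fps_of_poly_pderiv fls_deriv_fps_to_fls)

lemma poly_to_fls_eq_iff: "poly_to_fls p = poly_to_fls q \<longleftrightarrow> p = q"
  by (simp add: fps_of_poly_eq_iff)

lemmas poly_to_fls_hom = poly_to_fls_mult poly_to_fls_add poly_to_fls_diff poly_to_fls_of_nat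
  poly_to_fls_power poly_to_fls_pderiv

context
  fixes r :: nat and g w :: "'a::field_char_0 fls" and G V :: "'a poly"
  assumes r: "r \<ge> 1" and G: "G \<noteq> 0"
    and g_def: "g = poly_to_fls G"
    and w: "poly_to_fls V = of_nat r * g ^ (r - 1) * w"
begin

lemma g_nonzero: "g \<noteq> 0"
  using G by (simp add: g_def fps_of_poly_eq_iff[of _ 0, simplified])

lemma deriv_power: "g * fls_deriv (g ^ n) = of_nat n * g ^ n * fls_deriv g"
proof (induction n)
  case (Suc n)
  have "g * fls_deriv (g ^ Suc n) = g * (g ^ n * fls_deriv g) + g * (g * fls_deriv (g ^ n))"
    by (simp add: algebra_simps)
  then show ?case unfolding Suc.IH by (simp add: algebra_simps)
qed simp

text \<open>With \<open>F = G^r\<close> the \<open>r\<close>-th root is \<open>G\<close> itself. The extra factor \<open>g\<close> avoids the exponent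
  \<open>r (m + 1) - 1\<close>.\<close>

lemma power_ode_power:
  "g * poly_to_fls (power_ode r (G ^ r) m) =
     of_nat r ^ Suc m * g ^ (r * Suc m) * (fls_deriv ^^ Suc m) g"
proof (induction m)
  case 0
  show ?case using deriv_power[of r] by (simp add: poly_to_fls_pderiv poly_to_fls_power g_def[symmetric])
next
  case (Suc m)
  define P where "P = poly_to_fls (power_ode r (G ^ r) m)"
  define h where "h = (fls_deriv ^^ Suc m) g"
  define c where "c = (of_nat r :: 'a fls) ^ Suc m"
  define N where "N = r * Suc m"
  define S where "S = g ^ N"
  define R where "R = g ^ r"
  have IH: "g * P = c * S * h"
    using Suc by (simp only: P_def h_def c_def S_def N_def)
  have c': "fls_deriv c = 0" unfolding c_def by (simp add: fls_deriv_power)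
  have S': "g * fls_deriv S = of_nat N * S * fls_deriv g" unfolding S_def by (rule deriv_power)
  have R': "g * fls_deriv R = of_nat r * R * fls_deriv g" unfolding R_def by (rule deriv_power)
  have "fls_deriv (g * P) = fls_deriv (c * S * h)" using IH by simp
  then have "fls_deriv g * P + g * fls_deriv P = c * (fls_deriv S * h + S * fls_deriv h)"
    using c' by (simp add: algebra_simps)
  then have E1: "g * (fls_deriv g * P + g * fls_deriv P) = c * ((g * fls_deriv S) * h + g * S * fls_deriv h)"
    by (simp add: algebra_simps)
  have E2: "g * (g * fls_deriv P) =
      g * (fls_deriv g * P + g * fls_deriv P) - fls_deriv g * (g * P)"
    by (simp add: algebra_simps)
  have P': "g * (g * fls_deriv P) =
      c * ((of_nat N - 1) * S * fls_deriv g * h + g * S * fls_deriv h)"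
    unfolding E2 E1 S' IH by (simp add: algebra_simps)
  have "g * (g * poly_to_fls (power_ode r (G ^ r) (Suc m))) =
      of_nat r * (R * (g * (g * fls_deriv P))) + (1 - of_nat N) * ((g * fls_deriv R) * (g * P))"
    by (simp add: poly_to_fls_hom g_def[symmetric] P_def R_def N_def algebra_simps)
  also have "\<dots> = g * (c * of_nat r * (S * R) * fls_deriv h)"
    unfolding P' R' IH by (simp add: algebra_simps)
  finally have "g * poly_to_fls (power_ode r (G ^ r) (Suc m)) = c * of_nat r * (S * R) * fls_deriv h"
    using g_nonzero by (simp add: mult_left_cancel)
  moreover have "S * R = g ^ (r * Suc (Suc m))"
    unfolding S_def R_def N_def by (simp add: algebra_simps flip: power_add)
  moreover have "c * of_nat r = of_nat r ^ Suc (Suc m)" unfolding c_def by simp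
  moreover have "fls_deriv h = (fls_deriv ^^ Suc (Suc m)) g" unfolding h_def by simp
  ultimately show ?case by (simp only:)
qed

text \<open>The previous formula, differentiated formally when \<open>G\<close> moves in direction \<open>w\<close>. It is proved by the
  recursion because \<open>w\<close> need not be a polynomial.\<close>

lemma power_ode_lin_power:
  "g * (g * poly_to_fls (power_ode_lin r (G ^ r) V m)) =
     of_nat r ^ Suc m * g ^ (r * Suc m) *
       ((of_nat (r * Suc m) - 1) * w * (fls_deriv ^^ Suc m) g + g * (fls_deriv ^^ Suc m) w)"
proof -
  define R where "R = g ^ r"
  define v where "v = poly_to_fls V"
  have "R = g * g ^ (r - 1)" unfolding R_def using r by (simp add: power_eq_if)
  then have gv: "g * v = of_nat r * R * w" unfolding v_def w by (simp add: mult_ac)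
  have R': "g * fls_deriv R = of_nat r * R * fls_deriv g" unfolding R_def by (rule deriv_power)
  have "fls_deriv (g * v) = fls_deriv (of_nat r * R * w)" by (simp only: gv)
  then have "fls_deriv g * v + g * fls_deriv v = of_nat r * (fls_deriv R * w + R * fls_deriv w)"
    by (simp add: algebra_simps)
  then have E1: "g * (fls_deriv g * v + g * fls_deriv v) = of_nat r * ((g * fls_deriv R) * w + g * R * fls_deriv w)"
    by (simp add: algebra_simps)
  have E2: "g * (g * fls_deriv v) =
      g * (fls_deriv g * v + g * fls_deriv v) - fls_deriv g * (g * v)"
    by (simp add: algebra_simps)
  have gv': "g * (g * fls_deriv v) =
      of_nat r * R * ((of_nat r - 1) * fls_deriv g * w + g * fls_deriv w)"
    unfolding E2 E1 R' gv by (simp add: algebra_simps)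
  show ?thesis
  proof (induction m)
    case 0
    show ?case using gv' by (simp add: poly_to_fls_pderiv v_def R_def mult_ac)
  next
    case (Suc m)
    define P where "P = poly_to_fls (power_ode r (G ^ r) m)"
    define D where "D = poly_to_fls (power_ode_lin r (G ^ r) V m)"
    define h where "h = (fls_deriv ^^ Suc m) g"
    define x where "x = (fls_deriv ^^ Suc m) w"
    define c where "c = (of_nat r :: 'a fls) ^ Suc m"
    define N where "N = r * Suc m"
    define n where "n = (of_nat N :: 'a fls)"
    define S where "S = g ^ N"
    have gP: "g * P = c * S * h"
      using power_ode_power[of m] by (simp only: P_def h_def c_def S_def N_def)
    have gD: "g * (g * D) = c * S * ((n - 1) * w * h + g * x)"
      using Suc by (simp only: D_def h_def x_def c_def S_def N_def n_def)
    have c': "fls_deriv c = 0" unfolding c_def by (simp add: fls_deriv_power)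
    have n': "fls_deriv n = 0" unfolding n_def by simp
    have S': "g * fls_deriv S = n * S * fls_deriv g" unfolding S_def n_def by (rule deriv_power)
    have "fls_deriv (g * P) = fls_deriv (c * S * h)" using gP by simp
    then have "fls_deriv g * P + g * fls_deriv P = c * (fls_deriv S * h + S * fls_deriv h)"
      using c' by (simp add: algebra_simps)
    then have E1: "g * (fls_deriv g * P + g * fls_deriv P) = c * ((g * fls_deriv S) * h + g * S * fls_deriv h)"
      by (simp add: algebra_simps)
    have E2: "g * (g * fls_deriv P) =
        g * (fls_deriv g * P + g * fls_deriv P) - fls_deriv g * (g * P)"
      by (simp add: algebra_simps)
    have P': "g * (g * fls_deriv P) = c * S * ((n - 1) * fls_deriv g * h + g * fls_deriv h)"
      unfolding E2 E1 S' gP by (simp add: algebra_simps)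
    have "fls_deriv (g * (g * D)) = fls_deriv (c * S * ((n - 1) * w * h + g * x))" using gD by simp
    then have E0: "2 * fls_deriv g * (g * D) + g * (g * fls_deriv D) =
        c * (fls_deriv S * ((n - 1) * w * h + g * x) +
          S * ((n - 1) * (fls_deriv w * h + w * fls_deriv h) + fls_deriv g * x + g * fls_deriv x))"
      using c' n' by (simp add: algebra_simps)
    have E1: "g * (2 * fls_deriv g * (g * D) + g * (g * fls_deriv D)) =
        c * ((g * fls_deriv S) * ((n - 1) * w * h + g * x) +
          g * S * ((n - 1) * (fls_deriv w * h + w * fls_deriv h) + fls_deriv g * x + g * fls_deriv x))"
      unfolding E0 by (simp add: algebra_simps)
    have E2: "g * (g * (g * fls_deriv D)) =
        g * (2 * fls_deriv g * (g * D) + g * (g * fls_deriv D)) - 2 * fls_deriv g * (g * (g * D))"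
      by (simp add: algebra_simps)
    have D': "g * (g * (g * fls_deriv D)) =
        c * S * (n * fls_deriv g * ((n - 1) * w * h + g * x) +
          g * ((n - 1) * (fls_deriv w * h + w * fls_deriv h) + fls_deriv g * x + g * fls_deriv x)
          - 2 * fls_deriv g * ((n - 1) * w * h + g * x))"
      unfolding E2 E1 S' gD by (simp add: algebra_simps)
    have "g * (g * (g * poly_to_fls (power_ode_lin r (G ^ r) V (Suc m)))) =
        of_nat r * ((g * v) * (g * (g * fls_deriv P)) + R * (g * (g * (g * fls_deriv D)))) +
        (1 - n) * ((g * (g * fls_deriv v)) * (g * P) + (g * fls_deriv R) * (g * (g * D)))"
      by (simp add: poly_to_fls_hom g_def[symmetric] P_def D_def R_def N_def n_def v_def algebra_simps)
    also have "\<dots> = g * (c * of_nat r * (S * R) * ((n + of_nat r - 1) * w * fls_deriv h + g * fls_deriv x))"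
      unfolding gv P' D' gv' gP R' gD by (simp add: algebra_simps)
    finally have "g * (g * poly_to_fls (power_ode_lin r (G ^ r) V (Suc m))) =
        c * of_nat r * (S * R) * ((n + of_nat r - 1) * w * fls_deriv h + g * fls_deriv x)"
      using g_nonzero by (simp add: mult_left_cancel)
    moreover have "S * R = g ^ (r * Suc (Suc m))"
      unfolding S_def R_def N_def by (simp add: algebra_simps flip: power_add)
    moreover have "c * of_nat r = of_nat r ^ Suc (Suc m)" unfolding c_def by simp
    moreover have "fls_deriv h = (fls_deriv ^^ Suc (Suc m)) g" unfolding h_def by simp
    moreover have "fls_deriv x = (fls_deriv ^^ Suc (Suc m)) w" unfolding x_def by simp
    moreover have "n + of_nat r = of_nat (r * Suc (Suc m))" unfolding n_def N_def by simp
    ultimately show ?case by (simp only:)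
  qed
qed

end

unbundle fps_syntax

lemma fls_funpow_deriv_nth:
  "(fls_deriv ^^ n) w $$ k = (\<Prod>i=1..n. of_int (k + int i)) * (w :: 'a::field_char_0 fls) $$ (k + int n)"
proof (induction n arbitrary: k)
  case (Suc n)
  have "(\<Prod>i=1..Suc n. of_int (k + int i) :: 'a) = of_int (k + 1) * (\<Prod>i=1..n. of_int ((k + 1) + int i))"
    by (subst prod.atLeast_Suc_atMost) (simp_all add: prod.shift_bounds_cl_Suc_ivl algebra_simps del: prod.cl_ivl_Suc)
  then show ?case using Suc[of "k + 1"] by (simp add: algebra_simps del: prod.cl_ivl_Suc)
qed simp

text \<open>In characteristic zero a Laurent series with vanishing derivative of order \<open>e + 1\<close> has no negative
  powers and degree at most \<open>e\<close>.\<close>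

lemma fls_funpow_deriv_zero:
  assumes "(fls_deriv ^^ Suc e) (w :: 'a::field_char_0 fls) = 0"
  obtains H where "w = poly_to_fls H" "degree H \<le> e"
proof -
  have nz: "w $$ k = 0" if "k < 0 \<or> k > int e" for k
  proof -
    have "(fls_deriv ^^ Suc e) w $$ (k - int (Suc e)) = 0" by (simp only: assms fls_zero_nth)
    then have "(\<Prod>i=1..Suc e. of_int (k - int (Suc e) + int i) :: 'a) * w $$ k = 0"
      unfolding fls_funpow_deriv_nth by simp
    moreover have "k - int (Suc e) + int i \<noteq> 0" if "i \<in> {1..Suc e}" for i
      using that \<open>k < 0 \<or> k > int e\<close> by auto
    then have "(\<Prod>i=1..Suc e. of_int (k - int (Suc e) + int i) :: 'a) \<noteq> 0"
      by (subst prod_zero_iff) (auto simp del: of_int_add of_int_diff)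
    ultimately show ?thesis by simp
  qed
  define H where "H = (\<Sum>j\<le>e. monom (w $$ int j) j)"
  have H: "coeff H j = (if j \<le> e then w $$ int j else 0)" for j
    by (simp add: H_def coeff_sum)
  have "w = poly_to_fls H"
    by (rule fls_eqI) (auto simp: H nz)
  moreover have "degree H \<le> e" by (rule degree_le) (simp add: H)
  ultimately show ?thesis using that by blast
qed

lemma funpow_deriv_poly_to_fls:
  assumes "degree G \<le> e"
  shows "(fls_deriv ^^ Suc e) (poly_to_fls G) = 0"
proof (rule fls_eqI)
  fix k
  show "(fls_deriv ^^ Suc e) (poly_to_fls G) $$ k = 0 $$ k"
  proof (cases "k + int (Suc e) < 0 \<or> k + int (Suc e) > int e")
    case True
    then have "poly_to_fls G $$ (k + int (Suc e)) = 0"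
      using assms by (auto simp: intro: coeff_eq_0)
    then show ?thesis unfolding fls_funpow_deriv_nth by simp
  next
    case False
    then have "nat (- k) \<in> {1..Suc e}" "of_int (k + int (nat (- k))) = (0 :: 'a)" by auto
    then have "(\<Prod>i=1..Suc e. of_int (k + int i) :: 'a) = 0" by (intro prod_zero) blast+
    then show ?thesis unfolding fls_funpow_deriv_nth by simp
  qed
qed

lemma power_ode_vanishes:
  assumes "r \<ge> 1" "G \<noteq> 0" "degree (G :: 'a::field_char_0 poly) \<le> e"
  shows "power_ode r (G ^ r) e = 0"
proof -
  have "poly_to_fls G * poly_to_fls (power_ode r (G ^ r) e) = 0"
    using power_ode_power[OF assms(1,2) refl, where V = 0 and w = 0 and m = e] funpow_deriv_poly_to_fls[OF assms(3)]
    by (simp del: funpow.simps power_ode.simps)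
  moreover have "poly_to_fls G \<noteq> 0"
    using assms(2) fps_of_poly_eq_iff[of G 0] by simp
  ultimately have "poly_to_fls (power_ode r (G ^ r) e) = poly_to_fls 0" by simp
  then show ?thesis by (simp only: poly_to_fls_eq_iff)
qed

text \<open>At \<open>F = G^r\<close> the derivative of \<open>G\<close> of order \<open>e + 1\<close> is zero, so the linearized equation only says
  that the same derivative of \<open>w = V / (r G^(r-1))\<close> vanishes.\<close>

lemma power_ode_lin_kernel:
  assumes "r \<ge> 1" "G \<noteq> 0" "degree (G :: 'a::field_char_0 poly) \<le> e"
    and "power_ode_lin r (G ^ r) V e = 0"
  obtains H where "V = G ^ (r - 1) * H" "degree H \<le> e"
proof -
  define g where "g = poly_to_fls G"
  have g: "g \<noteq> 0" using assms(2) fps_of_poly_eq_iff[of G 0] by (simp add: g_def)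
  have r: "(of_nat r :: 'a fls) \<noteq> 0" using assms(1) by simp
  define w where "w = poly_to_fls V / (of_nat r * g ^ (r - 1))"
  have w: "poly_to_fls V = of_nat r * g ^ (r - 1) * w"
    using g r by (simp add: w_def)
  have "g * (g * 0) = of_nat r ^ Suc e * g ^ (r * Suc e) * (g * (fls_deriv ^^ Suc e) w)"
    using power_ode_lin_power[OF assms(1,2) g_def w, of e] funpow_deriv_poly_to_fls[OF assms(3)]
    unfolding assms(4) g_def[symmetric] by (simp del: funpow.simps)
  then have "(fls_deriv ^^ Suc e) w = 0"
    using g r by (simp del: funpow.simps power_Suc)
  then obtain H where H: "w = poly_to_fls H" "degree H \<le> e"
    by (rule fls_funpow_deriv_zero)
  have "poly_to_fls V = poly_to_fls (of_nat r * G ^ (r - 1) * H)"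
    by (simp add: w H(1) g_def poly_to_fls_hom)
  then have "V = G ^ (r - 1) * smult (of_nat r) H"
    by (simp only: poly_to_fls_eq_iff) (simp add: of_nat_poly)
  moreover have "degree (smult (of_nat r) H) \<le> e" using H(2) degree_smult_le le_trans by blast
  ultimately show ?thesis using that by blast
qed


section \<open>Dimension of spaces of coefficient vectors\<close>

interpretation fun_space: vector_space "fscale :: 'a::field \<Rightarrow> (nat \<Rightarrow> 'a) \<Rightarrow> nat \<Rightarrow> 'a"
  by (rule vector_space_fscale)

lemma sum_fscale_apply: "(\<Sum>s\<in>S. fscale (c s) (b s)) j = (\<Sum>s\<in>S. c s * b s j)"
  by (induction S rule: infinite_finite_induct) (simp_all add: fscale_def)

lemma family_independent:
  fixes b :: "'s \<Rightarrow> nat \<Rightarrow> 'a::field"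
  assumes "finite S"
    and zero: "\<And>c. (\<forall>j. (\<Sum>s\<in>S. c s * b s j) = 0) \<Longrightarrow> (\<forall>s\<in>S. c s = 0)"
  shows "fun_space.independent (b ` S)" and "card (b ` S) = card S"
proof -
  have inj: "inj_on b S"
  proof (rule inj_onI, rule ccontr)
    fix s t assume st: "s \<in> S" "t \<in> S" "b s = b t" "s \<noteq> t"
    have "(\<Sum>x\<in>S. (if x = s then 1 else if x = t then -1 else 0) * b x j) = 0" for j
    proof -
      have "(\<Sum>x\<in>S. (if x = s then 1 else if x = t then -1 else 0) * b x j) =
          (\<Sum>x\<in>S. (if x = s then b s j else 0) + (if x = t then - b t j else 0))"
        by (rule sum.cong) (use st in auto)
      then show ?thesis using st assms(1) by (simp add: sum.distrib)
    qed
    with zero[of "\<lambda>x. if x = s then 1 else if x = t then -1 else 0"] st(1) show False by auto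
  qed
  show "card (b ` S) = card S" by (rule card_image[OF inj])
  show "fun_space.independent (b ` S)"
  proof (rule fun_space.independent_if_scalars_zero)
    show "finite (b ` S)" using assms(1) by simp
  next
    fix f x assume sum: "(\<Sum>x\<in>b ` S. fscale (f x) x) = 0" and x: "x \<in> b ` S"
    have "(\<Sum>s\<in>S. f (b s) * b s j) = 0" for j
      using fun_cong[OF sum, of j] unfolding sum.reindex[OF inj] o_def sum_fscale_apply by simp
    with zero[of "\<lambda>s. f (b s)"] x show "f x = 0" by auto
  qed
qed

lemma family_span:
  fixes b :: "'s \<Rightarrow> nat \<Rightarrow> 'a::field"
  assumes "\<And>j. v j = (\<Sum>s\<in>S. c s * b s j)"
  shows "v \<in> fun_space.span (b ` S)"
proof -
  have "v = (\<Sum>s\<in>S. fscale (c s) (b s))"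
    by (rule ext) (simp add: assms sum_fscale_apply)
  then show ?thesis
    by (simp add: fun_space.span_sum fun_space.span_scale fun_space.span_base)
qed

lemma card_le_dim:
  fixes T :: "(nat \<Rightarrow> 'a::field) set"
  assumes "finite J" "T \<subseteq> aff_space J" "B \<subseteq> T" "fun_space.independent B"
  shows "card B \<le> fun_space.dim T"
proof -
  obtain B' where B': "B \<subseteq> B'" "B' \<subseteq> T" "fun_space.independent B'" "T \<subseteq> fun_space.span B'"
    using fun_space.maximal_independent_subset_extend[OF assms(3,4)] by blast
  define u :: "nat \<Rightarrow> nat \<Rightarrow> 'a" where "u k j = (if j = k then 1 else 0)" for k j
  have "aff_space J \<subseteq> fun_space.span (u ` J)"
  proof
    fix v :: "nat \<Rightarrow> 'a" assume v: "v \<in> aff_space J"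
    show "v \<in> fun_space.span (u ` J)"
    proof (rule family_span[where c = v])
      fix j
      have "(\<Sum>s\<in>J. v s * u s j) = (\<Sum>s\<in>J. if s = j then v j else 0)"
        by (rule sum.cong) (auto simp: u_def)
      then show "v j = (\<Sum>s\<in>J. v s * u s j)" using v assms(1) by (auto simp: aff_space_def)
    qed
  qed
  then have "finite B'"
    using fun_space.independent_span_bound[of "u ` J" B'] B'(2,3) assms(1,2) by blast
  moreover have "card B' = fun_space.dim T"
    by (rule fun_space.basis_card_eq_dim[OF B'(2,4,3)])
  ultimately show ?thesis using card_mono[OF _ B'(1)] by simp
qed

lemma poly_as_sum_monom:
  assumes "degree H \<le> e"
  shows "H = (\<Sum>j\<le>e. monom (coeff H j) j)"
  by (rule poly_eqI) (use assms in \<open>auto simp: coeff_sum intro: coeff_eq_0\<close>)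

text \<open>Multiplication by \<open>M\<close> embeds the space of polynomials of degree at most \<open>e\<close>, of dimension \<open>e + 1\<close>,
  and the condition cuts out a hyperplane because \<open>M G\<close> violates it. Adding \<open>M G\<close> to a basis of the
  hyperplane gives a basis of the whole space.\<close>

lemma dim_multiples_hyperplane:
  fixes M G :: "'a::field poly"
  assumes M: "M \<noteq> 0" and G: "degree G \<le> e" "coeff (M * G) i \<noteq> 0"
  shows "fun_space.dim {coeff (M * H) | H. degree H \<le> e \<and> coeff (M * H) i = 0} = e"
proof -
  define S where "S = {coeff (M * H) | H. degree H \<le> e}"
  define W where "W = {coeff (M * H) | H. degree H \<le> e \<and> coeff (M * H) i = 0}"
  define b where "b j = coeff (M * monom 1 j)" for j
  have comb: "(\<Sum>j\<le>e. c j * b j l) = coeff (M * (\<Sum>j\<le>e. monom (c j) j)) l" for c l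
  proof -
    have "M * monom (c j) j = smult (c j) (M * monom 1 j)" for j
      by (simp flip: mult_smult_right add: smult_monom)
    then show ?thesis by (simp add: sum_distrib_left coeff_sum b_def)
  qed
  have indep: "fun_space.independent (b ` {..e})" and card: "card (b ` {..e}) = card {..e}"
  proof -
    have "\<forall>s\<in>{..e}. c s = 0" if "\<forall>j. (\<Sum>s\<in>{..e}. c s * b s j) = 0" for c
    proof -
      have "M * (\<Sum>j\<le>e. monom (c j) j) = 0" by (rule poly_eqI) (use that comb in simp)
      then have "(\<Sum>j\<le>e. monom (c j) j) = 0" using M by simp
      then have "coeff (\<Sum>j\<le>e. monom (c j) j) s = 0" for s by simp
      then have "(if s \<le> e then c s else 0) = 0" for s by (simp add: coeff_sum)
      then show ?thesis by (metis atMost_iff)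
    qed
    then show "fun_space.independent (b ` {..e})" "card (b ` {..e}) = card {..e}"
      using family_independent[of "{..e}" b] by blast+
  qed
  have span: "S \<subseteq> fun_space.span (b ` {..e})"
  proof
    fix v assume "v \<in> S"
    then obtain H where H: "v = coeff (M * H)" "degree H \<le> e" by (auto simp: S_def)
    show "v \<in> fun_space.span (b ` {..e})"
      by (rule family_span[where c = "coeff H"]) (simp add: comb H(1) poly_as_sum_monom[OF H(2), symmetric])
  qed
  have "b ` {..e} \<subseteq> S"
    by (auto simp: S_def b_def intro!: exI[of _ "monom 1 _"] order_trans[OF degree_monom_le])
  from fun_space.basis_card_eq_dim[OF this span indep] card have dimS: "fun_space.dim S = Suc e" by simp
  obtain B where B: "B \<subseteq> W" "fun_space.independent B" "W \<subseteq> fun_space.span B" "card B = fun_space.dim W"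
    using fun_space.basis_exists by blast
  have WS: "W \<subseteq> S" by (auto simp: W_def S_def)
  have finB: "finite B"
    using fun_space.independent_span_bound[of "b ` {..e}" B] B(1,2) WS span by blast
  define p where "p = coeff (M * G)"
  have pS: "p \<in> S" using G by (auto simp: p_def S_def)
  have "fun_space.subspace {v :: nat \<Rightarrow> 'a. v i = 0}"
    by (rule fun_space.subspaceI) (simp_all add: fscale_def)
  then have "fun_space.span B \<subseteq> {v. v i = 0}"
    using B(1) by (intro fun_space.span_minimal) (auto simp: W_def)
  then have notin: "p \<notin> fun_space.span B" using G by (auto simp: p_def)
  then have "p \<notin> B" using fun_space.span_base by blast
  have "S \<subseteq> fun_space.span (insert p B)"
  proof
    fix v assume "v \<in> S"
    then obtain H where H: "v = coeff (M * H)" "degree H \<le> e" by (auto simp: S_def)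
    define c where "c = v i / p i"
    have "v - fscale c p = coeff (M * (H - smult c G))"
      by (rule ext) (simp add: H p_def fscale_def algebra_simps)
    moreover have "degree (H - smult c G) \<le> e"
      using H G by (intro degree_diff_le) (auto intro: order_trans[OF degree_smult_le])
    moreover have "(v - fscale c p) i = 0" using G by (simp add: c_def fscale_def p_def)
    ultimately have "v - fscale c p \<in> W" unfolding W_def by auto
    then show "v \<in> fun_space.span (insert p B)"
      using B(3) unfolding fun_space.span_insert by blast
  qed
  moreover have "insert p B \<subseteq> S" using pS B(1) WS by blast
  moreover have "fun_space.independent (insert p B)"
    by (rule fun_space.independent_insertI[OF notin B(2)])
  ultimately have "card (insert p B) = fun_space.dim S"
    by (intro fun_space.basis_card_eq_dim)
  then show ?thesis using finB \<open>p \<notin> B\<close> B(4) dimS by (simp add: W_def)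
qed


section \<open>The locus of perfect powers\<close>

lemma proj_point_scale:
  fixes a :: "nat \<Rightarrow> 'a::field"
  assumes "c \<noteq> 0"
  shows "proj_point (fscale c a) = proj_point a"
proof (intro equalityI subsetI)
  fix x assume "x \<in> proj_point (fscale c a)"
  then obtain b where "b \<noteq> 0" "x = fscale (b * c) a"
    by (auto simp: proj_point_def fscale_def mult.assoc)
  then show "x \<in> proj_point a" using assms unfolding proj_point_def by (auto intro!: exI[of _ "b * c"])
next
  fix x assume "x \<in> proj_point a"
  then obtain b where "b \<noteq> 0" "x = fscale b a" by (auto simp: proj_point_def)
  then have "b / c \<noteq> 0" "x = fscale (b / c) (fscale c a)" using assms by (auto simp: fscale_def)
  then show "x \<in> proj_point (fscale c a)" unfolding proj_point_def by blast
qed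

lemma proj_point_eqD:
  fixes a :: "nat \<Rightarrow> 'a::field"
  assumes "proj_point a = proj_point b"
  shows "\<exists>c. c \<noteq> 0 \<and> a = fscale c b"
proof -
  have "a = fscale 1 a" by (simp add: fscale_def)
  then have "a \<in> proj_point a" unfolding proj_point_def by (metis (mono_tags, lifting) mem_Collect_eq one_neq_zero)
  then show ?thesis unfolding assms by (auto simp: proj_point_def)
qed

text \<open>Polynomials with positive integer coefficients up to degree \<open>n\<close>; none of these coefficients is
  zero in characteristic zero, so for \<open>n = d\<close> their classes lie in every chart.\<close>

definition pos_coeffs :: "nat \<Rightarrow> 'a::field_char_0 poly \<Rightarrow> bool" where
  "pos_coeffs n p \<longleftrightarrow> (\<exists>m. (\<forall>i. coeff p i = of_nat (m i)) \<and> (\<forall>i\<le>n. m i > 0))"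

lemma pos_coeffs_mult:
  assumes "pos_coeffs n p" "pos_coeffs k q"
  shows "pos_coeffs (n + k) (p * q)"
proof -
  obtain a b where a: "\<And>i. coeff p i = of_nat (a i)" "\<And>i. i \<le> n \<Longrightarrow> a i > 0"
    and b: "\<And>i. coeff q i = of_nat (b i)" "\<And>i. i \<le> k \<Longrightarrow> b i > 0"
    using assms by (auto simp: pos_coeffs_def)
  have "coeff (p * q) i = of_nat (\<Sum>j\<le>i. a j * b (i - j))" for i
    by (simp add: coeff_mult a b)
  moreover have "(\<Sum>j\<le>i. a j * b (i - j)) > 0" if "i \<le> n + k" for i
    by (rule sum_pos2[of _ "min i n"]) (use that a b in auto)
  ultimately show ?thesis
    unfolding pos_coeffs_def by (intro exI[of _ "\<lambda>i. \<Sum>j\<le>i. a j * b (i - j)"]) blast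
qed

lemma pos_coeffs_one: "pos_coeffs 0 1"
  unfolding pos_coeffs_def by (rule exI[of _ "\<lambda>i. if i = 0 then 1 else 0"]) (auto simp: coeff_1)

lemma pos_coeffs_linear: "k > 0 \<Longrightarrow> pos_coeffs 1 [:of_nat k, 1:]"
  unfolding pos_coeffs_def
  by (rule exI[of _ "\<lambda>i. if i = 0 then k else if i = 1 then 1 else 0"])
    (auto simp: coeff_pCons split: nat.splits)

lemma pos_coeffs_power: "pos_coeffs n p \<Longrightarrow> pos_coeffs (r * n) (p ^ r)"
  by (induction r) (auto simp: pos_coeffs_one dest: pos_coeffs_mult)

lemma pos_coeffs_prod:
  "finite S \<Longrightarrow> (\<And>s. s \<in> S \<Longrightarrow> pos_coeffs 1 (p s)) \<Longrightarrow> pos_coeffs (card S) (\<Prod>s\<in>S. p s)"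
proof (induction S rule: finite_induct)
  case (insert s S)
  then have "pos_coeffs (1 + card S) (p s * (\<Prod>s\<in>S. p s))" by (intro pos_coeffs_mult) auto
  then show ?case using insert by simp
qed (simp add: pos_coeffs_one)

lemma pos_coeffs_nonzero: "pos_coeffs n p \<Longrightarrow> i \<le> n \<Longrightarrow> coeff p i \<noteq> 0"
  unfolding pos_coeffs_def by fastforce

text \<open>The locus of \<open>r\<close>-th powers of forms of degree \<open>e\<close>, in the chart of the \<open>i\<close>-th coordinate.\<close>

locale power_locus =
  fixes r e d i :: nat and X :: "(nat \<Rightarrow> 'a::{alg_closed_field, field_char_0}) set set"
  assumes r: "r \<ge> 1" and d: "d = r * e" and i: "i \<le> d"
    and X: "X = {proj_point (coeff (G ^ r)) | G. G \<noteq> 0 \<and> degree G \<le> e}"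
begin

definition J where "J = {..d} - {i}"
definition Z where "Z = proj_chart d i X"
definition chart_point :: "'a poly \<Rightarrow> nat \<Rightarrow> 'a" where
  "chart_point F = (\<lambda>j. if j \<in> J then coeff F j / coeff F i else 0)"

lemma finite_J: "finite J"
  by (simp add: J_def)

lemma Z_aff: "Z \<subseteq> aff_space J"
  by (auto simp: Z_def J_def proj_chart_def)

lemma degree_power: "degree G \<le> e \<Longrightarrow> degree (G ^ r) \<le> d"
proof -
  assume "degree G \<le> e"
  then have "degree G * r \<le> e * r" by (rule mult_le_mono1)
  from le_trans[OF degree_power_le this] show "degree (G ^ r) \<le> d"
    unfolding d by (subst mult.commute)
qed

lemma chart_point_in_Z:
  assumes "degree G \<le> e" "coeff (G ^ r) i \<noteq> 0"
  shows "chart_point (G ^ r) \<in> Z"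
proof -
  have G: "G \<noteq> 0" using assms(2) r by (auto simp: power_0_left)
  have "(chart_point (G ^ r))(i := 1) = fscale (1 / coeff (G ^ r) i) (coeff (G ^ r))"
  proof
    fix j
    show "((chart_point (G ^ r))(i := 1)) j = fscale (1 / coeff (G ^ r) i) (coeff (G ^ r)) j"
      using assms(2) degree_power[OF assms(1)]
      by (cases "j \<le> d") (auto simp: chart_point_def J_def fscale_def coeff_eq_0)
  qed
  then have "proj_point ((chart_point (G ^ r))(i := 1)) \<in> X"
    using assms G proj_point_scale[of "1 / coeff (G ^ r) i" "coeff (G ^ r)"] unfolding X by auto
  moreover have "chart_point (G ^ r) \<in> aff_space ({..d} - {i})"
    by (simp add: aff_space_def chart_point_def J_def)
  ultimately show ?thesis by (simp add: Z_def proj_chart_def)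
qed

text \<open>The scalar that normalises the \<open>i\<close>-th coefficient has an \<open>r\<close>-th root, which can be absorbed into
  \<open>G\<close>.\<close>

lemma Z_elim:
  assumes "z \<in> Z"
  obtains G where "degree G \<le> e" "G \<noteq> 0" "z(i := 1) = coeff (G ^ r)" "z = chart_point (G ^ r)" "coeff (G ^ r) i = 1"
proof -
  obtain G where G: "G \<noteq> 0" "degree G \<le> e" "proj_point (z(i := 1)) = proj_point (coeff (G ^ r))"
  proof -
    have "proj_point (z(i := 1)) \<in> X" using assms by (simp add: Z_def proj_chart_def)
    then show ?thesis using that unfolding X by blast
  qed
  obtain c where c: "c \<noteq> 0" "z(i := 1) = fscale c (coeff (G ^ r))"
    using proj_point_eqD[OF G(3)] by blast
  obtain b where b: "b ^ r = c" using nth_root_exists[of r c] r by auto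
  have eq: "z(i := 1) = coeff (smult b G ^ r)"
    using c(2) by (simp add: fun_eq_iff fscale_def smult_power b)
  have "b \<noteq> 0" using b c r by (auto simp: power_0_left)
  moreover have "coeff (smult b G ^ r) i = 1" using fun_cong[OF eq, of i] by simp
  moreover have "z = chart_point (smult b G ^ r)"
  proof
    fix j
    show "z j = chart_point (smult b G ^ r) j"
      using fun_cong[OF eq, of j] \<open>coeff (smult b G ^ r) i = 1\<close> subsetD[OF Z_aff assms]
      by (auto simp: chart_point_def J_def aff_space_def)
  qed
  ultimately show ?thesis using that[of "smult b G"] G eq by auto
qed

lemma power_curve:
  obtains \<gamma> :: "nat \<Rightarrow> 'a poly"
  where "\<And>j t. poly (\<gamma> j) t = coeff ((U + smult t V) ^ r) j"
    and "\<And>j. poly (pderiv (\<gamma> j)) 0 = of_nat r * coeff (U ^ (r - 1) * V) j"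
proof -
  have "\<exists>q. \<forall>t. poly q t = coeff ((U + smult t V) ^ r) j \<and>
      poly (pderiv q) t = coeff (smult (of_nat r) ((U + smult t V) ^ (r - 1) * V)) j" for j
  proof -
    have "(\<lambda>t. coeff ((U + smult t V) ^ r * 1) j,
        \<lambda>t. coeff (smult (of_nat r) ((U + smult t V) ^ (r - 1) * V) * 1) j) \<in> curve_alg"
      using curve_line_power[of U V r 1] unfolding curve.coeffwise_def by blast
    then show ?thesis by (rule curve_algE) (metis mult.right_neutral)
  qed
  then obtain \<gamma> where \<gamma>: "\<And>j t. poly (\<gamma> j) t = coeff ((U + smult t V) ^ r) j"
    "\<And>j t. poly (pderiv (\<gamma> j)) t = coeff (smult (of_nat r) ((U + smult t V) ^ (r - 1) * V)) j"
    by metis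
  show ?thesis by (rule that[of \<gamma>]) (simp_all add: \<gamma>)
qed

lemma meval_chart_point:
  assumes "f \<in> mpoly_ring J" "\<And>j. x j = coeff F j"
  shows "meval (\<lambda>j. x j / x i) f = meval (chart_point F) f"
  by (rule meval_cong[OF assms(1)]) (simp add: chart_point_def assms(2))

text \<open>Two members \<open>U\<close>, \<open>V\<close> of the linear system are joined by a line, and hence their images by a rational
  curve. Two functions that do not vanish identically on this curve have only finitely many zeros on
  it, so their product does not vanish identically either.\<close>

lemma irreducible_linear_section:
  fixes P :: "'a poly \<Rightarrow> bool"
  assumes line: "\<And>U V t. P U \<Longrightarrow> P V \<Longrightarrow> P (U + smult t (V - U))"
    and deg: "\<And>U. P U \<Longrightarrow> degree U \<le> e"
    and nonempty: "\<exists>U. P U \<and> coeff (U ^ r) i \<noteq> 0"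
  shows "irreducible_in (subtopology (zariski J) Z) {chart_point (U ^ r) | U. P U \<and> coeff (U ^ r) i \<noteq> 0}"
    (is "irreducible_in _ ?C")
proof (rule irreducible_inI[OF Z_aff])
  show "?C \<subseteq> Z" using chart_point_in_Z deg by blast
  show "?C \<noteq> {}" using nonempty by blast
  fix f g assume f: "f \<in> mpoly_ring J" and g: "g \<in> mpoly_ring J"
    and fg: "\<forall>q\<in>?C. meval q f * meval q g = 0"
  show "(\<forall>q\<in>?C. meval q f = 0) \<or> (\<forall>q\<in>?C. meval q g = 0)"
  proof (rule ccontr)
    assume "\<not> ?thesis"
    then obtain U V where U: "P U" "coeff (U ^ r) i \<noteq> 0" "meval (chart_point (U ^ r)) f \<noteq> 0"
      and V: "P V" "coeff (V ^ r) i \<noteq> 0" "meval (chart_point (V ^ r)) g \<noteq> 0" by blast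
    obtain \<gamma> where \<gamma>: "\<And>j t. poly (\<gamma> j) t = coeff ((U + smult t (V - U)) ^ r) j"
      using power_curve[of U "V - U"] by metis
    obtain D p where p: "\<And>t. poly (\<gamma> i) t \<noteq> 0 \<Longrightarrow>
        poly p t = poly (\<gamma> i) t ^ D * meval (\<lambda>j. poly (\<gamma> j) t / poly (\<gamma> i) t) f"
      using rational_curve[OF finite_J f, of \<gamma> i] by blast
    obtain E q where q: "\<And>t. poly (\<gamma> i) t \<noteq> 0 \<Longrightarrow>
        poly q t = poly (\<gamma> i) t ^ E * meval (\<lambda>j. poly (\<gamma> j) t / poly (\<gamma> i) t) g"
      using rational_curve[OF finite_J g, of \<gamma> i] by blast
    have p': "poly p t = poly (\<gamma> i) t ^ D * meval (chart_point ((U + smult t (V - U)) ^ r)) f"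
      if "poly (\<gamma> i) t \<noteq> 0" for t
      using p[OF that] meval_chart_point[OF f \<gamma>] by simp
    have q': "poly q t = poly (\<gamma> i) t ^ E * meval (chart_point ((U + smult t (V - U)) ^ r)) g"
      if "poly (\<gamma> i) t \<noteq> 0" for t
      using q[OF that] meval_chart_point[OF g \<gamma>] by simp
    have "poly p 0 \<noteq> 0" using p'[of 0] \<gamma>[of i 0] U by simp
    then have "p \<noteq> 0" by auto
    have "poly q 1 \<noteq> 0" using q'[of 1] \<gamma>[of i 1] V by simp
    then have "q \<noteq> 0" by auto
    have "poly (\<gamma> i) 0 \<noteq> 0" using \<gamma>[of i 0] U by simp
    then have "\<gamma> i \<noteq> 0" by auto
    then have "p * q * \<gamma> i \<noteq> 0" using \<open>p \<noteq> 0\<close> \<open>q \<noteq> 0\<close> by simp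
    then obtain t where t: "poly (p * q * \<gamma> i) t \<noteq> 0" using poly_all_0_iff_0 by blast
    then have "coeff ((U + smult t (V - U)) ^ r) i \<noteq> 0" using \<gamma>[of i t] by auto
    with line[OF U(1) V(1), of t] have "chart_point ((U + smult t (V - U)) ^ r) \<in> ?C" by blast
    with fg have "meval (chart_point ((U + smult t (V - U)) ^ r)) f * meval (chart_point ((U + smult t (V - U)) ^ r)) g = 0"
      by blast
    then show False using t p'[of t] q'[of t] by auto
  qed
qed

text \<open>The sets \<open>A m\<close> of powers \<open>G^r\<close> with \<open>G(-1) = \<dots> = G(-m) = 0\<close> decrease strictly for \<open>m \<le> e\<close>. They
  are closed because \<open>G(-k) = 0\<close> is equivalent to the linear equation \<open>F(-k) = 0\<close> in the coefficients
  of \<open>F = G^r\<close>. The zeros are taken negative in order to have members with positive coefficients.\<close>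

lemma krull_dim_ge: "enat e \<le> krull_dim (subtopology (zariski J) Z)"
proof -
  \<comment> \<open>\<open>ev k\<close> is the value at \<open>- k\<close> of the polynomial whose \<open>i\<close>-th coefficient is normalised to \<open>1\<close>.\<close>
  define ev :: "nat \<Rightarrow> 'a mpoly" where
    "ev k = mconst ((- of_nat k) ^ i) + (\<Sum>j\<in>J. mconst ((- of_nat k) ^ j) * mvar j)" for k
  have ev_ring: "ev k \<in> mpoly_ring J" for k
    unfolding ev_def
    by (intro mpoly_ring_add mpoly_ring_const mpoly_ring_sum mpoly_ring_mult mpoly_ring_var)
  have ev: "meval (chart_point (G ^ r)) (ev k) = 0 \<longleftrightarrow> poly G (- of_nat k) = 0"
    if G: "degree G \<le> e" "coeff (G ^ r) i \<noteq> 0" for G k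
  proof -
    have "coeff (G ^ r) i * meval (chart_point (G ^ r)) (ev k) =
        coeff (G ^ r) i * (- of_nat k) ^ i + (\<Sum>j\<in>J. coeff (G ^ r) j * (- of_nat k) ^ j)"
      using G(2) by (simp add: ev_def meval_add meval_sum meval_mult meval_const meval_var chart_point_def
          algebra_simps sum_distrib_left)
    also have "\<dots> = (\<Sum>j\<le>d. coeff (G ^ r) j * (- of_nat k) ^ j)"
      using i by (simp add: J_def sum.remove[of "{..d}" i])
    also have "\<dots> = poly (G ^ r) (- of_nat k)"
      unfolding poly_altdef
      by (rule sum.mono_neutral_right) (use degree_power[OF G(1)] in \<open>auto simp: coeff_eq_0\<close>)
    finally have "meval (chart_point (G ^ r)) (ev k) = 0 \<longleftrightarrow> poly (G ^ r) (- of_nat k) = 0"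
      using G(2) by (metis mult_eq_0_iff)
    then show ?thesis using r by simp
  qed
  define P where "P m G \<longleftrightarrow> degree G \<le> e \<and> (\<forall>k\<in>{1..m}. poly G (- of_nat k) = 0)" for m and G :: "'a poly"
  define A where "A m = {z \<in> Z. \<forall>k\<in>{1..m}. meval z (ev k) = 0}" for m
  have A: "A m = {chart_point (U ^ r) | U. P m U \<and> coeff (U ^ r) i \<noteq> 0}" for m
  proof (intro equalityI subsetI)
    fix z assume z: "z \<in> A m"
    then obtain G where G: "degree G \<le> e" "z = chart_point (G ^ r)" "coeff (G ^ r) i = 1"
      using Z_elim[of z] unfolding A_def by blast
    moreover have "P m G" using z G ev[OF G(1)] by (auto simp: P_def A_def)
    ultimately show "z \<in> {chart_point (U ^ r) | U. P m U \<and> coeff (U ^ r) i \<noteq> 0}" by auto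
  next
    fix z assume "z \<in> {chart_point (U ^ r) | U. P m U \<and> coeff (U ^ r) i \<noteq> 0}"
    then show "z \<in> A m" using chart_point_in_Z ev by (auto simp: A_def P_def)
  qed
  \<comment> \<open>For \<open>m < e\<close> the power of \<open>Q m\<close> lies in \<open>A m\<close> but not in \<open>A (m + 1)\<close>: its remaining zeros are placed at \<open>- (e + 1)\<close>, beyond
    all the points that are used.\<close>
  define Q :: "nat \<Rightarrow> 'a poly" where "Q m = (\<Prod>k\<in>{1..m}. [:of_nat k, 1:]) * [:of_nat (Suc e), 1:] ^ (e - m)" for m
  have Q: "P m (Q m)" "coeff (Q m ^ r) i \<noteq> 0" "m < e \<Longrightarrow> \<not> P (Suc m) (Q m)" if m: "m \<le> e" for m
  proof -
    have "degree (\<Prod>k\<in>{1..m}. [:of_nat k, 1::'a:]) = m"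
      by (subst degree_prod_eq_sum_degree) auto
    moreover have "degree ([:of_nat (Suc e), 1::'a:] ^ (e - m)) \<le> e - m"
      using degree_power_le[of "[:of_nat (Suc e), 1::'a:]" "e - m"] by simp
    ultimately have "degree (Q m) \<le> e"
      unfolding Q_def using m degree_mult_le[of "\<Prod>k\<in>{1..m}. [:of_nat k, 1::'a:]" "[:of_nat (Suc e), 1::'a:] ^ (e - m)"]
      by linarith
    moreover have ev_Q: "poly (Q m) x = (\<Prod>k\<in>{1..m}. of_nat k + x) * (of_nat (Suc e) + x) ^ (e - m)" for x
      by (simp add: Q_def poly_prod)
    moreover have "poly (Q m) (- of_nat k) = 0" if "k \<in> {1..m}" for k
    proof -
      have "(\<Prod>j\<in>{1..m}. of_nat j + - of_nat k :: 'a) = 0"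
        by (rule prod_zero) (use that in auto)
      then show ?thesis unfolding ev_Q by simp
    qed
    ultimately show "P m (Q m)" by (simp add: P_def)
    have "pos_coeffs (card {1..m}) (\<Prod>k\<in>{1..m}. [:of_nat k, 1:] :: 'a poly)"
      by (rule pos_coeffs_prod[OF finite_atLeastAtMost], rule pos_coeffs_linear) simp
    moreover have "pos_coeffs ((e - m) * 1) ([:of_nat (Suc e), 1:] ^ (e - m) :: 'a poly)"
      by (intro pos_coeffs_power pos_coeffs_linear) simp
    ultimately have "pos_coeffs (card {1..m} + (e - m) * 1) (Q m)"
      unfolding Q_def by (rule pos_coeffs_mult)
    then have "pos_coeffs (r * e) (Q m ^ r)" using m by (intro pos_coeffs_power) simp
    then show "coeff (Q m ^ r) i \<noteq> 0" using pos_coeffs_nonzero i d by blast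
    show "\<not> P (Suc m) (Q m)" if "m < e"
    proof
      assume "P (Suc m) (Q m)"
      then have "poly (Q m) (- of_nat (Suc m)) = 0" by (simp add: P_def del: of_nat_Suc)
      then have "(\<exists>k\<in>{1..m}. of_nat k + - of_nat (Suc m) = (0 :: 'a)) \<or> of_nat (Suc e) + - of_nat (Suc m) = (0 :: 'a)"
        unfolding ev_Q by (auto simp del: of_nat_Suc)
      then show False using that by (auto simp del: of_nat_Suc)
    qed
  qed
  have irr: "irreducible_in (subtopology (zariski J) Z) (A m)" if "m \<le> e" for m
    unfolding A
  proof (rule irreducible_linear_section)
    show "degree U \<le> e" if "P m U" for U using that by (simp add: P_def)
    show "\<exists>U. P m U \<and> coeff (U ^ r) i \<noteq> 0" using Q[OF \<open>m \<le> e\<close>] by blast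
    show "P m (U + smult t (V - U))" if "P m U" "P m V" for U V t
      using that unfolding P_def
      by (auto intro!: degree_add_le degree_diff_le order_trans[OF degree_smult_le])
  qed
  have closed: "closedin (subtopology (zariski J) Z) (A m)" for m
  proof (induction m)
    case 0
    have "A 0 = topspace (subtopology (zariski J) Z)"
      by (simp add: A_def topspace_sub_zariski[OF Z_aff] del: topspace_subtopology)
    then show ?case by (simp only: closedin_topspace)
  next
    case (Suc m)
    have "A (Suc m) = A m \<inter> {z \<in> Z. meval z (ev (Suc m)) = 0}"
      unfolding A_def by (auto simp: atLeastAtMostSuc_conv)
    then show ?case using Suc closedin_zero_locus[OF ev_ring Z_aff] by (simp add: closedin_Int)
  qed
  have strict: "A (Suc m) \<subset> A m" if m: "m < e" for m
  proof
    show "A (Suc m) \<subseteq> A m" by (auto simp: A_def)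
    have Qm: "P m (Q m)" "coeff (Q m ^ r) i \<noteq> 0" "\<not> P (Suc m) (Q m)" using Q[of m] m by auto
    have deg: "degree (Q m) \<le> e" using Qm by (simp add: P_def)
    have "chart_point (Q m ^ r) \<in> A m" unfolding A using Qm by blast
    moreover have "chart_point (Q m ^ r) \<notin> A (Suc m)"
      using Qm(3) ev[OF deg Qm(2)] deg by (auto simp: A_def P_def)
    ultimately show "A (Suc m) \<noteq> A m" by blast
  qed
  have "(\<forall>k\<le>e. closedin (subtopology (zariski J) Z) (A (e - k)) \<and>
      irreducible_in (subtopology (zariski J) Z) (A (e - k))) \<and> (\<forall>k<e. A (e - k) \<subset> A (e - Suc k))"
    using closed irr strict by (metis Suc_diff_Suc diff_le_self diff_less_Suc not_less_eq zero_less_diff Suc_le_eq less_eq_Suc_le)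
  then show ?thesis unfolding krull_dim_def by (intro Sup_upper) (auto intro!: exI[of _ "\<lambda>k. A (e - k)"])
qed

text \<open>The inclusion from left to right linearizes the differential equation \<open>power_ode r F e = 0\<close>, whose
  coefficients lie in the ideal of the chart; the other one uses the curves \<open>(G + t H)^r\<close>.\<close>

lemma tangent_space_power_locus:
  assumes "degree G \<le> e" "coeff (G ^ r) i = 1"
  shows "tangent_space J Z (chart_point (G ^ r)) =
    {coeff (G ^ (r - 1) * H) | H. degree H \<le> e \<and> coeff (G ^ (r - 1) * H) i = 0}"
    (is "_ = ?W")
proof (intro equalityI subsetI)
  fix v assume v: "v \<in> tangent_space J Z (chart_point (G ^ r))"
  then have v_aff: "v \<in> aff_space J"
    and v_tan: "\<And>f. f \<in> vanishing_ideal J Z \<Longrightarrow> (\<Sum>j\<in>J. meval (chart_point (G ^ r)) (mpderiv j f) * v j) = 0"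
    by (auto simp: tangent_space_def)
  interpret M: function_algebra "mpoly_algebra J :: (((nat \<Rightarrow> 'a) \<times> (nat \<Rightarrow> 'a) \<Rightarrow> 'a) \<times> _) set"
    by (rule mpoly_function_algebra)
  \<comment> \<open>The generic point \<open>F\<close> of the chart as a polynomial, and its derivative \<open>F'\<close>: the \<open>i\<close>-th coefficient
    is fixed.\<close>
  define F where "F pv = (\<Sum>j\<le>d. monom (((fst pv)(i := 1)) j) j)" for pv :: "(nat \<Rightarrow> 'a) \<times> (nat \<Rightarrow> 'a)"
  define F' where "F' pv = (\<Sum>j\<in>J. monom (snd pv j) j)" for pv :: "(nat \<Rightarrow> 'a) \<times> (nat \<Rightarrow> 'a)"
  have coeff_F: "coeff (F pv) l = (if l \<le> d then ((fst pv)(i := 1)) l else 0)" for pv l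
    by (simp add: F_def coeff_sum)
  have coeff_F': "coeff (F' pv) l = (if l \<in> J then snd pv l else 0)" for pv l
    using finite_J by (simp add: F'_def coeff_sum)
  have "M.coeffwise F F'"
    unfolding M.coeffwise_def coeff_F coeff_F'
  proof
    fix l
    have "l \<in> J \<or> l = i \<or> l > d" by (auto simp: J_def)
    then consider "l \<in> J" | "l = i" | "l > d" by blast
    then show "(\<lambda>pv :: (nat \<Rightarrow> 'a) \<times> (nat \<Rightarrow> 'a). if l \<le> d then ((fst pv)(i := 1)) l else 0, \<lambda>pv. if l \<in> J then snd pv l else 0) \<in> mpoly_algebra J"
    proof cases
      case 1
      have "(\<Sum>j\<in>J. meval (fst pv) (mpderiv j (mvar l)) * snd pv j) = snd pv l" for pv :: "(nat \<Rightarrow> 'a) \<times> (nat \<Rightarrow> 'a)"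
      proof -
        have "(\<Sum>j\<in>J. meval (fst pv) (mpderiv j (mvar l)) * snd pv j) = (\<Sum>j\<in>J. if j = l then snd pv l else 0)"
          by (rule sum.cong) (auto simp: mpderiv_var meval_const)
        then show ?thesis using 1 finite_J by simp
      qed
      with mpoly_algebraI[OF mpoly_ring_var[OF 1, where ?'a = 'a]] 1 show ?thesis
        by (simp add: meval_var J_def)
    next
      case 2
      with M.alg_const[of 1] i show ?thesis by (simp add: J_def)
    next
      case 3
      with M.alg_const[of 0] show ?thesis by (simp add: J_def)
    qed
  qed
  from M.coeffwise_power_ode[OF this, of r e]
  have ode: "(\<lambda>pv. coeff (power_ode r (F pv) e) l, \<lambda>pv. coeff (power_ode_lin r (F pv) (F' pv) e) l) \<in> mpoly_algebra J" for l
    by (simp add: M.coeffwise_def)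
  have F_Z: "F (z, u) = K ^ r" if "degree K \<le> e" "z(i := 1) = coeff (K ^ r)" for z u K
    by (rule poly_eqI) (use that degree_power[OF that(1)] in \<open>auto simp: coeff_F coeff_eq_0\<close>)
  have lin: "coeff (power_ode_lin r (F (chart_point (G ^ r), v)) (F' (chart_point (G ^ r), v)) e) l = 0" for l
  proof -
    obtain f where f: "f \<in> mpoly_ring J" "(\<lambda>pv. coeff (power_ode r (F pv) e) l) = (\<lambda>pv. meval (fst pv) f)"
      "(\<lambda>pv. coeff (power_ode_lin r (F pv) (F' pv) e) l) = (\<lambda>pv. \<Sum>j\<in>J. meval (fst pv) (mpderiv j f) * snd pv j)"
      using ode[of l] by (auto simp: mpoly_algebra_def)
    have "meval z f = 0" if "z \<in> Z" for z
    proof -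
      obtain K where K: "degree K \<le> e" "K \<noteq> 0" "z(i := 1) = coeff (K ^ r)"
        using Z_elim[OF \<open>z \<in> Z\<close>] by metis
      have "meval z f = coeff (power_ode r (F (z, v)) e) l"
        using fun_cong[OF f(2), of "(z, v)"] by simp
      also have "F (z, v) = K ^ r" by (rule F_Z[OF K(1,3)])
      finally show ?thesis using power_ode_vanishes[OF r K(2,1)] by simp
    qed
    then have "f \<in> vanishing_ideal J Z" using f(1) by (simp add: vanishing_ideal_def)
    from v_tan[OF this] show ?thesis using fun_cong[OF f(3), of "(chart_point (G ^ r), v)"] by simp
  qed
  have G: "G \<noteq> 0" using assms(2) r by (auto simp: power_0_left)
  have "(chart_point (G ^ r))(i := 1) = coeff (G ^ r)"
    using assms(2) degree_power[OF assms(1)] i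
    by (auto simp: chart_point_def J_def fun_eq_iff coeff_eq_0)
  from F_Z[OF assms(1) this, of v] lin
  have "power_ode_lin r (G ^ r) (F' (chart_point (G ^ r), v)) e = 0" by (intro poly_eqI) simp
  then obtain H where H: "F' (chart_point (G ^ r), v) = G ^ (r - 1) * H" "degree H \<le> e"
    using power_ode_lin_kernel[OF r G assms(1)] by metis
  have "v = coeff (G ^ (r - 1) * H)"
    unfolding H(1)[symmetric] using v_aff by (auto simp: fun_eq_iff coeff_F' aff_space_def)
  moreover have "v i = 0" using v_aff by (simp add: aff_space_def J_def)
  ultimately show "v \<in> ?W" using H(2) by auto
next
  fix v assume "v \<in> ?W"
  then obtain H where H: "v = coeff (G ^ (r - 1) * H)" "degree H \<le> e" "v i = 0" by blast
  have "degree (G ^ (r - 1) * H) \<le> degree (G ^ (r - 1)) + degree H" by (rule degree_mult_le)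
  also have "\<dots> \<le> degree G * (r - 1) + e" using degree_power_le H(2) by (rule add_mono)
  also have "\<dots> \<le> e * (r - 1) + e" using assms(1) by simp
  also have "\<dots> = d" unfolding d using r by (cases r) auto
  finally have v_aff: "v \<in> aff_space J"
    using H by (auto simp: aff_space_def J_def coeff_eq_0)
  obtain \<gamma> where \<gamma>: "\<And>j t. poly (\<gamma> j) t = coeff ((G + smult t H) ^ r) j"
    "\<And>j. poly (pderiv (\<gamma> j)) 0 = of_nat r * v j"
    using power_curve[of G H] H(1) by metis
  have "(\<Sum>j\<in>J. meval (chart_point (G ^ r)) (mpderiv j f) * v j) = 0" if f: "f \<in> vanishing_ideal J Z" for f
  proof -
    have ring: "f \<in> mpoly_ring J" and van: "\<And>z. z \<in> Z \<Longrightarrow> meval z f = 0"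
      using f by (auto simp: vanishing_ideal_def)
    obtain D q where q: "\<And>t. poly (\<gamma> i) t \<noteq> 0 \<Longrightarrow>
        poly q t = poly (\<gamma> i) t ^ D * meval (\<lambda>j. poly (\<gamma> j) t / poly (\<gamma> i) t) f"
      and q': "poly (\<gamma> i) 0 = 1 \<Longrightarrow> poly (pderiv (\<gamma> i)) 0 = 0 \<Longrightarrow>
        poly (pderiv q) 0 = (\<Sum>j\<in>J. meval (\<lambda>j. poly (\<gamma> j) 0) (mpderiv j f) * poly (pderiv (\<gamma> j)) 0)"
      using rational_curve[OF finite_J ring, of \<gamma> i] by blast
    have \<gamma>0: "poly (\<gamma> i) 0 = 1" using \<gamma>(1)[of i 0] assms(2) by simp
    have "poly (q * \<gamma> i) t = 0" for t
    proof (cases "poly (\<gamma> i) t = 0")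
      case False
      have "degree (G + smult t H) \<le> e"
        using assms(1) H(2) by (intro degree_add_le) (auto intro: order_trans[OF degree_smult_le])
      then have "chart_point ((G + smult t H) ^ r) \<in> Z" using False \<gamma>(1)[of i t] by (intro chart_point_in_Z) auto
      then have "meval (\<lambda>j. poly (\<gamma> j) t / poly (\<gamma> i) t) f = 0"
        using meval_chart_point[OF ring \<gamma>(1)] van by simp
      then show ?thesis using q[OF False] by simp
    qed simp
    then have "q * \<gamma> i = 0" using poly_all_0_iff_0 by blast
    moreover have "\<gamma> i \<noteq> 0" using \<gamma>0 by auto
    ultimately have "q = 0" by simp
    then have "0 = (\<Sum>j\<in>J. meval (\<lambda>j. poly (\<gamma> j) 0) (mpderiv j f) * (of_nat r * v j))"
      using q' \<gamma>0 \<gamma>(2) H(3) by simp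
    also have "\<dots> = (\<Sum>j\<in>J. meval (chart_point (G ^ r)) (mpderiv j f) * (of_nat r * v j))"
    proof (rule sum.cong)
      fix j assume "j \<in> J"
      have "meval (\<lambda>j. poly (\<gamma> j) 0) (mpderiv j f) = meval (chart_point (G ^ r)) (mpderiv j f)"
        by (rule meval_cong[OF mpoly_ring_mpderiv[OF ring]]) (use \<gamma>(1)[of _ 0] assms(2) in \<open>simp add: chart_point_def\<close>)
      then show "meval (\<lambda>j. poly (\<gamma> j) 0) (mpderiv j f) * (of_nat r * v j) =
          meval (chart_point (G ^ r)) (mpderiv j f) * (of_nat r * v j)" by simp
    qed simp
    also have "\<dots> = of_nat r * (\<Sum>j\<in>J. meval (chart_point (G ^ r)) (mpderiv j f) * v j)"
      by (simp add: sum_distrib_left mult_ac)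
    finally show ?thesis using r by simp
  qed
  then show "v \<in> tangent_space J Z (chart_point (G ^ r))" using v_aff by (simp add: tangent_space_def)
qed

lemma dim_tangent_space:
  assumes "p \<in> Z"
  shows "fun_space.dim (tangent_space J Z p) = e"
proof -
  obtain G where G: "degree G \<le> e" "G \<noteq> 0" "p = chart_point (G ^ r)" "coeff (G ^ r) i = 1"
    using Z_elim[OF assms] by metis
  have "G ^ r = G ^ (r - 1) * G" using r by (simp add: power_eq_if)
  with G show ?thesis
    unfolding G(3) tangent_space_power_locus[OF G(1,4)]
    by (intro dim_multiples_hyperplane[of _ G]) auto
qed

end


section \<open>Coincident root loci via univariate polynomials\<close>

definition homogenization :: "nat \<Rightarrow> 'a::field poly \<Rightarrow> 'a mpoly" where
  "homogenization k p = (\<Sum>j\<le>k. Poly_Mapping.single (xy_monom (k - j) j) (coeff p j))"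

definition dehomogenization :: "nat \<Rightarrow> (nat \<Rightarrow> 'a::field) \<Rightarrow> 'a poly" where
  "dehomogenization k a = (\<Sum>j\<le>k. monom (a j) j)"

lemma coeff_dehomogenization: "coeff (dehomogenization k a) l = (if l \<le> k then a l else 0)"
  by (simp add: dehomogenization_def coeff_sum)

lemma degree_dehomogenization: "degree (dehomogenization k a) \<le> k"
  by (rule degree_le) (simp add: coeff_dehomogenization)

lemma binary_form_homogenization: "binary_form k a = homogenization k (dehomogenization k a)"
  unfolding binary_form_def homogenization_def by (rule sum.cong) (auto simp: coeff_dehomogenization)

lemma homogenization_add: "homogenization k (p + q) = homogenization k p + homogenization k q"
  by (simp add: homogenization_def single_add sum.distrib)

lemma homogenization_sum: "homogenization k (sum p S) = (\<Sum>s\<in>S. homogenization k (p s))"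
proof -
  have "homogenization k 0 = 0" by (simp add: homogenization_def)
  then show ?thesis
    by (induction S rule: infinite_finite_induct) (simp_all add: homogenization_add)
qed

lemma homogenization_monom:
  assumes "i \<le> k"
  shows "homogenization k (monom a i) = Poly_Mapping.single (xy_monom (k - i) i) a"
proof -
  have "homogenization k (monom a i) =
      (\<Sum>j\<le>k. if j = i then Poly_Mapping.single (xy_monom (k - i) i) a else 0)"
    unfolding homogenization_def by (rule sum.cong) auto
  then show ?thesis using assms by simp
qed

lemma xy_monom_add: "xy_monom a b + xy_monom c d = xy_monom (a + c) (b + d)"
  by (simp add: xy_monom_def single_add algebra_simps)

text \<open>The degree bounds prevent truncation, so that by bilinearity it suffices to look at products of
  monomials.\<close>

lemma homogenization_mult:
  assumes "degree p \<le> k" "degree q \<le> l"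
  shows "homogenization (k + l) (p * q) = homogenization k p * homogenization l q"
proof -
  have "homogenization (k + l) (p * q) =
      homogenization (k + l) (\<Sum>i\<le>k. \<Sum>j\<le>l. monom (coeff p i * coeff q j) (i + j))"
    by (subst poly_as_sum_monom[OF assms(1)], subst poly_as_sum_monom[OF assms(2)])
      (simp add: sum_product mult_monom)
  also have "\<dots> = (\<Sum>i\<le>k. \<Sum>j\<le>l. Poly_Mapping.single (xy_monom (k - i) i) (coeff p i) *
      Poly_Mapping.single (xy_monom (l - j) j) (coeff q j))"
    unfolding homogenization_sum
    by (intro sum.cong refl) (auto simp: homogenization_monom mult_single xy_monom_add)
  also have "\<dots> = homogenization k p * homogenization l q"
    by (simp add: homogenization_def sum_product)
  finally show ?thesis .
qed

lemma homogenization_one: "homogenization 0 1 = 1"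
  by (simp add: homogenization_def xy_monom_def)

lemma homogenization_power:
  assumes "degree p \<le> k"
  shows "homogenization k p ^ n = homogenization (n * k) (p ^ n) \<and> degree (p ^ n) \<le> n * k"
proof (induction n)
  case (Suc n)
  then show ?case
    using homogenization_mult[OF assms, of "p ^ n" "n * k"] degree_mult_le[of p "p ^ n"] assms by simp
qed (simp add: homogenization_one)

lemma homogenization_prod:
  assumes "finite S" "\<And>s. s \<in> S \<Longrightarrow> degree (p s) \<le> k s"
  shows "(\<Prod>s\<in>S. homogenization (k s) (p s)) = homogenization (\<Sum>s\<in>S. k s) (\<Prod>s\<in>S. p s) \<and>
    degree (\<Prod>s\<in>S. p s) \<le> (\<Sum>s\<in>S. k s)"
  using assms
proof (induction S rule: finite_induct)
  case (insert s S)
  have s: "degree (p s) \<le> k s" by (rule insert.prems) simp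
  have S: "(\<Prod>s\<in>S. homogenization (k s) (p s)) = homogenization (\<Sum>s\<in>S. k s) (\<Prod>s\<in>S. p s)"
    "degree (\<Prod>s\<in>S. p s) \<le> (\<Sum>s\<in>S. k s)"
    using insert by auto
  have "degree (p s * (\<Prod>s\<in>S. p s)) \<le> k s + (\<Sum>s\<in>S. k s)"
    by (rule order_trans[OF degree_mult_le add_mono[OF s S(2)]])
  then show ?case using insert(1,2) homogenization_mult[OF s S(2)] S(1) by simp
qed (simp add: homogenization_one)

lemma form_coords_homogenization:
  assumes "degree F \<le> d"
  shows "form_coords d (homogenization d F) = coeff F"
proof
  fix j
  have eq: "xy_monom (d - l) l = xy_monom (d - j) j \<longleftrightarrow> l = j" for l
  proof (intro iffI)
    assume "xy_monom (d - l) l = xy_monom (d - j) j"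
    then have "Poly_Mapping.lookup (xy_monom (d - l) l) 1 = Poly_Mapping.lookup (xy_monom (d - j) j) 1" by simp
    then show "l = j" by (simp add: xy_monom_def lookup_add lookup_single)
  qed simp
  have "Poly_Mapping.lookup (homogenization d F) (xy_monom (d - j) j) = (\<Sum>l\<le>d. if l = j then coeff F j else 0)"
    unfolding homogenization_def lookup_sum
    by (rule sum.cong) (auto simp: lookup_single when_def eq)
  then show "form_coords d (homogenization d F) j = coeff F j"
    using assms by (auto simp: form_coords_def coeff_eq_0)
qed

text \<open>The factors are indexed by an arbitrary set of the right size; if the degree is smaller, constants
  take the place of the missing factors, which are the linear forms proportional to \<open>x\<close>.\<close>

lemma linear_factorization:
  fixes p :: "'a::alg_closed_field poly"
  assumes "finite S" "p \<noteq> 0" "degree p \<le> card S"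
  shows "\<exists>c L. c \<noteq> 0 \<and> p = smult c (\<Prod>s\<in>S. L s) \<and> (\<forall>s\<in>S. L s \<noteq> 0 \<and> degree (L s) \<le> 1)"
  using assms
proof (induction S arbitrary: p rule: finite_induct)
  case empty
  then have "degree p = 0" by simp
  then obtain c where "p = [:c:]" by (rule degree_eq_zeroE)
  moreover from this empty have "c \<noteq> 0" by simp
  ultimately show ?case by (intro exI[of _ c]) simp
next
  case (insert x S)
  have "\<exists>K q. p = K * q \<and> K \<noteq> 0 \<and> degree K \<le> 1 \<and> q \<noteq> 0 \<and> degree q \<le> card S"
  proof (cases "degree p \<le> card S")
    case True
    then show ?thesis using insert by (intro exI[of _ 1] exI[of _ p]) simp
  next
    case False
    then obtain a where "poly p a = 0" using alg_closed_imp_poly_has_root[of p] by auto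
    then obtain q where q: "p = [:- a, 1:] * q" by (auto simp: poly_eq_0_iff_dvd)
    then have "q \<noteq> 0" using insert by auto
    then have "degree p = Suc (degree q)" unfolding q by (subst degree_mult_eq) auto
    then have "degree q \<le> card S" using insert by simp
    with q \<open>q \<noteq> 0\<close> show ?thesis by (intro exI[of _ "[:- a, 1:]"] exI[of _ q]) simp
  qed
  then obtain K q where K: "p = K * q" "K \<noteq> 0" "degree K \<le> 1" and q: "q \<noteq> 0" "degree q \<le> card S"
    by blast
  obtain c L where cL: "c \<noteq> 0" "q = smult c (\<Prod>s\<in>S. L s)" "\<forall>s\<in>S. L s \<noteq> 0 \<and> degree (L s) \<le> 1"
    using insert.IH[OF q] by blast
  have "(\<Prod>s\<in>S. (L(x := K)) s) = (\<Prod>s\<in>S. L s)"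
    by (rule prod.cong) (use insert in auto)
  then have "p = smult c (\<Prod>s\<in>insert x S. (L(x := K)) s)"
    using insert K(1) cL(2) by simp
  then show ?case using K cL by (intro exI[of _ c] exI[of _ "L(x := K)"]) auto
qed

text \<open>One index \<open>(r, l)\<close> for each part of the partition, where \<open>r\<close> is the part and \<open>l\<close> counts its repetitions.
  The map \<open>fst\<close> then gives the exponents in \<open>\<Prod>s. L\<^sub>s ^ w\<^sub>s\<close>.\<close>

definition parts :: "nat \<Rightarrow> nat list \<Rightarrow> (nat \<times> nat) set" where
  "parts d lam = (SIGMA r:{1..d}. {..<count_list lam r})"

lemma partition_parts:
  assumes "is_partition d lam"
  shows "set lam \<subseteq> {1..d}" "finite (parts d lam)" "card (parts d lam) = length lam"
    "(\<Sum>s\<in>parts d lam. fst s) = d" "\<And>s. s \<in> parts d lam \<Longrightarrow> fst s > 0"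
    "(\<Sum>r\<in>{1..d}. r * count_list lam r) = d"
proof -
  show set: "set lam \<subseteq> {1..d}"
    using assms member_le_sum_list[of _ lam] by (fastforce simp: is_partition_def)
  show "finite (parts d lam)" by (simp add: parts_def)
  show "card (parts d lam) = length lam"
    using sum_count_set[OF set] by (simp add: parts_def)
  have "sum_list (map (\<lambda>x. x) lam) = (\<Sum>r\<in>{1..d}. count_list lam r * r)"
    by (rule sum_list_map_eq_sum_count2[OF set]) simp
  then show sum: "(\<Sum>r\<in>{1..d}. r * count_list lam r) = d"
    using assms by (simp add: is_partition_def mult.commute)
  have "(\<Sum>s\<in>parts d lam. fst s) = (\<Sum>r\<in>{1..d}. \<Sum>l\<in>{..<count_list lam r}. r)"
    unfolding parts_def by (subst sum.Sigma) (auto simp: case_prod_unfold)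
  then show "(\<Sum>s\<in>parts d lam. fst s) = d" using sum by (simp add: mult.commute)
  show "\<And>s. s \<in> parts d lam \<Longrightarrow> fst s > 0" by (auto simp: parts_def)
qed

lemma form_of_parts:
  "form_of (parts d lam) fst L = (\<Prod>r\<in>{1..d}. (\<Prod>l\<in>{..<count_list lam r}. L (r, l)) ^ r)"
proof -
  have "form_of (parts d lam) fst L = (\<Prod>r\<in>{1..d}. \<Prod>l\<in>{..<count_list lam r}. L (r, l) ^ r)"
    unfolding form_of_def parts_def by (subst prod.Sigma) (auto intro!: prod.cong)
  then show ?thesis by (simp add: prod_power_distrib)
qed

lemma f_map_eq:
  assumes "is_partition d lam"
  shows "f_map d lam G =
    proj_point (coeff (\<Prod>r\<in>{1..d}. dehomogenization (count_list lam r) (G r) ^ r))"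
proof -
  let ?p = "\<lambda>r. dehomogenization (count_list lam r) (G r)"
  have pow: "binary_form (count_list lam r) (G r) ^ r = homogenization (r * count_list lam r) (?p r ^ r)"
    and deg: "degree (?p r ^ r) \<le> r * count_list lam r" for r
    using homogenization_power[OF degree_dehomogenization[of "count_list lam r" "G r"], of r]
    by (simp_all add: binary_form_homogenization)
  have "(\<Prod>r\<in>{1..d}. binary_form (count_list lam r) (G r) ^ r) = homogenization d (\<Prod>r\<in>{1..d}. ?p r ^ r)"
    and "degree (\<Prod>r\<in>{1..d}. ?p r ^ r) \<le> d"
    using homogenization_prod[of "{1..d}" "\<lambda>r. ?p r ^ r" "\<lambda>r. r * count_list lam r"] deg
      partition_parts(6)[OF assms] by (simp_all add: pow)
  then show ?thesis by (simp add: f_map_def form_coords_homogenization)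
qed

lemma coeff_smult_fscale: "coeff (smult c p) = fscale c (coeff p)"
  by (simp add: fun_eq_iff fscale_def)

lemma coincident_root_locus_eq:
  assumes "is_partition d lam"
  shows "(coincident_root_locus d lam :: (nat \<Rightarrow> 'a::alg_closed_field) set set) =
    {proj_point (coeff (form_of (parts d lam) fst L)) | L.
       \<forall>s\<in>parts d lam. L s \<noteq> 0 \<and> degree (L s) \<le> 1}"
proof (intro equalityI subsetI)
  fix x :: "(nat \<Rightarrow> 'a) set"
  assume "x \<in> coincident_root_locus d lam"
  then obtain G where G: "G \<in> Y_coords d lam" and x: "x = f_map d lam G"
    by (auto simp: coincident_root_locus_def)
  let ?p = "\<lambda>r. dehomogenization (count_list lam r) (G r)"
  have "\<exists>c L. c \<noteq> 0 \<and> ?p r = smult c (\<Prod>l\<in>{..<count_list lam r}. L l) \<and>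
      (\<forall>l\<in>{..<count_list lam r}. L l \<noteq> 0 \<and> degree (L l) \<le> 1)" if r: "r \<in> {1..d}" for r
  proof (rule linear_factorization)
    have Gr: "G r \<in> hom_coords (count_list lam r)" using G r by (auto simp: Y_coords_def)
    then obtain j where j: "G r j \<noteq> 0" by (auto simp: hom_coords_def fun_eq_iff)
    then have "j \<le> count_list lam r" using Gr by (auto simp: hom_coords_def aff_space_def)
    then have "coeff (?p r) j \<noteq> 0" using j by (simp add: coeff_dehomogenization)
    then show "?p r \<noteq> 0" by auto
  qed (simp_all add: degree_dehomogenization)
  then obtain c L where cL: "\<And>r. r \<in> {1..d} \<Longrightarrow> c r \<noteq> 0"
    "\<And>r. r \<in> {1..d} \<Longrightarrow> ?p r = smult (c r) (\<Prod>l\<in>{..<count_list lam r}. L r l)"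
    "\<And>r l. r \<in> {1..d} \<Longrightarrow> l \<in> {..<count_list lam r} \<Longrightarrow> L r l \<noteq> 0 \<and> degree (L r l) \<le> 1"
    by metis
  have "(\<Prod>r\<in>{1..d}. ?p r ^ r) = (\<Prod>r\<in>{1..d}. smult (c r ^ r) ((\<Prod>l\<in>{..<count_list lam r}. L r l) ^ r))"
    by (rule prod.cong) (simp_all add: cL(2) smult_power)
  also have "\<dots> = smult (\<Prod>r\<in>{1..d}. c r ^ r) (form_of (parts d lam) fst (\<lambda>(r, l). L r l))"
    by (simp add: form_of_parts prod_smult)
  finally have "x = proj_point (fscale (\<Prod>r\<in>{1..d}. c r ^ r) (coeff (form_of (parts d lam) fst (\<lambda>(r, l). L r l))))"
    unfolding x f_map_eq[OF assms] by (simp add: coeff_smult_fscale)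
  also have "\<dots> = proj_point (coeff (form_of (parts d lam) fst (\<lambda>(r, l). L r l)))"
    by (rule proj_point_scale) (use cL(1) in \<open>simp add: prod_zero_iff\<close>)
  finally show "x \<in> {proj_point (coeff (form_of (parts d lam) fst L)) | L.
       \<forall>s\<in>parts d lam. L s \<noteq> 0 \<and> degree (L s) \<le> 1}"
    using cL(3) by (auto simp: parts_def intro!: exI[of _ "\<lambda>(r, l). L r l"])
next
  fix x :: "(nat \<Rightarrow> 'a) set"
  assume "x \<in> {proj_point (coeff (form_of (parts d lam) fst L)) | L.
       \<forall>s\<in>parts d lam. L s \<noteq> 0 \<and> degree (L s) \<le> 1}"
  then obtain L where x: "x = proj_point (coeff (form_of (parts d lam) fst L))"
    and L: "\<And>s. s \<in> parts d lam \<Longrightarrow> L s \<noteq> 0 \<and> degree (L s) \<le> 1" by blast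
  define p where "p r = (\<Prod>l\<in>{..<count_list lam r}. L (r, l))" for r
  define G where "G = (\<lambda>r\<in>{1..d}. coeff (p r))"
  have p: "p r \<noteq> 0" "degree (p r) \<le> count_list lam r" if "r \<in> {1..d}" for r
  proof -
    have Lr: "L (r, l) \<noteq> 0 \<and> degree (L (r, l)) \<le> 1" if "l < count_list lam r" for l
      using L that \<open>r \<in> {1..d}\<close> by (auto simp: parts_def)
    then show "p r \<noteq> 0" by (simp add: p_def)
    have "degree (p r) \<le> (\<Sum>l\<in>{..<count_list lam r}. degree (L (r, l)))"
      unfolding p_def using degree_prod_sum_le[of "{..<count_list lam r}" "\<lambda>l. L (r, l)"] by simp
    also have "\<dots> \<le> (\<Sum>l\<in>{..<count_list lam r}. 1)"
      by (rule sum_mono) (use Lr in auto)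
    finally show "degree (p r) \<le> count_list lam r" by simp
  qed
  have "coeff (p r) \<in> hom_coords (count_list lam r)" if "r \<in> {1..d}" for r
  proof -
    have "coeff (p r) (degree (p r)) \<noteq> 0" using p(1)[OF that] by simp
    then have "coeff (p r) \<noteq> 0" by (metis zero_fun_apply)
    then show ?thesis using p(2)[OF that] by (auto simp: hom_coords_def aff_space_def coeff_eq_0)
  qed
  then have "G \<in> Y_coords d lam" by (auto simp: G_def Y_coords_def)
  moreover have "dehomogenization (count_list lam r) (G r) = p r" if "r \<in> {1..d}" for r
    by (rule poly_eqI) (use p(2)[OF that] that in \<open>auto simp: coeff_dehomogenization G_def coeff_eq_0\<close>)
  then have "f_map d lam G = x"
    unfolding f_map_eq[OF assms] x form_of_parts p_def[symmetric]
    by (intro arg_cong[of _ _ proj_point] arg_cong[of _ _ coeff] prod.cong) auto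
  ultimately show "x \<in> coincident_root_locus d lam" unfolding coincident_root_locus_def by blast
qed


section \<open>The smoothness criterion\<close>

lemma krull_dim_chart_le:
  fixes X :: "(nat \<Rightarrow> 'a::alg_closed_field) set set"
  assumes "is_partition d lam" "X = coincident_root_locus d lam"
  shows "krull_dim (subtopology (zariski ({..d} - {i})) (proj_chart d i X)) \<le> enat (length lam)"
  unfolding partition_parts(3)[OF assms(1), symmetric]
proof (rule krull_dim_le_card[OF partition_parts(2)[OF assms(1)]])
  show "proj_chart d i X \<subseteq> aff_space ({..d} - {i})" by (auto simp: proj_chart_def)
  fix z assume z: "z \<in> proj_chart d i X"
  then have "proj_point (z(i := 1)) \<in> X" by (simp add: proj_chart_def)
  then obtain L where L: "proj_point (z(i := 1)) = proj_point (coeff (form_of (parts d lam) fst L))"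
    "\<forall>s\<in>parts d lam. degree (L s) \<le> 1"
    unfolding assms(2) coincident_root_locus_eq[OF assms(1)] by blast
  obtain c where c: "c \<noteq> 0" "z(i := 1) = fscale c (coeff (form_of (parts d lam) fst L))"
    using proj_point_eqD[OF L(1)] by blast
  have eq: "(if j = i then 1 else z j) = c * coeff (form_of (parts d lam) fst L) j" for j
    using fun_cong[OF c(2), of j] by (simp add: fscale_def)
  have i: "c * coeff (form_of (parts d lam) fst L) i = 1" using eq[of i] by simp
  have "z j = coeff (form_of (parts d lam) fst L) j / coeff (form_of (parts d lam) fst L) i" if "j \<noteq> i" for j
  proof -
    have "z j = z j / (c * coeff (form_of (parts d lam) fst L) i)" using i by simp
    also have "\<dots> = coeff (form_of (parts d lam) fst L) j / coeff (form_of (parts d lam) fst L) i"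
      using eq[of j] that c(1) by simp
    finally show ?thesis .
  qed
  then show "\<exists>L. (\<forall>s\<in>parts d lam. degree (L s) \<le> 1) \<and> coeff (form_of (parts d lam) fst L) i \<noteq> 0 \<and>
      (\<forall>j\<in>{..d} - {i}. z j = coeff (form_of (parts d lam) fst L) j / coeff (form_of (parts d lam) fst L) i)"
    using L(2) i by (intro exI[of _ L]) auto
qed

text \<open>If all parts equal \<open>r\<close> then \<open>\<Prod>s. L\<^sub>s^r\<close> is an \<open>r\<close>-th power, and conversely every nonzero polynomial
  of degree at most \<open>e\<close> is, up to a scalar, a product of \<open>e\<close> linear forms.\<close>

lemma smooth_even_locus:
  fixes X :: "(nat \<Rightarrow> 'a::{alg_closed_field, field_char_0}) set set"
  assumes "d \<ge> 1" and lam: "is_partition d lam" and X_def: "X = coincident_root_locus d lam"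
    and even: "even_partition lam"
  shows "proj_smooth d X"
proof -
  have "lam \<noteq> []" using assms by (auto simp: is_partition_def)
  define r where "r = lam ! 0"
  define e where "e = length lam"
  let ?I = "parts d lam"
  have all_r: "x = r" if "x \<in> set lam" for x
    using that even \<open>lam \<noteq> []\<close> unfolding in_set_conv_nth even_partition_def r_def by auto
  have r: "r \<ge> 1" using lam \<open>lam \<noteq> []\<close> by (auto simp: is_partition_def r_def Suc_le_eq)
  have fst_r: "fst s = r" if "s \<in> ?I" for s
  proof -
    obtain a l where s: "s = (a, l)" by (cases s)
    with that have "l < count_list lam a" by (simp add: parts_def)
    then have "count_list lam a \<noteq> 0" by simp
    then have "a \<in> set lam" by (simp add: count_list_0_iff)
    then show ?thesis using all_r s by simp
  qed
  have d: "d = r * e"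
    using partition_parts(3,4)[OF lam] fst_r by (simp add: e_def mult.commute)
  have form: "form_of ?I fst L = (\<Prod>s\<in>?I. L s) ^ r" for L :: "nat \<times> nat \<Rightarrow> 'a poly"
    unfolding form_of_def prod_power_distrib by (rule prod.cong) (simp_all add: fst_r)
  have X: "X = {proj_point (coeff (G ^ r)) | G. G \<noteq> 0 \<and> degree G \<le> e}"
  proof (intro equalityI subsetI)
    fix x assume "x \<in> X"
    then obtain L where x: "x = proj_point (coeff ((\<Prod>s\<in>?I. L s) ^ r))"
      and L: "\<forall>s\<in>?I. L s \<noteq> 0 \<and> degree (L s) \<le> 1"
      unfolding X_def coincident_root_locus_eq[OF lam] form by blast
    have "degree (\<Prod>s\<in>?I. L s) \<le> (\<Sum>s\<in>?I. degree (L s))"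
      using degree_prod_sum_le[OF partition_parts(2)[OF lam], of L] by simp
    also have "\<dots> \<le> (\<Sum>s\<in>?I. 1)" by (rule sum_mono) (use L in auto)
    finally have "degree (\<Prod>s\<in>?I. L s) \<le> e" using partition_parts(3)[OF lam] by (simp add: e_def)
    moreover have "(\<Prod>s\<in>?I. L s) \<noteq> 0" using L partition_parts(2)[OF lam] by simp
    ultimately show "x \<in> {proj_point (coeff (G ^ r)) | G. G \<noteq> 0 \<and> degree G \<le> e}"
      using x by blast
  next
    fix x :: "(nat \<Rightarrow> 'a) set"
    assume "x \<in> {proj_point (coeff (G ^ r)) | G. G \<noteq> 0 \<and> degree G \<le> e}"
    then obtain G :: "'a poly" where x: "x = proj_point (coeff (G ^ r))" and G: "G \<noteq> 0" "degree G \<le> e"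
      by blast
    obtain c L where cL: "c \<noteq> 0" "G = smult c (\<Prod>s\<in>?I. L s)" "\<forall>s\<in>?I. L s \<noteq> 0 \<and> degree (L s) \<le> 1"
      using linear_factorization[OF partition_parts(2)[OF lam] G(1)] G(2) partition_parts(3)[OF lam]
      unfolding e_def by auto
    have "x = proj_point (fscale (c ^ r) (coeff (form_of ?I fst L)))"
      unfolding x form cL(2) by (simp add: smult_power coeff_smult_fscale)
    also have "\<dots> = proj_point (coeff (form_of ?I fst L))"
      by (rule proj_point_scale) (use cL(1) in simp)
    finally show "x \<in> X" unfolding X_def coincident_root_locus_eq[OF lam] using cL(3) by blast
  qed
  show ?thesis unfolding proj_smooth_def
  proof (intro allI impI ballI)
    fix i p assume i: "i \<le> d" and p: "p \<in> proj_chart d i X"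
    interpret power_locus r e d i X
      by unfold_locales (fact r d i X)+
    have "krull_dim (subtopology (zariski J) Z) = enat e"
      using krull_dim_ge krull_dim_chart_le[OF lam X_def, of i] by (simp add: J_def Z_def e_def)
    moreover have "fun_space.dim (tangent_space J Z p) = e"
      using dim_tangent_space p by (simp add: Z_def)
    ultimately show "aff_smooth_at ({..d} - {i}) (proj_chart d i X) p"
      by (simp add: aff_smooth_at_def J_def Z_def)
  qed
qed

text \<open>The singular point is \<open>x^d\<close>, the origin of the chart \<open>a\<^sub>0 = 1\<close>. Since some part exceeds \<open>1\<close>, the
  chart has at least \<open>e + 1\<close> coordinates, and the first \<open>e + 1\<close> coordinate directions are tangent.\<close>

lemma singular_uneven_locus:
  fixes X :: "(nat \<Rightarrow> 'a::{alg_closed_field, field_char_0}) set set"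
  assumes lam: "is_partition d lam" and X_def: "X = coincident_root_locus d lam"
    and uneven: "\<not> even_partition lam"
  shows "\<not> proj_smooth d X"
proof -
  let ?I = "parts d lam"
  define Z where "Z = proj_chart d 0 X"
  define J where "J = {..d} - {0 :: nat}"
  have J: "J = {1..d}" by (auto simp: J_def)
  obtain a b where ab: "a \<in> set lam" "b \<in> set lam" "a \<noteq> b"
    using uneven unfolding even_partition_def by (metis nth_mem)
  have idx: "(x, 0) \<in> ?I" if "x \<in> set lam" for x
    using that partition_parts(1)[OF lam] count_list_0_iff[of lam x] by (auto simp: parts_def)
  have fin: "finite ?I" and pos: "\<And>s. s \<in> ?I \<Longrightarrow> fst s > 0"
    using partition_parts[OF lam] by auto
  have card: "card ?I < d"
  proof -
    have "\<exists>s\<in>?I. 1 < fst s"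
    proof (cases "a = 1")
      case True
      then have "b > 1" using ab pos[OF idx[OF ab(2)]] by auto
      then show ?thesis using idx[OF ab(2)] by force
    next
      case False
      then have "a > 1" using pos[OF idx[OF ab(1)]] by auto
      then show ?thesis using idx[OF ab(1)] by force
    qed
    then have "(\<Sum>s\<in>?I. 1) < (\<Sum>s\<in>?I. fst s)"
      using fin pos by (intro sum_strict_mono_ex1) (auto simp: Suc_le_eq)
    then show ?thesis using partition_parts(4)[OF lam] by simp
  qed
  have point: "(\<lambda>j. if j \<in> J then coeff (form_of ?I fst (\<lambda>s. [:1, b s:])) j else 0) \<in> Z" for b :: "nat \<times> nat \<Rightarrow> 'a"
  proof -
    let ?F = "form_of ?I fst (\<lambda>s. [:1, b s:])"
    have deg: "degree ?F \<le> d"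
      using degree_form_of[OF fin, of "\<lambda>s. [:1, b s:]" fst] partition_parts(4)[OF lam] by simp
    have "(\<lambda>j. if j \<in> J then coeff ?F j else 0)(0 := 1) = coeff ?F"
      using deg coeff_form_of_low(1)[OF fin, of fst b] by (auto simp: fun_eq_iff J_def coeff_eq_0)
    moreover have "proj_point (coeff ?F) \<in> X"
      unfolding X_def coincident_root_locus_eq[OF lam] by (auto intro!: exI[of _ "\<lambda>s. [:1, b s:]"])
    ultimately show ?thesis by (auto simp: Z_def proj_chart_def J_def aff_space_def)
  qed
  have one: "form_of ?I fst (\<lambda>s. [:1, 0:]) = (1 :: 'a poly)" by (simp add: form_of_def one_pCons[symmetric])
  have "(\<lambda>j. if j \<in> J then coeff (1 :: 'a poly) j else 0) \<in> Z"
    using point[of "\<lambda>_. 0"] by (simp only: one)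
  moreover have "(\<lambda>j. if j \<in> J then coeff (1 :: 'a poly) j else 0) = (\<lambda>_. 0)"
    by (auto simp: fun_eq_iff J_def)
  ultimately have origin: "(\<lambda>_. 0) \<in> Z" by simp
  define u :: "nat \<Rightarrow> nat \<Rightarrow> 'a" where "u k = (\<lambda>j. if j = Suc k then 1 else 0)" for k
  have u_tangent: "u k \<in> tangent_space J Z (\<lambda>_. 0)" if k: "k \<in> {..card ?I}" for k
  proof -
    have kd: "k < d" "Suc k \<in> J" using k card by (auto simp: J_def)
    have "(\<Sum>j\<in>J. meval (\<lambda>_. 0) (mpderiv j f) * u k j) = 0" if f: "f \<in> vanishing_ideal J Z" for f
    proof -
      have ring: "f \<in> mpoly_ring {1..d}" using f by (simp add: vanishing_ideal_def J)
      have "meval (coeff (form_of ?I fst (\<lambda>s. [:1, b s:]))) f = 0" for b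
      proof -
        have "meval (coeff (form_of ?I fst (\<lambda>s. [:1, b s:]))) f =
            meval (\<lambda>j. if j \<in> J then coeff (form_of ?I fst (\<lambda>s. [:1, b s:])) j else 0) f"
          by (rule meval_cong[OF ring]) (simp add: J)
        then show ?thesis using f point by (simp add: vanishing_ideal_def)
      qed
      then have "meval (\<lambda>_. 0) (mpderiv (Suc k) f) = 0"
        using linear_derivatives_vanish[OF fin pos idx[OF ab(1)] idx[OF ab(2)] _ ring _ kd(1)] ab(3) k
        by simp
      then show ?thesis by (intro sum.neutral) (auto simp: u_def)
    qed
    moreover have "u k \<in> aff_space J" using kd by (auto simp: aff_space_def u_def)
    ultimately show ?thesis by (simp add: tangent_space_def)
  qed
  have "fun_space.independent (u ` {..card ?I})" and u_card: "card (u ` {..card ?I}) = Suc (card ?I)"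
  proof -
    have "\<forall>s\<in>{..card ?I}. c s = 0" if c: "\<forall>j. (\<Sum>s\<in>{..card ?I}. c s * u s j) = 0" for c
    proof
      fix s assume s: "s \<in> {..card ?I}"
      have "(\<Sum>k\<in>{..card ?I}. c k * u k (Suc s)) = (\<Sum>k\<in>{..card ?I}. if k = s then c s else 0)"
        by (rule sum.cong) (auto simp: u_def)
      then show "c s = 0" using c s by simp
    qed
    then show "fun_space.independent (u ` {..card ?I})" "card (u ` {..card ?I}) = Suc (card ?I)"
      using family_independent[of "{..card ?I}" u] by simp_all
  qed
  then have "Suc (card ?I) \<le> fun_space.dim (tangent_space J Z (\<lambda>_. 0))"
    unfolding u_card[symmetric]
    by (intro card_le_dim[of J]) (use u_tangent in \<open>auto simp: J tangent_space_def\<close>)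
  moreover have "krull_dim (subtopology (zariski J) Z) \<le> enat (card ?I)"
    using krull_dim_chart_le[OF lam X_def, of 0] partition_parts(3)[OF lam] by (simp add: J_def Z_def)
  ultimately have "\<not> aff_smooth_at J Z (\<lambda>_. 0)"
    unfolding aff_smooth_at_def by (metis Suc_n_not_le_n enat_ord_simps(1) order_trans)
  then show ?thesis using origin unfolding proj_smooth_def J_def Z_def by blast
qed

theorem corollary2p2:
  fixes d :: nat and lam :: "nat list"
  assumes "d \<ge> 1" and "is_partition d lam"
  shows "proj_smooth d
           (coincident_root_locus d lam :: (nat \<Rightarrow> 'a::{alg_closed_field, field_char_0}) set set)
         \<longleftrightarrow> even_partition lam"
  using smooth_even_locus[OF assms refl] singular_uneven_locus[OF assms(2) refl] by blast

end
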